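(* Let $h\ge1$ be an integer, let $\epsilon>0$ be a target suboptimality and $\delta>0$ a probability threshold. Suppose inexact $h$-PMD, started from $\pi_0\in\mathrm{ri}(\Pi)$, is run for a number of iterations $$K>\frac{1}{h(1-\gamma)}\log\left(\frac{4}{\epsilon(1-\gamma)(1-\gamma^h)}\right)$$ with the choice of stepsize defined by the sequence $c_k=\gamma^{2h(k+1)}$, and that at each iteration the lookahead action-value function $Q_h^{\pi_k}$ is estimated at all state-action pairs by the Monte Carlo planning procedure with parameter values $$M_0=\tilde{\mathcal{O}}\left(\frac{\gamma^{2h}}{(1-\gamma)^4(1-\gamma^h)^2\epsilon^2}\right),\qquad M_j=M=\tilde{\mathcal{O}}\left(\frac{1}{(1-\gamma)^6\epsilon^2}\right)\ \text{ for all } j\in\{1,\dots,h\}$$ (that is, for suitable choices of $M_0$ and $M$ of these orders and a suitable rollout length $H$). Then, with probability at least $1-\delta$, at all iterations $k$, $$\|V^\star-V^{\pi_k}\|_\infty\le\gamma^{hk}\left(\|V^\star-V^{\pi_0}\|_\infty+\frac{1-\gamma^{hk}}{(1-\gamma)(1-\gamma^h)}\right)+\epsilon .$$ Moreover, the procedure uses at most $KM_0HS+hKMSA$ samples in total, and the overall sample complexity of inexact $h$-PMD is $$\tilde{\mathcal{O}}\left(\frac{S}{h\,\epsilon^2(1-\gamma)^6(1-\gamma^h)^2}+\frac{SA}{\epsilon^2(1-\gamma)^7}\right).$$ Here $\tilde{\mathcal{O}}$ hides at most polylogarithmic factors.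
   Context: Setting: a discounted Markov decision process with finite state set $\mathcal{S}$ ($S=|\mathcal{S}|$), finite action set $\mathcal{A}$ ($A=|\mathcal{A}|$), transition kernel $P:\mathcal{S}\times\mathcal{A}\to\Delta(\mathcal{S})$ ($\Delta(\mathcal X)$ is the probability simplex over $\mathcal X$), reward $r:\mathcal{S}\times\mathcal{A}\to[0,1]$, discount $\gamma\in(0,1)$. A generative model is available: from any $(s,a)$ one may draw i.i.d. next states from $P(\cdot|s,a)$; each such draw is one sample. $\Pi$ is the set of policies $\pi:\mathcal{S}\to\Delta(\mathcal{A})$, $\pi_s:=\pi(\cdot|s)$ (and $\pi^k_s:=\pi_k(\cdot|s)$); $\mathrm{ri}$ denotes relative interior. $V^\pi(s)=\mathbb{E}_\pi[\sum_{t\ge0}\gamma^t r(s_t,a_t)\mid s_0=s]$ and $V^\star$ is the optimal value function. $(PV)(s,a)=\sum_{s'}P(s'|s,a)V(s')$; $(\mathcal{T}V)(s)=\max_a (r(s,a)+\gamma (PV)(s,a))$; $(M^\pi Q)(s)=\sum_a\pi(a|s)Q(s,a)$; $Q_h^\pi:=r+\gamma P\mathcal{T}^{h-1}V^\pi$. Mirror map: $\phi:\mathrm{dom}\,\phi\to\mathbb{R}$ is of Legendre type (strictly convex and essentially smooth in the relative interior of its domain) with $\Delta(\mathcal{A})\subset\mathrm{dom}\,\phi$; $D_\phi(p,q)=\phi(p)-\phi(q)-\langle\nabla\phi(q),p-q\rangle$ for $p\in\mathrm{dom}\,\phi$, $q\in\mathrm{ri}(\mathrm{dom}\,\phi)$;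 for policies $D_\phi(\pi,\pi')\in\mathbb{R}^S$ has components $D_\phi(\pi_s,\pi'_s)$. Inexact $h$-PMD: for every $s$, $\pi^{k+1}_s=\arg\max_{\pi_s\in\Delta(\mathcal{A})}\{\eta_k\langle\hat Q_h^{\pi_k}(s,\cdot),\pi_s\rangle-D_\phi(\pi_s,\pi^k_s)\}$, where $\hat Q_h^{\pi_k}$ is an estimate of $Q_h^{\pi_k}$. The stepsize is "defined by the sequence $(c_k)$" if $\eta_k\ge\frac1{c_k}\|\min_{\pi\in\tilde{\mathcal{G}}_h}D_\phi(\pi,\pi_k)\|_\infty$, with $\tilde{\mathcal{G}}_h=\arg\max_{\pi\in\Pi}M^\pi\hat Q_h^{\pi_k}$ (policies greedy w.r.t. $\hat Q_h^{\pi_k}$ in every state) and the minimum computed component-wise. The iterates are assumed to be such that all divergences involved are defined. Monte Carlo planning procedure (estimate of $Q_h^\pi(s,a)$; parameters $M_0,M_1,\dots,M_h,H\ge1$). Set $\mathcal{S}_h=\{s\}$; for $k=h-1,\dots,0$, for each $\tilde s\in\mathcal{S}_{k+1}$, $\tilde a\in\mathcal{A}$ draw a multiset $\mathcal{S}_k(\tilde s,\tilde a)$ of $M_{k+1}$ i.i.d. next states from $P(\cdot|\tilde s,\tilde a)$, and let $\mathcal{S}_k$ be the union of all these together with $\mathcal{S}_{k+1}$ (without duplicates). For $\tilde s\in\mathcal{S}_0$ let $\hat V_1(\tilde s)=\frac1{M_0}\sum_{j=1}^{M_0}\sum_{i=0}^{H-1}\gamma^i r(s_i^j,a_i^j)$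 from $M_0$ independent length-$H$ trajectories following $\pi$ from $s_0^j=\tilde s$. For $k=1,\dots,h$, $\tilde s\in\mathcal{S}_k$, $\tilde a\in\mathcal{A}$, let $\hat Q_k(\tilde s,\tilde a)=r(\tilde s,\tilde a)+\frac{\gamma}{M_k}\sum_{s'\in\mathcal{S}_{k-1}(\tilde s,\tilde a)}\hat V_k(s')$ and $\hat V_{k+1}(\tilde s)=\max_{\tilde a\in\mathcal{A}}\hat Q_k(\tilde s,\tilde a)$. The output is $\hat Q_h^\pi(s,a):=\hat Q_h(s,a)$. When estimating at all state-action pairs within one iteration, the estimates are reused: at each level each component is computed at most once for every state (respectively state-action pair).
   Formalization: The overall sample complexity is stated only for K at most a constant multiple of the lower bound on K (hidden constants depend on that multiple), as it fails for arbitrarily large K, or for K=1 with h far above 1/(1-γ); orders of M_0 and M are rounded up and may include log K. *)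

theory Defs
  imports "HOL-Probability.Probability" "HOL-Analysis.Finite_Function_Topology"
begin

section \<open>Finite discounted Markov decision processes\<close>

text \<open>
  States and actions are finite subsets of arbitrary carrier types, rather than types of class
  \<open>finite\<close>: the constants hidden by the soft-O notation below must be uniform in the numbers of
  states and actions, and a constant cannot be chosen before a quantification over types.
  The simplex over a set \<open>Y\<close> consists of the \<open>pmf\<close>s supported in \<open>Y\<close>.
\<close>

record ('s, 'a) mdp =
  states :: "'s set"
  actions :: "'a set"
  transition :: "'s \<Rightarrow> 'a \<Rightarrow> 's pmf"
  reward :: "'s \<Rightarrow> 'a \<Rightarrow> real"
  discount :: real

definition finite_mdp :: "('s, 'a) mdp \<Rightarrow> bool" where
  "finite_mdp D \<longleftrightarrow>
     finite (states D) \<and> states D \<noteq> {} \<and> finite (actions D) \<and> actions D \<noteq> {} \<and>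
     0 < discount D \<and> discount D < 1 \<and>
     (\<forall>s\<in>states D. \<forall>a\<in>actions D.
        set_pmf (transition D s a) \<subseteq> states D \<and> 0 \<le> reward D s a \<and> reward D s a \<le> 1)"

type_synonym ('s, 'a) policy = "'s \<Rightarrow> 'a pmf"

definition policies :: "('s, 'a) mdp \<Rightarrow> ('s, 'a) policy set" where
  "policies D = {\<pi>. \<forall>s\<in>states D. set_pmf (\<pi> s) \<subseteq> actions D}"

text \<open>
  The law of the infinite trajectory \<open>(s\<^sub>0, a\<^sub>0), (s\<^sub>1, a\<^sub>1), \<dots>\<close> with \<open>s\<^sub>0 = s\<close>, given by the
  Ionescu-Tulcea theorem. \<open>traj_kernel D \<pi> s i \<omega>\<close> is the law of \<open>(s\<^sub>i, a\<^sub>i)\<close> given the first \<open>i\<close> entries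
  of \<open>\<omega>\<close>.
\<close>

definition traj_kernel ::
    "('s, 'a) mdp \<Rightarrow> ('s, 'a) policy \<Rightarrow> 's \<Rightarrow> nat \<Rightarrow> (nat \<Rightarrow> 's \<times> 'a) \<Rightarrow> ('s \<times> 'a) measure" where
  "traj_kernel D \<pi> s i \<omega> = measure_pmf (do {
     s' \<leftarrow> (if i = 0 then return_pmf s else transition D (fst (\<omega> (i - 1))) (snd (\<omega> (i - 1))));
     a' \<leftarrow> \<pi> s';
     return_pmf (s', a') })"

lemma Ionescu_Tulcea_traj_kernel:
  "Ionescu_Tulcea (traj_kernel D \<pi> s) (\<lambda>_. count_space UNIV)"
proof (rule Ionescu_Tulcea.intro)
  fix i :: nat
  show "traj_kernel D \<pi> s i
      \<in> measurable (PiM {0..<i} (\<lambda>_. count_space UNIV)) (subprob_algebra (count_space UNIV))"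
  proof (cases "i = 0")
    case True
    then show ?thesis
      by (simp add: traj_kernel_def[abs_def] space_subprob_algebra measure_pmf.subprob_space_axioms)
  next
    case False
    define g where "g = (\<lambda>x. measure_pmf (do {
      s' \<leftarrow> transition D (fst x) (snd x); a' \<leftarrow> \<pi> s'; return_pmf (s', a') }))"
    have "g \<in> measurable (count_space UNIV) (subprob_algebra (count_space UNIV))"
      by (simp add: g_def space_subprob_algebra measure_pmf.subprob_space_axioms)
    moreover have "(\<lambda>\<omega>. \<omega> (i - 1))
        \<in> measurable (PiM {0..<i} (\<lambda>_. count_space UNIV)) (count_space UNIV)"
      using False by (intro measurable_component_singleton) auto
    ultimately have "(\<lambda>\<omega>. g (\<omega> (i - 1)))
        \<in> measurable (PiM {0..<i} (\<lambda>_. count_space UNIV)) (subprob_algebra (count_space UNIV))"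
      by (rule measurable_compose[rotated])
    then show ?thesis
      using False by (simp add: traj_kernel_def[abs_def] g_def)
  qed
qed (simp add: traj_kernel_def measure_pmf.prob_space_axioms)

definition traj_space ::
    "('s, 'a) mdp \<Rightarrow> ('s, 'a) policy \<Rightarrow> 's \<Rightarrow> (nat \<Rightarrow> 's \<times> 'a) measure" where
  "traj_space D \<pi> s =
     projective_family.lim UNIV
       (Ionescu_Tulcea.CI (traj_kernel D \<pi> s) (\<lambda>_. count_space UNIV)) (\<lambda>_. count_space UNIV)"

definition value_fun :: "('s, 'a) mdp \<Rightarrow> ('s, 'a) policy \<Rightarrow> 's \<Rightarrow> real" where
  "value_fun D \<pi> s =
     (\<integral>\<omega>. suminf (\<lambda>t. discount D ^ t * reward D (fst (\<omega> t)) (snd (\<omega> t))) \<partial>traj_space D \<pi> s)"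

definition opt_value :: "('s, 'a) mdp \<Rightarrow> 's \<Rightarrow> real" where
  "opt_value D s = (SUP \<pi>\<in>policies D. value_fun D \<pi> s)"

definition sup_norm :: "('s, 'a) mdp \<Rightarrow> ('s \<Rightarrow> real) \<Rightarrow> real" where
  "sup_norm D f = Max ((\<lambda>s. \<bar>f s\<bar>) ` states D)"

definition policy_avg :: "('s, 'a) mdp \<Rightarrow> ('s \<Rightarrow> 'a \<Rightarrow> real) \<Rightarrow> ('s, 'a) policy \<Rightarrow> 's \<Rightarrow> real" where
  "policy_avg D Q \<pi> s = (\<Sum>a\<in>actions D. pmf (\<pi> s) a * Q s a)"

definition greedy_policies :: "('s, 'a) mdp \<Rightarrow> ('s \<Rightarrow> 'a \<Rightarrow> real) \<Rightarrow> ('s, 'a) policy set" where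
  "greedy_policies D Q =
     {\<pi>\<in>policies D. \<forall>\<pi>'\<in>policies D. \<forall>s\<in>states D. policy_avg D Q \<pi>' s \<le> policy_avg D Q \<pi> s}"


section \<open>Mirror maps\<close>

text \<open>
  Vectors indexed by a finite action set \<open>Act\<close> are the finitely supported functions whose support
  lies in \<open>Act\<close>; on these the norm of \<^typ>\<open>'a \<Rightarrow>\<^sub>0 real\<close> is the 1-norm. \<open>pmf_vec p\<close> is meaningful only
  if \<open>p\<close> has finite support.
\<close>

definition pm_inner :: "('a \<Rightarrow>\<^sub>0 real) \<Rightarrow> ('a \<Rightarrow>\<^sub>0 real) \<Rightarrow> real" where
  "pm_inner x y = (\<Sum>a\<in>Poly_Mapping.keys x. Poly_Mapping.lookup x a * Poly_Mapping.lookup y a)"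

definition pmf_vec :: "'a pmf \<Rightarrow> ('a \<Rightarrow>\<^sub>0 real)" where
  "pmf_vec p = Poly_Mapping.Abs_poly_mapping (pmf p)"

definition simplex_vecs :: "'a set \<Rightarrow> ('a \<Rightarrow>\<^sub>0 real) set" where
  "simplex_vecs Act = pmf_vec ` {p. set_pmf p \<subseteq> Act}"

text \<open>
  The gradient relative to the affine hull of the domain \<open>X\<close>: the representing vector, in the
  direction space of that hull, of the derivative within \<open>X\<close>. It is the usual gradient if \<open>X\<close> has
  interior points in the space of all vectors indexed by the actions.
\<close>

definition rel_grad :: "('a \<Rightarrow>\<^sub>0 real) set \<Rightarrow> (('a \<Rightarrow>\<^sub>0 real) \<Rightarrow> real) \<Rightarrow> ('a \<Rightarrow>\<^sub>0 real) \<Rightarrow> ('a \<Rightarrow>\<^sub>0 real)" where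
  "rel_grad X \<phi> q =
     (THE g. g \<in> span {x - y | x y. x \<in> X \<and> y \<in> X} \<and>
             (\<phi> has_derivative pm_inner g) (at q within X))"

definition legendre_type :: "('a \<Rightarrow>\<^sub>0 real) set \<Rightarrow> (('a \<Rightarrow>\<^sub>0 real) \<Rightarrow> real) \<Rightarrow> bool" where
  "legendre_type X \<phi> \<longleftrightarrow>
     convex_on X \<phi> \<and>
     (\<forall>x\<in>rel_interior X. \<forall>y\<in>rel_interior X. \<forall>u. x \<noteq> y \<and> 0 < u \<and> u < 1 \<longrightarrow>
        \<phi> ((1 - u) *\<^sub>R x + u *\<^sub>R y) < (1 - u) * \<phi> x + u * \<phi> y) \<and>
     (\<forall>q\<in>rel_interior X. \<phi> differentiable (at q within X)) \<and>
     (\<forall>f x. (\<forall>n. f n \<in> rel_interior X) \<and> x \<in> rel_frontier X \<and> f \<longlonglongrightarrow> x \<longrightarrow>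
        filterlim (\<lambda>n. norm (rel_grad X \<phi> (f n))) at_top sequentially)"

definition mirror_map :: "'a set \<Rightarrow> ('a \<Rightarrow>\<^sub>0 real) set \<Rightarrow> (('a \<Rightarrow>\<^sub>0 real) \<Rightarrow> real) \<Rightarrow> bool" where
  "mirror_map Act X \<phi> \<longleftrightarrow>
     X \<subseteq> {x. Poly_Mapping.keys x \<subseteq> Act} \<and> simplex_vecs Act \<subseteq> X \<and> legendre_type X \<phi>"

definition bregman ::
    "('a \<Rightarrow>\<^sub>0 real) set \<Rightarrow> (('a \<Rightarrow>\<^sub>0 real) \<Rightarrow> real) \<Rightarrow> 'a pmf \<Rightarrow> 'a pmf \<Rightarrow> real" where
  "bregman X \<phi> p q =
     \<phi> (pmf_vec p) - \<phi> (pmf_vec q) - pm_inner (rel_grad X \<phi> (pmf_vec q)) (pmf_vec p - pmf_vec q)"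


section \<open>The Monte Carlo planning procedure\<close>

text \<open>
  The number of samples is carried along with the estimates. A trajectory of length \<open>H\<close> is charged
  \<open>H\<close> samples; the last of its next states is drawn but not used.
\<close>

primrec traj :: "('s, 'a) mdp \<Rightarrow> ('s, 'a) policy \<Rightarrow> nat \<Rightarrow> 's \<Rightarrow> ('s \<times> 'a) list pmf" where
  "traj D \<pi> 0 s = return_pmf []"
| "traj D \<pi> (Suc n) s = do {
     a \<leftarrow> \<pi> s;
     s' \<leftarrow> transition D s a;
     xs \<leftarrow> traj D \<pi> n s';
     return_pmf ((s, a) # xs) }"

definition disc_return :: "('s, 'a) mdp \<Rightarrow> ('s \<times> 'a) list \<Rightarrow> real" where
  "disc_return D xs = (\<Sum>i<length xs. discount D ^ i * reward D (fst (xs ! i)) (snd (xs ! i)))"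

text \<open>
  \<open>mc_backup D m est T\<close> draws, for each state in \<open>T\<close> and each action, \<open>m\<close> next states, obtains value
  estimates from \<open>est\<close> on the set of all these states together with \<open>T\<close>, and returns the resulting
  action-value estimates at the states of \<open>T\<close>. In the notation of the procedure, \<open>mc_V D \<pi> M H k\<close>
  maps \<open>\<S>\<^sub>k\<close> to the estimate of index \<open>k + 1\<close>, and \<open>mc_Q D \<pi> M H h\<close> maps \<open>\<S>\<^sub>h\<close> to the
  action-value estimate of index \<open>h\<close>.
\<close>

definition mc_backup ::
    "('s, 'a) mdp \<Rightarrow> nat \<Rightarrow> ('s set \<Rightarrow> (('s \<Rightarrow> real) \<times> nat) pmf) \<Rightarrow> 's set \<Rightarrow>
     (('s \<Rightarrow> 'a \<Rightarrow> real) \<times> nat) pmf" where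
  "mc_backup D m est T = do {
     X \<leftarrow> Pi_pmf (T \<times> actions D) [] (\<lambda>(s, a). replicate_pmf m (transition D s a));
     (V, n) \<leftarrow> est (T \<union> (\<Union>sa\<in>T \<times> actions D. set (X sa)));
     return_pmf
       ((\<lambda>s a. reward D s a + discount D / real m * (\<Sum>s'\<leftarrow>X (s, a). V s')),
        n + m * card T * card (actions D)) }"

primrec mc_V ::
    "('s, 'a) mdp \<Rightarrow> ('s, 'a) policy \<Rightarrow> (nat \<Rightarrow> nat) \<Rightarrow> nat \<Rightarrow> nat \<Rightarrow> 's set \<Rightarrow>
     (('s \<Rightarrow> real) \<times> nat) pmf" where
  "mc_V D \<pi> M H 0 = (\<lambda>T. do {
     W \<leftarrow> Pi_pmf T [] (\<lambda>s. replicate_pmf (M 0) (traj D \<pi> H s));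
     return_pmf
       ((\<lambda>s. 1 / real (M 0) * (\<Sum>xs\<leftarrow>W s. disc_return D xs)), M 0 * H * card T) })"
| "mc_V D \<pi> M H (Suc k) = (\<lambda>T. do {
     (Q, n) \<leftarrow> mc_backup D (M (Suc k)) (mc_V D \<pi> M H k) T;
     return_pmf ((\<lambda>s. Max (Q s ` actions D)), n) })"

definition mc_Q ::
    "('s, 'a) mdp \<Rightarrow> ('s, 'a) policy \<Rightarrow> (nat \<Rightarrow> nat) \<Rightarrow> nat \<Rightarrow> nat \<Rightarrow> 's set \<Rightarrow>
     (('s \<Rightarrow> 'a \<Rightarrow> real) \<times> nat) pmf" where
  "mc_Q D \<pi> M H h = mc_backup D (M h) (mc_V D \<pi> M H (h - 1))"


section \<open>Inexact policy mirror descent with lookahead\<close>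

text \<open>
  \<open>pol\<close> and \<open>eta\<close> map the list of estimates obtained so far to the current policy and to the last
  stepsize: \<open>\<pi>\<^sub>k = pol [q\<^sub>0, \<dots>, q\<^sub>k\<^sub>-\<^sub>1]\<close> and \<open>\<eta>\<^sub>k = eta [q\<^sub>0, \<dots>, q\<^sub>k]\<close>. Running the estimator from all states at
  once computes each component at each level once. \<open>hpmd_run\<close> yields the joint law of the first \<open>k\<close>
  estimates and of the total number of samples.
\<close>

primrec hpmd_run ::
    "('s, 'a) mdp \<Rightarrow> (nat \<Rightarrow> nat) \<Rightarrow> nat \<Rightarrow> nat \<Rightarrow> (('s \<Rightarrow> 'a \<Rightarrow> real) list \<Rightarrow> ('s, 'a) policy) \<Rightarrow>
     nat \<Rightarrow> (('s \<Rightarrow> 'a \<Rightarrow> real) list \<times> nat) pmf" where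
  "hpmd_run D M H h pol 0 = return_pmf ([], 0)"
| "hpmd_run D M H h pol (Suc k) = do {
     (qs, n) \<leftarrow> hpmd_run D M H h pol k;
     (q, c) \<leftarrow> mc_Q D (pol qs) M H h (states D);
     return_pmf (qs @ [q], n + c) }"

text \<open>The first conjunct says that the divergences to the current policy are defined.\<close>

definition pmd_update ::
    "('s, 'a) mdp \<Rightarrow> ('a \<Rightarrow>\<^sub>0 real) set \<Rightarrow> (('a \<Rightarrow>\<^sub>0 real) \<Rightarrow> real) \<Rightarrow> real \<Rightarrow>
     ('s \<Rightarrow> 'a \<Rightarrow> real) \<Rightarrow> ('s, 'a) policy \<Rightarrow> ('s, 'a) policy \<Rightarrow> bool" where
  "pmd_update D X \<phi> \<eta> Q \<pi> \<pi>' \<longleftrightarrow>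
     (\<forall>s\<in>states D. pmf_vec (\<pi> s) \<in> rel_interior X \<and>
        is_arg_max (\<lambda>p. \<eta> * (\<Sum>a\<in>actions D. Q s a * pmf p a) - bregman X \<phi> p (\<pi> s))
          (\<lambda>p. set_pmf p \<subseteq> actions D) (\<pi>' s))"

text \<open>
  The infimum over the greedy policies is taken state by state; it agrees with the minimum whenever
  that is attained, and it is bounded below by 0.
\<close>

definition stepsize_cond ::
    "('s, 'a) mdp \<Rightarrow> ('a \<Rightarrow>\<^sub>0 real) set \<Rightarrow> (('a \<Rightarrow>\<^sub>0 real) \<Rightarrow> real) \<Rightarrow> real \<Rightarrow> real \<Rightarrow>
     ('s \<Rightarrow> 'a \<Rightarrow> real) \<Rightarrow> ('s, 'a) policy \<Rightarrow> bool" where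
  "stepsize_cond D X \<phi> c \<eta> Q \<pi> \<longleftrightarrow>
     \<eta> \<ge> 1 / c * sup_norm D (\<lambda>s. INF \<pi>'\<in>greedy_policies D Q. bregman X \<phi> (\<pi>' s) (\<pi> s))"

definition inexact_hpmd ::
    "('s, 'a) mdp \<Rightarrow> ('a \<Rightarrow>\<^sub>0 real) set \<Rightarrow> (('a \<Rightarrow>\<^sub>0 real) \<Rightarrow> real) \<Rightarrow> (nat \<Rightarrow> nat) \<Rightarrow> nat \<Rightarrow> nat \<Rightarrow>
     (nat \<Rightarrow> real) \<Rightarrow> nat \<Rightarrow> (('s \<Rightarrow> 'a \<Rightarrow> real) list \<Rightarrow> ('s, 'a) policy) \<Rightarrow>
     (('s \<Rightarrow> 'a \<Rightarrow> real) list \<Rightarrow> real) \<Rightarrow> bool" where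
  "inexact_hpmd D X \<phi> M H h c K pol eta \<longleftrightarrow>
     finite_mdp D \<and> mirror_map (actions D) X \<phi> \<and>
     pol [] \<in> policies D \<and>
     (\<forall>s\<in>states D. pmf_vec (pol [] s) \<in> rel_interior (simplex_vecs (actions D))) \<and>
     (\<forall>k<K. \<forall>(qs, n)\<in>set_pmf (hpmd_run D M H h pol k).
        \<forall>(q, m)\<in>set_pmf (mc_Q D (pol qs) M H h (states D)).
          pmd_update D X \<phi> (eta (qs @ [q])) q (pol qs) (pol (qs @ [q])) \<and>
          stepsize_cond D X \<phi> (c k) (eta (qs @ [q])) q (pol qs))"


section \<open>Orders of magnitude up to polylogarithmic factors\<close>

text \<open>
  The hidden factors are powers of the logarithm of the following quantity, which exceeds 4; the
  orders of the Monte Carlo parameters may also involve the logarithm of the number of iterations.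
  The parameters being positive integers, their order is that of a real number rounded up.
  \<open>iter_threshold\<close> is the lower bound imposed on the number of iterations \<open>K\<close>. An overall sample
  complexity independent of \<open>K\<close> requires in addition \<open>K \<le> \<kappa> * iter_threshold \<gamma> h \<epsilon>\<close> for an arbitrary
  constant \<open>\<kappa> \<ge> 1\<close>, on which the hidden constants may depend.
\<close>

definition problem_size :: "nat \<Rightarrow> nat \<Rightarrow> real \<Rightarrow> nat \<Rightarrow> real \<Rightarrow> real \<Rightarrow> real" where
  "problem_size S A \<gamma> h \<epsilon> \<delta> = real S + real A + real h + 1 / (1 - \<gamma>) + 1 / \<epsilon> + 1 / \<delta>"

text \<open>Arguments: \<open>S\<close>, \<open>A\<close>, discount, lookahead depth, accuracy, probability threshold, iterations.\<close>

type_synonym mc_parameter = "nat \<Rightarrow> nat \<Rightarrow> real \<Rightarrow> nat \<Rightarrow> real \<Rightarrow> real \<Rightarrow> nat \<Rightarrow> nat"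

definition soft_O :: "mc_parameter \<Rightarrow> (real \<Rightarrow> nat \<Rightarrow> real \<Rightarrow> real) \<Rightarrow> bool" where
  "soft_O F g \<longleftrightarrow>
     (\<exists>(C::real) (p::nat). \<forall>S A \<gamma> h \<epsilon> \<delta> K.
        1 \<le> S \<and> 1 \<le> A \<and> 0 < \<gamma> \<and> \<gamma> < 1 \<and> 1 \<le> h \<and> 0 < \<epsilon> \<and> 0 < \<delta> \<longrightarrow>
        int (F S A \<gamma> h \<epsilon> \<delta> K) \<le> \<lceil>C * ln (problem_size S A \<gamma> h \<epsilon> \<delta> + real K) ^ p * g \<gamma> h \<epsilon>\<rceil>)"

definition iter_threshold :: "real \<Rightarrow> nat \<Rightarrow> real \<Rightarrow> real" where
  "iter_threshold \<gamma> h \<epsilon> = 1 / (real h * (1 - \<gamma>)) * ln (4 / (\<epsilon> * (1 - \<gamma>) * (1 - \<gamma> ^ h)))"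

end

theory Submission
  imports Defs
begin

text \<open>
  Let \<open>b\<close> bound the error of the estimates of \<open>Q\<^sub>h\<close> at \<open>\<pi>\<^sub>k\<close>. Comparing \<open>\<pi>\<^sub>k\<^sub>+\<^sub>1\<close> with a greedy policy in
  the mirror step, the stepsize condition gives
  \<open>T\<^sup>\<pi> U \<ge> T U - (2 b + c\<^sub>k)\<close> for \<open>\<pi> = \<pi>\<^sub>k\<^sub>+\<^sub>1\<close> and \<open>U = T\<^sup>h\<^sup>-\<^sup>1 V\<close>, \<open>V\<close> the value of \<open>\<pi>\<^sub>k\<close>.
  As \<open>T U \<ge> U\<close>, the suboptimality contracts by \<open>\<gamma>\<^sup>h\<close> up to \<open>(2 b + c\<^sub>k) / (1 - \<gamma>)\<close>; summing up, the
  errors contribute at most \<open>\<epsilon>\<close> if \<open>b \<le> \<epsilon> (1 - \<gamma>) (1 - \<gamma>\<^sup>h) / 2\<close>.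

  At each level the sampled averages are compared with the expectation of the exact, hence
  deterministic, value of the level below, so Hoeffding's inequality applies although the
  estimates are reused. With per-level errors \<open>\<tau>\<^sub>0\<close> (rollouts) and \<open>\<tau>\<close> (next states) the total error is
  \<open>\<gamma>\<^sup>h (\<tau>\<^sub>0 + \<gamma>\<^sup>H / (1 - \<gamma>)) + \<gamma> \<tau> (1 - \<gamma>\<^sup>h) / (1 - \<gamma>)\<close>. The factor \<open>1 - \<gamma>\<^sup>h\<close> of the last term cancels
  the one in the bound on \<open>b\<close>, which is why it is absent from the order of \<open>M\<close>.
\<close>

section \<open>Value functions and lookahead\<close>

text \<open>The comparison in the mirror step bounds the stepsize times the gap, so it says nothing
  at stepsize 0, which is permitted when greedy policies come arbitrarily close in divergence to the
  current one in every state. There one shows instead that the current policy is greedy already and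
  that the update keeps it. This requires the divergence to separate points, also on the relative
  boundary of the domain, and hence that the gradient, a definite description relative to the affine
  hull, exists and is unique.

  The stepsize terms decay like the square of the contraction rate, so that their accumulated effect
  keeps the rate itself. The guarantee for the estimates is proved at a fixed policy and used
  conditionally on the history that determines the policy.

  The number of iterations occurs under the logarithms in the parameters because failures are summed
  over iterations. In the overall complexity an upper bound on this number removes the
  dependence.\<close>

definition qval :: "('s, 'a) mdp \<Rightarrow> ('s \<Rightarrow> real) \<Rightarrow> 's \<Rightarrow> 'a \<Rightarrow> real" where
  "qval D V s a = reward D s a + discount D * (\<Sum>s'\<in>states D. pmf (transition D s a) s' * V s')"

definition pol_backup :: "('s, 'a) mdp \<Rightarrow> ('s, 'a) policy \<Rightarrow> ('s \<Rightarrow> real) \<Rightarrow> 's \<Rightarrow> real" where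
  "pol_backup D \<pi> V = policy_avg D (qval D V) \<pi>"

definition opt_backup :: "('s, 'a) mdp \<Rightarrow> ('s \<Rightarrow> real) \<Rightarrow> 's \<Rightarrow> real" where
  "opt_backup D V s = Max (qval D V s ` actions D)"

section \<open>Marginals of the trajectory law\<close>

definition traj_step :: "('s, 'a) mdp \<Rightarrow> ('s, 'a) policy \<Rightarrow> 's \<times> 'a \<Rightarrow> ('s \<times> 'a) pmf" where
  "traj_step D \<pi> x = do {
     s' \<leftarrow> transition D (fst x) (snd x); a' \<leftarrow> \<pi> s'; return_pmf (s', a') }"

text \<open>The value function integrates a series whose t-th term depends on
  \<open>\<omega> t\<close> alone, so the trajectory law acts only through these one-coordinate
  marginals.\<close>

primrec traj_marginal :: "('s, 'a) mdp \<Rightarrow> ('s, 'a) policy \<Rightarrow> nat \<Rightarrow> 's \<Rightarrow> ('s \<times> 'a) pmf" where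
  "traj_marginal D \<pi> 0 s = do { a \<leftarrow> \<pi> s; return_pmf (s, a) }"
| "traj_marginal D \<pi> (Suc t) s = traj_marginal D \<pi> t s \<bind> traj_step D \<pi>"

lemma traj_kernel_eq:
  "traj_kernel D \<pi> s i \<omega> =
     measure_pmf (if i = 0 then traj_marginal D \<pi> 0 s else traj_step D \<pi> (\<omega> (i - 1)))"
  by (simp add: traj_kernel_def traj_step_def bind_return_pmf)

text \<open>The kernel at stage n sees the prefix only through its last entry. Integrating out the
  final coordinate turns \<open>f\<close> into a function of the entry before it, which is why the
  induction generalises over \<open>f\<close>.\<close>

lemma nn_integral_traj_prefix:
  fixes f :: "'s \<times> 'a \<Rightarrow> ennreal"
  shows "(\<integral>\<^sup>+\<omega>. f (\<omega> n) \<partial>Ionescu_Tulcea.C (traj_kernel D \<pi> s) (\<lambda>_. count_space UNIV) 0 (Suc n)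
           (\<lambda>_. undefined)) = (\<integral>\<^sup>+x. f x \<partial>traj_marginal D \<pi> n s)"
proof (induction n arbitrary: f)
  interpret IT: Ionescu_Tulcea "traj_kernel D \<pi> s" "\<lambda>_. count_space UNIV"
    by (rule Ionescu_Tulcea_traj_kernel)
  let ?u = "\<lambda>_::nat. undefined :: 's \<times> 'a"
  have u: "?u \<in> space (PiM {0..<0} (\<lambda>_. count_space UNIV))"
    by (simp add: space_PiM)
  \<comment> \<open>\<open>IT.C 0 (Suc n)\<close> appends one draw from the kernel at stage n to a
    prefix of length n, and the integrand looks at that draw alone.\<close>
  have step: "(\<integral>\<^sup>+\<omega>. f (\<omega> n) \<partial>IT.C 0 (Suc n) ?u) = (\<integral>\<^sup>+\<omega>. \<integral>\<^sup>+x. f x \<partial>traj_kernel D \<pi> s n \<omega> \<partial>IT.C 0 n ?u)"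
    for n and f :: "'s \<times> 'a \<Rightarrow> ennreal"
  proof -
    have meas: "(\<lambda>\<omega>. f (\<omega> n)) \<in> borel_measurable (PiM {0..<Suc n} (\<lambda>_. count_space UNIV))"
      by (rule measurable_compose[OF measurable_component_singleton]) auto
    have "IT.eP n \<in> measurable (IT.C 0 n ?u) (subprob_algebra (PiM {0..<Suc n} (\<lambda>_. count_space UNIV)))"
      using IT.measurable_eP[of n] IT.sets_C[OF u, of n] by (simp cong: measurable_cong_sets)
    then have "(\<integral>\<^sup>+\<omega>. f (\<omega> n) \<partial>IT.C 0 (Suc n) ?u) =
        (\<integral>\<^sup>+\<omega>. \<integral>\<^sup>+\<omega>'. f (\<omega>' n) \<partial>IT.eP n \<omega> \<partial>IT.C 0 n ?u)"
      using meas by (simp add: nn_integral_bind)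
    also have "\<dots> = (\<integral>\<^sup>+\<omega>. \<integral>\<^sup>+x. f x \<partial>traj_kernel D \<pi> s n \<omega> \<partial>IT.C 0 n ?u)"
    proof (rule nn_integral_cong)
      fix \<omega> assume "\<omega> \<in> space (IT.C 0 n ?u)"
      then show "(\<integral>\<^sup>+\<omega>'. f (\<omega>' n) \<partial>IT.eP n \<omega>) = (\<integral>\<^sup>+x. f x \<partial>traj_kernel D \<pi> s n \<omega>)"
        using meas IT.space_C[OF u, of n] by (simp add: IT.nn_integral_eP)
    qed
    finally show ?thesis .
  qed
  {
    case 0
    have "prob_space (IT.C 0 0 ?u)"
      using u by (rule IT.prob_space_C)
    then show ?case
      by (subst step) (simp add: traj_kernel_eq prob_space.emeasure_space_1 del: IT.C.simps nn_integral_bind_pmf)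
  next
    case (Suc n)
    show ?case
      by (subst step) (simp add: traj_kernel_eq Suc[of "\<lambda>y. \<integral>\<^sup>+x. f x \<partial>traj_step D \<pi> y"] del: IT.C.simps)
  }
qed

lemma traj_space_component_measurable [measurable]:
  "(\<lambda>\<omega>. \<omega> n) \<in> measurable (traj_space D \<pi> s) (count_space UNIV)"
proof -
  interpret IT: Ionescu_Tulcea "traj_kernel D \<pi> s" "\<lambda>_. count_space UNIV"
    by (rule Ionescu_Tulcea_traj_kernel)
  show ?thesis
    unfolding traj_space_def measurable_cong_sets[OF IT.PF.sets_lim refl]
    by (rule measurable_component_singleton) simp
qed

lemma distr_traj_space:
  fixes D :: "('s, 'a) mdp"
  shows "distr (traj_space D \<pi> s) (count_space UNIV) (\<lambda>\<omega>. \<omega> n) = measure_pmf (traj_marginal D \<pi> n s)"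
proof (rule measure_eqI)
  interpret IT: Ionescu_Tulcea "traj_kernel D \<pi> s" "\<lambda>_. count_space UNIV"
    by (rule Ionescu_Tulcea_traj_kernel)
  let ?M = "\<lambda>_::nat. count_space UNIV :: ('s \<times> 'a) measure"
  let ?u = "\<lambda>_::nat. undefined :: 's \<times> 'a"
  have u: "?u \<in> space (PiM {0..<0} ?M)"
    by (simp add: space_PiM)
  have meas: "(\<lambda>\<omega>. \<omega> n) \<in> measurable (PiM I ?M) (count_space UNIV)" if "n \<in> I" for I
    using that by (rule measurable_component_singleton)
  fix A :: "('s \<times> 'a) set"
  \<comment> \<open>The event in coordinate n is a cylinder over the first n + 1 coordinates, on
    which the projective limit agrees with the law of the finite prefix.\<close>
  define X where "X = {\<omega>\<in>space (PiM {0..<Suc n} ?M). \<omega> n \<in> A}"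
  have X: "X \<in> sets (PiM {0..<Suc n} ?M)"
    unfolding X_def using measurable_sets[OF meas[of "{0..<Suc n}"], of A]
    by (simp add: vimage_def Int_def conj_commute)
  have "emeasure (distr (traj_space D \<pi> s) (count_space UNIV) (\<lambda>\<omega>. \<omega> n)) A =
      emeasure IT.PF.lim ((\<lambda>\<omega>. \<omega> n) -` A \<inter> space IT.PF.lim)"
    by (subst emeasure_distr[OF traj_space_component_measurable]) (simp_all add: traj_space_def)
  also have "(\<lambda>\<omega>. \<omega> n) -` A \<inter> space IT.PF.lim = IT.PF.emb UNIV {0..<Suc n} X"
    by (auto simp: X_def prod_emb_def space_PiM)
  also have "emeasure IT.PF.lim \<dots> = emeasure (IT.CI {0..<Suc n}) X"
    using X by (intro IT.lim) auto
  also have "\<dots> = emeasure (IT.C 0 (Suc n) ?u) (IT.PF.emb {0..<Suc n} {0..<Suc n} X)"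
    using X by (intro IT.emeasure_CI) auto
  also have "IT.PF.emb {0..<Suc n} {0..<Suc n} X = X"
    using X by (intro prod_emb_id) (auto simp: X_def space_PiM)
  also have "emeasure (IT.C 0 (Suc n) ?u) X = (\<integral>\<^sup>+\<omega>. indicator X \<omega> \<partial>IT.C 0 (Suc n) ?u)"
    using X IT.sets_C[OF u, of "Suc n"] by (subst nn_integral_indicator) (auto simp del: IT.C.simps)
  also have "\<dots> = (\<integral>\<^sup>+\<omega>. indicator A (\<omega> n) \<partial>IT.C 0 (Suc n) ?u)"
    using IT.space_C[OF u, of "Suc n"]
    by (intro nn_integral_cong) (auto simp: X_def indicator_def simp del: IT.C.simps)
  also have "\<dots> = emeasure (traj_marginal D \<pi> n s) A"
    by (subst nn_integral_traj_prefix) simp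
  finally show "emeasure (distr (traj_space D \<pi> s) (count_space UNIV) (\<lambda>\<omega>. \<omega> n)) A =
      emeasure (traj_marginal D \<pi> n s) A" .
qed simp

lemma prob_space_traj_space: "prob_space (traj_space D \<pi> s)"
proof -
  have "emeasure (distr (traj_space D \<pi> s) (count_space UNIV) (\<lambda>\<omega>. \<omega> 0)) UNIV = 1"
    unfolding distr_traj_space by simp
  then show ?thesis
    by (intro prob_spaceI) (simp add: emeasure_distr)
qed

lemma integral_traj_space:
  fixes f :: "'s \<times> 'a \<Rightarrow> real"
  shows "(\<integral>\<omega>. f (\<omega> n) \<partial>traj_space D \<pi> s) = measure_pmf.expectation (traj_marginal D \<pi> n s) f"
  by (subst distr_traj_space[symmetric], subst integral_distr) auto

lemma AE_traj_space:
  assumes "\<And>x. x \<in> set_pmf (traj_marginal D \<pi> n s) \<Longrightarrow> P x"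
  shows "AE \<omega> in traj_space D \<pi> s. P (\<omega> n)"
proof -
  have "AE x in distr (traj_space D \<pi> s) (count_space UNIV) (\<lambda>\<omega>. \<omega> n). P x"
    unfolding distr_traj_space using assms by (simp add: AE_measure_pmf_iff)
  then show ?thesis
    by (subst (asm) AE_distr_iff) auto
qed

section \<open>Bellman operators on a finite decision process\<close>

locale fin_mdp =
  fixes D :: "('s, 'a) mdp"
  assumes finite_mdp: "finite_mdp D"
begin

abbreviation \<gamma> :: real where "\<gamma> \<equiv> discount D"

lemma \<gamma>: "0 < \<gamma>" "\<gamma> < 1"
  using finite_mdp by (auto simp: finite_mdp_def)

lemma finite_states [simp]: "finite (states D)" and finite_actions [simp]: "finite (actions D)"
  and states_nonempty [simp]: "states D \<noteq> {}" and actions_nonempty [simp]: "actions D \<noteq> {}"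
  using finite_mdp by (auto simp: finite_mdp_def)

lemma set_transition: "s \<in> states D \<Longrightarrow> a \<in> actions D \<Longrightarrow> set_pmf (transition D s a) \<subseteq> states D"
  and reward_bounds: "s \<in> states D \<Longrightarrow> a \<in> actions D \<Longrightarrow> 0 \<le> reward D s a \<and> reward D s a \<le> 1"
  using finite_mdp by (auto simp: finite_mdp_def)

lemma sum_pmf_states: "s \<in> states D \<Longrightarrow> a \<in> actions D \<Longrightarrow> (\<Sum>s'\<in>states D. pmf (transition D s a) s') = 1"
  using set_transition by (simp add: sum_pmf_eq_1)

lemma sum_transition_eq_expectation:
  assumes "s \<in> states D" "a \<in> actions D"
  shows "(\<Sum>s'\<in>states D. pmf (transition D s a) s' * V s') = measure_pmf.expectation (transition D s a) V"
  using set_transition[OF assms] by (subst integral_measure_pmf[of "states D"]) auto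

text \<open>One inequality with an additive constant serves two purposes: \<open>c = 0\<close> gives
  monotonicity, and two opposite uses with the same \<open>c\<close> give contraction by \<gamma>.
  The backup operators inherit this form.\<close>

lemma qval_le_shift:
  assumes "\<And>s. s \<in> states D \<Longrightarrow> V s \<le> W s + c" and sa: "s \<in> states D" "a \<in> actions D"
  shows "qval D V s a \<le> qval D W s a + \<gamma> * c"
proof -
  have "(\<Sum>s'\<in>states D. pmf (transition D s a) s' * V s') \<le>
      (\<Sum>s'\<in>states D. pmf (transition D s a) s' * (W s' + c))"
    using assms by (intro sum_mono mult_left_mono) auto
  also have "\<dots> = (\<Sum>s'\<in>states D. pmf (transition D s a) s' * W s') + c"
    using sum_pmf_states[OF sa] by (simp add: distrib_left sum.distrib flip: sum_distrib_right)
  finally have "\<gamma> * (\<Sum>s'\<in>states D. pmf (transition D s a) s' * V s') \<le>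
      \<gamma> * ((\<Sum>s'\<in>states D. pmf (transition D s a) s' * W s') + c)"
    using \<gamma> by (intro mult_left_mono) auto
  then show ?thesis
    by (simp add: qval_def distrib_left)
qed

lemma policy_avg_le_shift:
  assumes "\<pi> \<in> policies D" "s \<in> states D" "\<And>a. a \<in> actions D \<Longrightarrow> P s a \<le> Q s a + c"
  shows "policy_avg D P \<pi> s \<le> policy_avg D Q \<pi> s + c"
proof -
  have "(\<Sum>a\<in>actions D. pmf (\<pi> s) a) = 1"
    using assms by (simp add: sum_pmf_eq_1 policies_def)
  then have "policy_avg D Q \<pi> s + c = (\<Sum>a\<in>actions D. pmf (\<pi> s) a * (Q s a + c))"
    by (simp add: policy_avg_def distrib_left sum.distrib flip: sum_distrib_right)
  moreover have "policy_avg D P \<pi> s \<le> (\<Sum>a\<in>actions D. pmf (\<pi> s) a * (Q s a + c))"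
    unfolding policy_avg_def using assms by (intro sum_mono mult_left_mono) auto
  ultimately show ?thesis by simp
qed

lemma pol_backup_le_shift:
  assumes "\<pi> \<in> policies D" "\<And>s. s \<in> states D \<Longrightarrow> V s \<le> W s + c" "s \<in> states D"
  shows "pol_backup D \<pi> V s \<le> pol_backup D \<pi> W s + \<gamma> * c"
  unfolding pol_backup_def using assms by (intro policy_avg_le_shift qval_le_shift) auto

lemma opt_backup_le_shift:
  assumes "\<And>s. s \<in> states D \<Longrightarrow> V s \<le> W s + c" "s \<in> states D"
  shows "opt_backup D V s \<le> opt_backup D W s + \<gamma> * c"
  unfolding opt_backup_def
proof (rule Max.boundedI)
  fix y assume "y \<in> qval D V s ` actions D"
  then obtain a where a: "a \<in> actions D" "y = qval D V s a" by auto
  have "y \<le> qval D W s a + \<gamma> * c"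
    unfolding a(2) using assms a by (intro qval_le_shift) auto
  also have "qval D W s a \<le> Max (qval D W s ` actions D)"
    using a by (intro Max_ge) auto
  finally show "y \<le> Max (qval D W s ` actions D) + \<gamma> * c" by simp
qed auto

lemma opt_backup_funpow_le_shift:
  assumes "\<And>s. s \<in> states D \<Longrightarrow> V s \<le> W s + c" "s \<in> states D"
  shows "(opt_backup D ^^ n) V s \<le> (opt_backup D ^^ n) W s + \<gamma> ^ n * c"
  using assms(2)
proof (induction n arbitrary: s)
  case 0
  then show ?case using assms by simp
next
  case (Suc n)
  then show ?case
    using opt_backup_le_shift[OF Suc.IH Suc.prems] by (simp add: mult.assoc)
qed

lemma policy_avg_le_Max:
  assumes "\<pi> \<in> policies D" "s \<in> states D"
  shows "policy_avg D Q \<pi> s \<le> Max (Q s ` actions D)"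
  using policy_avg_le_shift[of \<pi> s Q "\<lambda>_ _. 0" "Max (Q s ` actions D)"] assms
  by (simp add: policy_avg_def)

lemma pol_backup_le_opt_backup:
  "\<pi> \<in> policies D \<Longrightarrow> s \<in> states D \<Longrightarrow> pol_backup D \<pi> V s \<le> opt_backup D V s"
  unfolding pol_backup_def opt_backup_def by (rule policy_avg_le_Max)

text \<open>The interval is invariant because
  \<open>1 + \<gamma> / (1 - \<gamma>) = 1 / (1 - \<gamma>)\<close>. It bounds the exact lookahead
  values and thereby the range in Hoeffding's inequality.\<close>

lemma opt_backup_bounds:
  assumes "\<And>s. s \<in> states D \<Longrightarrow> 0 \<le> V s \<and> V s \<le> 1 / (1 - \<gamma>)" "s \<in> states D"
  shows "0 \<le> opt_backup D V s \<and> opt_backup D V s \<le> 1 / (1 - \<gamma>)"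
proof -
  have zero: "qval D (\<lambda>_. 0) s a = reward D s a" for a
    by (simp add: qval_def)
  have "qval D V s a \<le> 1 / (1 - \<gamma>)" if "a \<in> actions D" for a
  proof -
    have "qval D V s a \<le> reward D s a + \<gamma> * (1 / (1 - \<gamma>))"
      using qval_le_shift[of V "\<lambda>_. 0" "1 / (1 - \<gamma>)" s a] assms that by (simp add: zero)
    also have "\<dots> \<le> 1 + \<gamma> * (1 / (1 - \<gamma>))"
      using reward_bounds assms that by simp
    also have "\<dots> = 1 / (1 - \<gamma>)"
      using \<gamma> by (simp add: field_simps)
    finally show ?thesis .
  qed
  moreover obtain a where a: "a \<in> actions D"
    using actions_nonempty by blast
  have "0 \<le> qval D V s a"
    using qval_le_shift[of "\<lambda>_. 0" V 0 s a] assms a reward_bounds[of s a] by (simp add: zero)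
  then have "0 \<le> Max (qval D V s ` actions D)"
    using a by (subst Max_ge_iff) auto
  ultimately show ?thesis
    by (simp add: opt_backup_def)
qed

lemma opt_backup_funpow_bounds:
  assumes "\<And>s. s \<in> states D \<Longrightarrow> 0 \<le> V s \<and> V s \<le> 1 / (1 - \<gamma>)" "s \<in> states D"
  shows "0 \<le> (opt_backup D ^^ n) V s \<and> (opt_backup D ^^ n) V s \<le> 1 / (1 - \<gamma>)"
  using assms(2) by (induction n arbitrary: s) (simp_all add: assms opt_backup_bounds)

lemma abs_le_sup_norm: "s \<in> states D \<Longrightarrow> \<bar>f s\<bar> \<le> sup_norm D f"
  unfolding sup_norm_def by (intro Max_ge) auto

lemma sup_norm_le: "(\<And>s. s \<in> states D \<Longrightarrow> \<bar>f s\<bar> \<le> c) \<Longrightarrow> sup_norm D f \<le> c"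
  unfolding sup_norm_def by (intro Max.boundedI) auto

end

section \<open>The value function of a fixed policy\<close>

locale mdp_policy = fin_mdp D for D :: "('s, 'a) mdp" +
  fixes \<pi> :: "('s, 'a) policy"
  assumes policy: "\<pi> \<in> policies D"
begin

lemma set_policy: "s \<in> states D \<Longrightarrow> set_pmf (\<pi> s) \<subseteq> actions D"
  using policy by (auto simp: policies_def)

lemma expectation_transition_bind:
  fixes f :: "'a \<Rightarrow> 's \<Rightarrow> 'b pmf" and g :: "'b \<Rightarrow> real"
  assumes "s \<in> states D" "\<And>a s'. a \<in> actions D \<Longrightarrow> s' \<in> states D \<Longrightarrow> finite (set_pmf (f a s'))"
  shows "measure_pmf.expectation (do { a \<leftarrow> \<pi> s; s' \<leftarrow> transition D s a; f a s' }) g =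
    (\<Sum>a\<in>actions D. pmf (\<pi> s) a * (\<Sum>s'\<in>states D. pmf (transition D s a) s' * measure_pmf.expectation (f a s') g))"
proof -
  have "measure_pmf.expectation (do { a \<leftarrow> \<pi> s; s' \<leftarrow> transition D s a; f a s' }) g =
      (\<Sum>a\<in>actions D. pmf (\<pi> s) a * measure_pmf.expectation (do { s' \<leftarrow> transition D s a; f a s' }) g)"
  proof (subst pmf_expectation_bind[of "actions D"])
    fix a assume a: "a \<in> actions D"
    have "set_pmf (transition D s a \<bind> f a) \<subseteq> (\<Union>s'\<in>states D. set_pmf (f a s'))"
      using set_transition[OF assms(1) a] by auto
    then show "finite (set_pmf (transition D s a \<bind> f a))"
      by (rule finite_subset) (use assms a in auto)
  qed (use set_policy assms in auto)
  also have "\<dots> = (\<Sum>a\<in>actions D. pmf (\<pi> s) a *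
      (\<Sum>s'\<in>states D. pmf (transition D s a) s' * measure_pmf.expectation (f a s') g))"
  proof (intro sum.cong refl arg_cong2[where f = times])
    fix a assume a: "a \<in> actions D"
    show "measure_pmf.expectation (transition D s a \<bind> f a) g =
        (\<Sum>s'\<in>states D. pmf (transition D s a) s' * measure_pmf.expectation (f a s') g)"
      using assms a set_transition[OF assms(1) a] by (subst pmf_expectation_bind[of "states D"]) auto
  qed
  finally show ?thesis .
qed

lemma set_traj_marginal: "s \<in> states D \<Longrightarrow> set_pmf (traj_marginal D \<pi> t s) \<subseteq> states D \<times> actions D"
proof (induction t)
  case 0
  then show ?case using set_policy by auto
next
  case (Suc t)
  then show ?case
    using set_policy set_transition by (fastforce simp: traj_step_def)
qed

text \<open>The definition appends steps at the end, as the trajectory kernels do, whereas the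
  Bellman equation conditions on the first step. Associativity of bind moves the recursion to the
  front.\<close>

lemma traj_marginal_Suc_left:
  "traj_marginal D \<pi> (Suc t) s = do { a \<leftarrow> \<pi> s; s' \<leftarrow> transition D s a; traj_marginal D \<pi> t s' }"
proof (induction t)
  case 0
  then show ?case by (simp add: bind_assoc_pmf bind_return_pmf traj_step_def)
next
  case (Suc t)
  have "traj_marginal D \<pi> (Suc (Suc t)) s = traj_marginal D \<pi> (Suc t) s \<bind> traj_step D \<pi>"
    by simp
  also have "\<dots> = do { a \<leftarrow> \<pi> s; s' \<leftarrow> transition D s a; traj_marginal D \<pi> (Suc t) s' }"
    unfolding Suc by (simp add: bind_assoc_pmf)
  finally show ?case .
qed

definition mean_reward :: "nat \<Rightarrow> 's \<Rightarrow> real" where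
  "mean_reward t s =
     measure_pmf.expectation (traj_marginal D \<pi> t s) (\<lambda>x. reward D (fst x) (snd x))"

lemma mean_reward_0: "s \<in> states D \<Longrightarrow> mean_reward 0 s = (\<Sum>a\<in>actions D. pmf (\<pi> s) a * reward D s a)"
  using set_policy unfolding mean_reward_def traj_marginal.simps
  by (subst pmf_expectation_bind[of "actions D"]) auto

lemma mean_reward_Suc:
  assumes "s \<in> states D"
  shows "mean_reward (Suc t) s =
    (\<Sum>a\<in>actions D. pmf (\<pi> s) a * (\<Sum>s'\<in>states D. pmf (transition D s a) s' * mean_reward t s'))"
  unfolding mean_reward_def traj_marginal_Suc_left
  using assms finite_subset[OF set_traj_marginal] by (intro expectation_transition_bind) auto

lemma mean_reward_bounds:
  assumes "s \<in> states D"
  shows "0 \<le> mean_reward t s \<and> mean_reward t s \<le> 1"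
proof -
  have AE: "AE x in traj_marginal D \<pi> t s. 0 \<le> reward D (fst x) (snd x) \<and> reward D (fst x) (snd x) \<le> 1"
    using set_traj_marginal[OF assms, of t] reward_bounds by (fastforce simp: AE_measure_pmf_iff)
  then have "integrable (traj_marginal D \<pi> t s) (\<lambda>x. reward D (fst x) (snd x))"
    by (intro measure_pmf.integrable_const_bound[where B = 1]) auto
  with AE show ?thesis
    unfolding mean_reward_def
    by (auto intro!: integral_nonneg_AE measure_pmf.integral_le_const)
qed

text \<open>The geometric majorant permits exchanging integral and series. Rewards are bounded only
  at pairs in \<open>states D \<times> actions D\<close>, so the bounds on the trajectory space hold
  almost everywhere.\<close>

lemma value_fun_sums:
  assumes "s \<in> states D"
  shows "(\<lambda>t. \<gamma> ^ t * mean_reward t s) sums value_fun D \<pi> s"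
proof -
  interpret prob_space "traj_space D \<pi> s" by (rule prob_space_traj_space)
  let ?r = "\<lambda>t (\<omega> :: nat \<Rightarrow> 's \<times> 'a). \<gamma> ^ t * reward D (fst (\<omega> t)) (snd (\<omega> t))"
  have meas: "?r t \<in> borel_measurable (traj_space D \<pi> s)" for t
    using measurable_compose[OF traj_space_component_measurable[of t D \<pi> s],
        of "\<lambda>x. \<gamma> ^ t * reward D (fst x) (snd x)" borel] by simp
  have bound: "AE \<omega> in traj_space D \<pi> s. \<bar>?r t \<omega>\<bar> \<le> \<gamma> ^ t" for t
  proof (rule AE_traj_space)
    fix x assume "x \<in> set_pmf (traj_marginal D \<pi> t s)"
    then have "fst x \<in> states D" "snd x \<in> actions D"
      using set_traj_marginal[OF assms, of t] by auto
    from reward_bounds[OF this] have "\<bar>reward D (fst x) (snd x)\<bar> \<le> 1"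
      by simp
    then have "\<gamma> ^ t * \<bar>reward D (fst x) (snd x)\<bar> \<le> \<gamma> ^ t * 1"
      using \<gamma> by (intro mult_left_mono) auto
    then show "\<bar>\<gamma> ^ t * reward D (fst x) (snd x)\<bar> \<le> \<gamma> ^ t"
      using \<gamma> by (simp add: abs_mult)
  qed
  have int: "integrable (traj_space D \<pi> s) (?r t)" for t
    using bound meas by (intro integrable_const_bound[where B = "\<gamma> ^ t"]) auto
  have geo: "summable (\<lambda>t. \<gamma> ^ t)"
    using \<gamma> by (intro summable_geometric) auto
  have "(\<lambda>t. \<integral>\<omega>. ?r t \<omega> \<partial>traj_space D \<pi> s) sums (\<integral>\<omega>. suminf (\<lambda>t. ?r t \<omega>) \<partial>traj_space D \<pi> s)"
  proof (rule sums_integral[OF int])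
    have "AE \<omega> in traj_space D \<pi> s. \<forall>t. \<bar>?r t \<omega>\<bar> \<le> \<gamma> ^ t"
      using bound by (simp add: AE_all_countable)
    then show "AE \<omega> in traj_space D \<pi> s. summable (\<lambda>t. norm (?r t \<omega>))"
      by eventually_elim (rule summable_comparison_test'[OF geo, of 0], simp)
    show "summable (\<lambda>t. \<integral>\<omega>. norm (?r t \<omega>) \<partial>traj_space D \<pi> s)"
    proof (rule summable_comparison_test'[OF geo, of 0])
      fix t
      have "(\<integral>\<omega>. norm (?r t \<omega>) \<partial>traj_space D \<pi> s) \<le> \<gamma> ^ t"
        using int bound[of t] by (intro integral_le_const) auto
      moreover have "0 \<le> (\<integral>\<omega>. norm (?r t \<omega>) \<partial>traj_space D \<pi> s)"
        by (intro integral_nonneg_AE) auto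
      ultimately show "norm (\<integral>\<omega>. norm (?r t \<omega>) \<partial>traj_space D \<pi> s) \<le> \<gamma> ^ t"
        by simp
    qed
  qed
  moreover have "(\<integral>\<omega>. reward D (fst (\<omega> t)) (snd (\<omega> t)) \<partial>traj_space D \<pi> s) = mean_reward t s" for t
    unfolding mean_reward_def using integral_traj_space[where f = "\<lambda>x. reward D (fst x) (snd x)"] by simp
  ultimately show ?thesis
    by (simp add: value_fun_def)
qed

lemma value_fun_bounds:
  assumes "s \<in> states D"
  shows "0 \<le> value_fun D \<pi> s" "value_fun D \<pi> s \<le> 1 / (1 - \<gamma>)"
proof -
  note S = value_fun_sums[OF assms]
  show "0 \<le> value_fun D \<pi> s"
    using \<gamma> mean_reward_bounds[OF assms] by (intro sums_le[OF _ sums_zero S]) auto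
  have "(\<lambda>t. \<gamma> ^ t) sums (1 / (1 - \<gamma>))"
    using \<gamma> by (intro geometric_sums) auto
  then show "value_fun D \<pi> s \<le> 1 / (1 - \<gamma>)"
    using \<gamma> mean_reward_bounds[OF assms] by (intro sums_le[OF _ S]) (auto simp: mult_left_le)
qed

lemma pol_backup_value_fun:
  assumes s: "s \<in> states D"
  shows "pol_backup D \<pi> (value_fun D \<pi>) s = value_fun D \<pi> s"
proof -
  \<comment> \<open>The series shifted by one: its tail is the discounted expected value at the next
    state, and the missing term of index 0 is the expected immediate reward.\<close>
  have "(\<lambda>t. \<Sum>a\<in>actions D. pmf (\<pi> s) a * (\<gamma> * (\<Sum>s'\<in>states D. pmf (transition D s a) s' * (\<gamma> ^ t * mean_reward t s'))))
      sums (\<Sum>a\<in>actions D. pmf (\<pi> s) a * (\<gamma> * (\<Sum>s'\<in>states D. pmf (transition D s a) s' * value_fun D \<pi> s')))"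
    by (intro sums_sum sums_mult value_fun_sums)
  also have "(\<lambda>t. \<Sum>a\<in>actions D. pmf (\<pi> s) a * (\<gamma> * (\<Sum>s'\<in>states D. pmf (transition D s a) s' * (\<gamma> ^ t * mean_reward t s'))))
      = (\<lambda>t. \<gamma> ^ Suc t * mean_reward (Suc t) s)"
    using s by (intro ext) (simp add: mean_reward_Suc sum_distrib_left mult_ac)
  finally have "(\<lambda>t. \<gamma> ^ t * mean_reward t s) sums
      ((\<Sum>a\<in>actions D. pmf (\<pi> s) a * (\<gamma> * (\<Sum>s'\<in>states D. pmf (transition D s a) s' * value_fun D \<pi> s'))) + mean_reward 0 s)"
    by (subst (asm) sums_Suc_iff) simp
  with value_fun_sums[OF s] have "value_fun D \<pi> s =
      (\<Sum>a\<in>actions D. pmf (\<pi> s) a * (\<gamma> * (\<Sum>s'\<in>states D. pmf (transition D s a) s' * value_fun D \<pi> s'))) + mean_reward 0 s"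
    by (rule sums_unique2)
  also have "\<dots> = pol_backup D \<pi> (value_fun D \<pi>) s"
    using s by (simp add: mean_reward_0 pol_backup_def policy_avg_def qval_def sum.distrib distrib_left)
  finally show ?thesis by simp
qed

lemma disc_return_Nil [simp]: "disc_return D [] = 0"
  by (simp add: disc_return_def)

lemma disc_return_Cons: "disc_return D (x # xs) = reward D (fst x) (snd x) + \<gamma> * disc_return D xs"
  unfolding disc_return_def length_Cons sum.lessThan_Suc_shift
  by (simp add: sum_distrib_left mult.assoc)

lemma finite_set_traj: "s \<in> states D \<Longrightarrow> finite (set_pmf (traj D \<pi> n s))"
proof (induction n arbitrary: s)
  case (Suc n)
  have "set_pmf (traj D \<pi> (Suc n) s) \<subseteq>
      (\<Union>a\<in>actions D. \<Union>s'\<in>states D. (#) (s, a) ` set_pmf (traj D \<pi> n s'))"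
  proof
    fix xs assume "xs \<in> set_pmf (traj D \<pi> (Suc n) s)"
    then obtain a s' ys where *: "a \<in> set_pmf (\<pi> s)" "s' \<in> set_pmf (transition D s a)"
      "ys \<in> set_pmf (traj D \<pi> n s')" "xs = (s, a) # ys" by auto
    then have "a \<in> actions D"
      using set_policy[OF Suc.prems] by auto
    moreover from this have "s' \<in> states D"
      using set_transition[OF Suc.prems] * by auto
    ultimately show "xs \<in> (\<Union>a\<in>actions D. \<Union>s'\<in>states D. (#) (s, a) ` set_pmf (traj D \<pi> n s'))"
      using * by auto
  qed
  then show ?case
    by (rule finite_subset) (use Suc.IH in auto)
qed simp

lemma disc_return_bounds:
  "s \<in> states D \<Longrightarrow> xs \<in> set_pmf (traj D \<pi> n s) \<Longrightarrow>
    0 \<le> disc_return D xs \<and> disc_return D xs \<le> 1 / (1 - \<gamma>)"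
proof (induction n arbitrary: s xs)
  case 0
  then show ?case using \<gamma> by simp
next
  case (Suc n)
  then obtain a s' ys where *: "a \<in> set_pmf (\<pi> s)" "s' \<in> set_pmf (transition D s a)"
    "ys \<in> set_pmf (traj D \<pi> n s')" "xs = (s, a) # ys" by auto
  have a: "a \<in> actions D"
    using set_policy[OF Suc.prems(1)] * by auto
  have s': "s' \<in> states D"
    using set_transition[OF Suc.prems(1) a] * by auto
  have IH: "0 \<le> disc_return D ys \<and> disc_return D ys \<le> 1 / (1 - \<gamma>)"
    using Suc.IH[OF s' *(3)] .
  have "\<gamma> * disc_return D ys \<le> \<gamma> * (1 / (1 - \<gamma>))"
    using IH \<gamma> by (intro mult_left_mono) auto
  moreover have "1 + \<gamma> * (1 / (1 - \<gamma>)) = 1 / (1 - \<gamma>)"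
    using \<gamma> by (simp add: field_simps)
  moreover have "0 \<le> \<gamma> * disc_return D ys"
    using IH \<gamma> by simp
  ultimately show ?case
    using reward_bounds[OF Suc.prems(1) a] unfolding *(4) disc_return_Cons fst_conv snd_conv by linarith
qed

definition rollout :: "nat \<Rightarrow> 's \<Rightarrow> real" where
  "rollout n s = measure_pmf.expectation (traj D \<pi> n s) (disc_return D)"

text \<open>Hence \<open>rollout n\<close> is the n-fold policy backup of 0, which turns the
  truncation bias into a matter of contraction.\<close>

lemma rollout_Suc:
  assumes s: "s \<in> states D"
  shows "rollout (Suc n) s = pol_backup D \<pi> (rollout n) s"
proof -
  have "rollout (Suc n) s = (\<Sum>a\<in>actions D. pmf (\<pi> s) a * (\<Sum>s'\<in>states D. pmf (transition D s a) s' *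
      measure_pmf.expectation (traj D \<pi> n s' \<bind> (\<lambda>xs. return_pmf ((s, a) # xs))) (disc_return D)))"
    unfolding rollout_def traj.simps using s
    by (intro expectation_transition_bind) (auto simp: finite_set_traj)
  also have "\<dots> = (\<Sum>a\<in>actions D. pmf (\<pi> s) a * (\<Sum>s'\<in>states D. pmf (transition D s a) s' *
      (reward D s a + \<gamma> * rollout n s')))"
  proof (intro sum.cong refl arg_cong2[where f = times])
    fix a s' assume "s' \<in> states D"
    have "measure_pmf.expectation (traj D \<pi> n s' \<bind> (\<lambda>xs. return_pmf ((s, a) # xs))) (disc_return D) =
        measure_pmf.expectation (traj D \<pi> n s') (\<lambda>xs. reward D s a + \<gamma> * disc_return D xs)"
      by (simp flip: map_pmf_def add: disc_return_Cons)
    also have "\<dots> = reward D s a + \<gamma> * rollout n s'"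
      using \<open>s' \<in> states D\<close> by (simp add: rollout_def integrable_measure_pmf_finite finite_set_traj)
    finally show "measure_pmf.expectation (traj D \<pi> n s' \<bind> (\<lambda>xs. return_pmf ((s, a) # xs))) (disc_return D) =
        reward D s a + \<gamma> * rollout n s'" .
  qed
  also have "\<dots> = pol_backup D \<pi> (rollout n) s"
    unfolding pol_backup_def policy_avg_def qval_def
  proof (intro sum.cong refl arg_cong2[where f = times])
    fix a assume a: "a \<in> actions D"
    have "(\<Sum>s'\<in>states D. pmf (transition D s a) s' * (reward D s a + \<gamma> * rollout n s')) =
        (\<Sum>s'\<in>states D. pmf (transition D s a) s') * reward D s a +
        \<gamma> * (\<Sum>s'\<in>states D. pmf (transition D s a) s' * rollout n s')"
      by (simp add: algebra_simps sum.distrib sum_distrib_left sum_distrib_right)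
    then show "(\<Sum>s'\<in>states D. pmf (transition D s a) s' * (reward D s a + \<gamma> * rollout n s')) =
        reward D s a + \<gamma> * (\<Sum>s'\<in>states D. pmf (transition D s a) s' * rollout n s')"
      by (simp add: sum_pmf_states s a)
  qed
  finally show ?thesis .
qed

text \<open>Each backup contracts by \<gamma>, and the initial distance is that between 0 and a
  value of at most \<open>1 / (1 - \<gamma>)\<close>.\<close>

lemma abs_rollout_minus_value_fun_le:
  "s \<in> states D \<Longrightarrow> \<bar>rollout n s - value_fun D \<pi> s\<bar> \<le> \<gamma> ^ n / (1 - \<gamma>)"
proof (induction n arbitrary: s)
  case 0
  then show ?case
    using value_fun_bounds by (simp add: rollout_def)
next
  case (Suc n)
  have "rollout n s \<le> value_fun D \<pi> s + \<gamma> ^ n / (1 - \<gamma>)"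
    "value_fun D \<pi> s \<le> rollout n s + \<gamma> ^ n / (1 - \<gamma>)" if "s \<in> states D" for s
    using Suc.IH[OF that] by auto
  then have "pol_backup D \<pi> (rollout n) s \<le> pol_backup D \<pi> (value_fun D \<pi>) s + \<gamma> * (\<gamma> ^ n / (1 - \<gamma>))"
    "pol_backup D \<pi> (value_fun D \<pi>) s \<le> pol_backup D \<pi> (rollout n) s + \<gamma> * (\<gamma> ^ n / (1 - \<gamma>))"
    using policy Suc.prems by (intro pol_backup_le_shift; simp)+
  then show ?case
    by (simp add: rollout_Suc[OF Suc.prems] pol_backup_value_fun[OF Suc.prems])
qed

text \<open>If one backup of \<open>U\<close> loses at most \<open>e\<close>, repeated backups lose
  at most a geometric sum. Starting from the backup of \<open>U\<close> instead of \<open>U\<close>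
  leaves out the first summand, hence the factor \<gamma>.\<close>

lemma value_fun_ge_pol_backup:
  assumes U: "\<And>s. s \<in> states D \<Longrightarrow> U s \<le> pol_backup D \<pi> U s + e" and s: "s \<in> states D"
  shows "pol_backup D \<pi> U s - \<gamma> * (e / (1 - \<gamma>)) \<le> value_fun D \<pi> s"
proof -
  \<comment> \<open>The largest signed excess of \<open>U\<close> over the value. At its maximiser
    the hypothesis yields \<open>d \<le> \<gamma> * d + e\<close>, which replaces iterating the
    backup to its limit.\<close>
  define d where "d = Max ((\<lambda>s. U s - value_fun D \<pi> s) ` states D)"
  have d: "U s \<le> value_fun D \<pi> s + d" if "s \<in> states D" for s
  proof -
    have "U s - value_fun D \<pi> s \<le> d"
      unfolding d_def using that by (intro Max_ge) auto
    then show ?thesis by simp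
  qed
  have backup: "pol_backup D \<pi> U s \<le> value_fun D \<pi> s + \<gamma> * d" if "s \<in> states D" for s
    using pol_backup_le_shift[where V = U and W = "value_fun D \<pi>", OF policy d that] pol_backup_value_fun[OF that] by simp
  have "d \<le> \<gamma> * d + e"
    unfolding d_def
  proof (rule Max.boundedI, unfold d_def[symmetric])
    fix y assume "y \<in> (\<lambda>s. U s - value_fun D \<pi> s) ` states D"
    then show "y \<le> \<gamma> * d + e"
      using U backup by fastforce
  qed auto
  then have "d * (1 - \<gamma>) \<le> e"
    by (simp add: algebra_simps)
  then have "d \<le> e / (1 - \<gamma>)"
    using \<gamma> by (subst pos_le_divide_eq) auto
  then have "\<gamma> * d \<le> \<gamma> * (e / (1 - \<gamma>))"
    using \<gamma> by (intro mult_left_mono) auto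
  then show ?thesis
    using backup[OF s] by linarith
qed

end

section \<open>Improvement by policies that are nearly greedy for the lookahead\<close>

context fin_mdp
begin

lemma value_fun_le_opt_value:
  assumes "\<pi> \<in> policies D" "s \<in> states D"
  shows "value_fun D \<pi> s \<le> opt_value D s"
proof -
  have "value_fun D \<pi>' s \<le> 1 / (1 - \<gamma>)" if "\<pi>' \<in> policies D" for \<pi>'
  proof -
    interpret mdp_policy D \<pi>' by unfold_locales fact
    show ?thesis using value_fun_bounds assms by simp
  qed
  then show ?thesis
    unfolding opt_value_def using assms by (intro cSUP_upper bdd_aboveI2)
qed

lemma policies_nonempty: "policies D \<noteq> {}"
proof -
  obtain a where "a \<in> actions D"
    using actions_nonempty by blast
  then have "(\<lambda>_. return_pmf a) \<in> policies D"
    by (simp add: policies_def)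
  then show ?thesis by blast
qed

text \<open>Every policy value is a fixed point of its own backup, which the optimal backup of the
  supremum dominates. Iterated, this bounds the optimal value by its h-fold backup.\<close>

lemma opt_value_le_opt_backup:
  assumes s: "s \<in> states D"
  shows "opt_value D s \<le> opt_backup D (opt_value D) s"
  unfolding opt_value_def[of D s]
proof (rule cSUP_least[OF policies_nonempty])
  fix \<pi> assume \<pi>: "\<pi> \<in> policies D"
  interpret mdp_policy D \<pi> by unfold_locales fact
  have "value_fun D \<pi> s = pol_backup D \<pi> (value_fun D \<pi>) s"
    using s by (simp add: pol_backup_value_fun)
  also have "\<dots> \<le> pol_backup D \<pi> (opt_value D) s + \<gamma> * 0"
    using \<pi> s by (intro pol_backup_le_shift) (auto intro: value_fun_le_opt_value)
  also have "\<dots> \<le> opt_backup D (opt_value D) s"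
    using pol_backup_le_opt_backup[OF \<pi> s] by simp
  finally show "value_fun D \<pi> s \<le> opt_backup D (opt_value D) s" .
qed

lemma le_opt_backup_funpow:
  assumes "\<And>s. s \<in> states D \<Longrightarrow> V s \<le> opt_backup D V s" "s \<in> states D"
  shows "V s \<le> (opt_backup D ^^ n) V s"
  using assms(2)
proof (induction n arbitrary: s)
  case (Suc n)
  have "V s \<le> opt_backup D V s"
    using assms Suc.prems by simp
  also have "\<dots> \<le> opt_backup D ((opt_backup D ^^ n) V) s + \<gamma> * 0"
    using Suc by (intro opt_backup_le_shift) auto
  finally show ?case by simp
qed simp

lemma lookahead_improvement:
  assumes h: "1 \<le> h" and \<pi>: "\<pi> \<in> policies D" and \<pi>': "\<pi>' \<in> policies D"
    and step: "\<And>s. s \<in> states D \<Longrightarrow> opt_backup D ((opt_backup D ^^ (h - 1)) (value_fun D \<pi>)) s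
      \<le> pol_backup D \<pi>' ((opt_backup D ^^ (h - 1)) (value_fun D \<pi>)) s + e"
  shows "sup_norm D (\<lambda>s. opt_value D s - value_fun D \<pi>' s) \<le>
    \<gamma> ^ h * sup_norm D (\<lambda>s. opt_value D s - value_fun D \<pi> s) + e / (1 - \<gamma>)"
proof (rule sup_norm_le)
  fix s assume s: "s \<in> states D"
  interpret p: mdp_policy D \<pi> by unfold_locales fact
  interpret p': mdp_policy D \<pi>' by unfold_locales fact
  let ?V = "value_fun D \<pi>"
  define U where "U = (opt_backup D ^^ (h - 1)) ?V"
  define d where "d = sup_norm D (\<lambda>s. opt_value D s - value_fun D \<pi> s)"
  have TU: "opt_backup D U = (opt_backup D ^^ h) ?V"
    using h unfolding U_def by (cases h) auto
  \<comment> \<open>The value is a fixed point of the policy backup, which the optimal backup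
    dominates; monotonicity carries this inequality to \<open>U\<close>.\<close>
  have incr: "?V s \<le> opt_backup D ?V s" if "s \<in> states D" for s
    using pol_backup_le_opt_backup[OF \<pi> that, of ?V] p.pol_backup_value_fun[OF that] by simp
  have U: "U s \<le> opt_backup D U s" if "s \<in> states D" for s
  proof -
    have "U s \<le> (opt_backup D ^^ (h - 1)) (opt_backup D ?V) s + \<gamma> ^ (h - 1) * 0"
      unfolding U_def using incr that by (intro opt_backup_funpow_le_shift) auto
    then show ?thesis
      by (simp add: U_def funpow_swap1)
  qed
  have "pol_backup D \<pi>' U s - \<gamma> * (e / (1 - \<gamma>)) \<le> value_fun D \<pi>' s"
    using U step s by (intro p'.value_fun_ge_pol_backup) (fastforce simp: U_def)
  moreover have "opt_backup D U s \<le> pol_backup D \<pi>' U s + e"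
    using step[OF s] by (simp add: U_def)
  moreover have "opt_value D s \<le> opt_backup D U s + \<gamma> ^ h * d"
  proof -
    have "opt_value D s \<le> (opt_backup D ^^ h) (opt_value D) s"
      using opt_value_le_opt_backup s by (rule le_opt_backup_funpow)
    also have "\<dots> \<le> (opt_backup D ^^ h) ?V s + \<gamma> ^ h * d"
      using abs_le_sup_norm[of _ "\<lambda>s. opt_value D s - value_fun D \<pi> s"] s
      unfolding d_def by (intro opt_backup_funpow_le_shift) fastforce+
    finally show ?thesis by (simp add: TU)
  qed
  \<comment> \<open>The total loss: \<open>e\<close> between the optimal and the policy backup of
    \<open>U\<close>, and \<open>\<gamma> * (e / (1 - \<gamma>))\<close> between that policy backup
    and the value of \<open>\<pi>'\<close>.\<close>
  moreover have "\<gamma> * (e / (1 - \<gamma>)) + e = e / (1 - \<gamma>)"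
    using \<gamma> by (simp add: field_simps)
  ultimately have "opt_value D s - value_fun D \<pi>' s \<le> \<gamma> ^ h * d + e / (1 - \<gamma>)"
    by linarith
  moreover have "value_fun D \<pi>' s \<le> opt_value D s"
    using \<pi>' s by (rule value_fun_le_opt_value)
  ultimately show "\<bar>opt_value D s - value_fun D \<pi>' s\<bar> \<le>
      \<gamma> ^ h * sup_norm D (\<lambda>s. opt_value D s - value_fun D \<pi> s) + e / (1 - \<gamma>)"
    by (simp add: d_def)
qed

text \<open>The estimation error counts twice: once where the estimated maximum replaces the true
  one, and once where \<open>\<pi>'\<close> is evaluated under the true action values instead of the
  estimated ones.\<close>

lemma lookahead_improvement_inexact:
  assumes h: "1 \<le> h" and \<pi>: "\<pi> \<in> policies D" and \<pi>': "\<pi>' \<in> policies D"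
    and Q: "\<And>s a. s \<in> states D \<Longrightarrow> a \<in> actions D \<Longrightarrow>
      \<bar>Q s a - qval D ((opt_backup D ^^ (h - 1)) (value_fun D \<pi>)) s a\<bar> \<le> b"
    and gap: "\<And>s. s \<in> states D \<Longrightarrow> Max (Q s ` actions D) - c \<le> policy_avg D Q \<pi>' s"
  shows "sup_norm D (\<lambda>s. opt_value D s - value_fun D \<pi>' s) \<le>
    \<gamma> ^ h * sup_norm D (\<lambda>s. opt_value D s - value_fun D \<pi> s) + (2 * b + c) / (1 - \<gamma>)"
proof (rule lookahead_improvement[OF h \<pi> \<pi>'])
  fix s assume s: "s \<in> states D"
  let ?Q = "qval D ((opt_backup D ^^ (h - 1)) (value_fun D \<pi>))"
  have "Max (?Q s ` actions D) \<le> Max (Q s ` actions D) + b"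
  proof (rule Max.boundedI)
    fix y assume "y \<in> ?Q s ` actions D"
    then obtain a where a: "a \<in> actions D" "y = ?Q s a" by auto
    have "?Q s a \<le> Q s a + b"
      using Q[OF s a(1)] by simp
    also have "Q s a \<le> Max (Q s ` actions D)"
      using a by (intro Max_ge) auto
    finally show "y \<le> Max (Q s ` actions D) + b"
      using a by simp
  qed auto
  moreover have "policy_avg D Q \<pi>' s \<le> policy_avg D ?Q \<pi>' s + b"
    using \<pi>' s
  proof (rule policy_avg_le_shift)
    fix a assume "a \<in> actions D"
    from Q[OF s this] show "Q s a \<le> ?Q s a + b" by simp
  qed
  ultimately show "opt_backup D ((opt_backup D ^^ (h - 1)) (value_fun D \<pi>)) s \<le>
      pol_backup D \<pi>' ((opt_backup D ^^ (h - 1)) (value_fun D \<pi>)) s + (2 * b + c)"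
    using gap[OF s] unfolding opt_backup_def pol_backup_def by linarith
qed

end


section \<open>The mirror step\<close>

lemma lookup_scaleR [simp]:
  fixes x :: "'a \<Rightarrow>\<^sub>0 'b::real_vector"
  shows "Poly_Mapping.lookup (c *\<^sub>R x) a = c *\<^sub>R Poly_Mapping.lookup x a"
proof -
  have "finite {i. c *\<^sub>R Poly_Mapping.lookup x i \<noteq> 0}"
    by (rule finite_subset[of _ "Poly_Mapping.keys x"]) (auto simp: in_keys_iff)
  then show ?thesis
    by (simp add: scaleR_poly_mapping_def)
qed

lemma abs_lookup_le_norm:
  fixes x :: "'a \<Rightarrow>\<^sub>0 real"
  shows "\<bar>Poly_Mapping.lookup x a\<bar> \<le> norm x"
proof (cases "a \<in> Poly_Mapping.keys x")
  case True
  then have "\<bar>Poly_Mapping.lookup x a\<bar> \<le> (\<Sum>b\<in>Poly_Mapping.keys x. \<bar>Poly_Mapping.lookup x b\<bar>)"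
    by (intro member_le_sum) auto
  then show ?thesis
    by (simp add: norm_poly_mapping_def dist_poly_mapping_def)
qed (simp add: in_keys_iff)

lemma bounded_linear_lookup: "bounded_linear (\<lambda>x::'a \<Rightarrow>\<^sub>0 real. Poly_Mapping.lookup x a)"
  by (rule bounded_linear_intro[where K = 1]) (auto simp: lookup_add abs_lookup_le_norm)

lemma pm_inner_eq_sum:
  assumes "finite A" "Poly_Mapping.keys x \<subseteq> A"
  shows "pm_inner x y = (\<Sum>a\<in>A. Poly_Mapping.lookup x a * Poly_Mapping.lookup y a)"
  unfolding pm_inner_def using assms by (intro sum.mono_neutral_left) (auto simp: in_keys_iff)

lemma pm_inner_commute: "pm_inner x y = pm_inner y x"
proof -
  have "pm_inner x y = (\<Sum>a\<in>Poly_Mapping.keys x \<union> Poly_Mapping.keys y.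
      Poly_Mapping.lookup x a * Poly_Mapping.lookup y a)"
    by (intro pm_inner_eq_sum) auto
  also have "\<dots> = pm_inner y x"
    by (subst pm_inner_eq_sum[of "Poly_Mapping.keys x \<union> Poly_Mapping.keys y"]) (auto simp: mult.commute)
  finally show ?thesis .
qed

lemma bounded_linear_pm_inner: "bounded_linear (pm_inner x)"
  unfolding pm_inner_def[abs_def]
  by (intro bounded_linear_sum bounded_linear_const_mult bounded_linear_lookup)

lemma pm_inner_add_right: "pm_inner x (y + z) = pm_inner x y + pm_inner x z"
  and pm_inner_diff_right: "pm_inner x (y - z) = pm_inner x y - pm_inner x z"
  and pm_inner_scaleR_right: "pm_inner x (c *\<^sub>R y) = c * pm_inner x y"
  and pm_inner_zero_right [simp]: "pm_inner x 0 = 0"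
  using linear_simps[OF bounded_linear_pm_inner[of x]] by auto

lemma pm_inner_add_left: "pm_inner (x + y) z = pm_inner x z + pm_inner y z"
  and pm_inner_diff_left: "pm_inner (x - y) z = pm_inner x z - pm_inner y z"
  and pm_inner_scaleR_left: "pm_inner (c *\<^sub>R x) z = c * pm_inner x z"
  by (simp_all add: pm_inner_commute[of _ z] pm_inner_add_right pm_inner_diff_right pm_inner_scaleR_right)

lemma pm_inner_self_eq_0: "pm_inner x x = 0 \<longleftrightarrow> x = 0"
proof
  assume "pm_inner x x = 0"
  then have "\<forall>a\<in>Poly_Mapping.keys x. Poly_Mapping.lookup x a * Poly_Mapping.lookup x a = 0"
    unfolding pm_inner_def by (subst (asm) sum_nonneg_eq_0_iff) auto
  then show "x = 0"
    by (intro poly_mapping_eqI) (metis in_keys_iff lookup_zero mult_eq_0_iff)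
qed simp

text \<open>Riesz representation on a finite-dimensional subspace by Gram-Schmidt: each new
  generator \<open>b\<close> contributes its component \<open>c\<close> orthogonal to the span so
  far.\<close>

lemma linear_functional_span_eq_pm_inner:
  fixes L :: "('a \<Rightarrow>\<^sub>0 real) \<Rightarrow> real"
  assumes "finite B" and L: "linear L"
  shows "\<exists>g\<in>span B. \<forall>v\<in>span B. pm_inner g v = L v"
  using assms(1) L
proof (induction B arbitrary: L rule: finite_induct)
  case empty
  then show ?case by (simp add: linear_0)
next
  case (insert b B)
  have "linear (pm_inner b)"
    using bounded_linear_pm_inner by (rule bounded_linear.linear)
  \<comment> \<open>For the functional \<open>pm_inner b\<close> the induction hypothesis yields the
    orthogonal projection \<open>p\<close> of \<open>b\<close> onto \<open>span B\<close>; hence the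
    induction over arbitrary functionals.\<close>
  from insert.IH[OF this] obtain p where p: "p \<in> span B" "\<forall>v\<in>span B. pm_inner p v = pm_inner b v"
    by blast
  from insert.IH[OF insert.prems] obtain g where g: "g \<in> span B" "\<forall>v\<in>span B. pm_inner g v = L v"
    by blast
  define c where "c = b - p"
  have c: "pm_inner c v = 0" if "v \<in> span B" for v
    using p that by (simp add: c_def pm_inner_diff_left)
  show ?case
  proof (cases "c = 0")
    case True
    then have "span (insert b B) = span B"
      using p by (simp add: c_def span_redundant)
    with g show ?thesis by auto
  next
    case False
    \<comment> \<open>\<open>g\<close> represents \<open>L\<close> on \<open>span B\<close> and is
      orthogonal to \<open>c\<close>, so the coefficient of \<open>c\<close> is fixed by the value
      of \<open>L\<close> at \<open>c\<close>.\<close>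
    define t where "t = L c / pm_inner c c"
    have t: "t * pm_inner c c = L c"
      using False by (simp add: t_def pm_inner_self_eq_0)
    have sub: "span B \<subseteq> span (insert b B)"
      by (intro span_mono) auto
    have "c \<in> span (insert b B)"
      unfolding c_def using p sub by (intro span_diff) (auto intro: span_base)
    then have "g + t *\<^sub>R c \<in> span (insert b B)"
      using g sub by (intro span_add span_scale) auto
    moreover have "pm_inner (g + t *\<^sub>R c) v = L v" if "v \<in> span (insert b B)" for v
    proof -
      from that obtain k where k: "v - k *\<^sub>R b \<in> span B"
        by (auto simp: span_insert)
      define w where "w = v - k *\<^sub>R b + k *\<^sub>R p"
      have w: "w \<in> span B"
        unfolding w_def using k p by (intro span_add span_scale) auto
      have v: "v = w + k *\<^sub>R c"
        by (simp add: w_def c_def algebra_simps)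
      have "pm_inner g c = 0"
        using c[OF g(1)] by (simp add: pm_inner_commute)
      then have "pm_inner (g + t *\<^sub>R c) v = L w + k * (t * pm_inner c c)"
        using w g c[OF w] by (simp add: v pm_inner_add_left pm_inner_add_right pm_inner_scaleR_left
            pm_inner_scaleR_right)
      also have "\<dots> = L v"
        using insert.prems by (simp add: v t linear_add linear_scale)
      finally show ?thesis .
    qed
    ultimately show ?thesis by blast
  qed
qed

section \<open>The gradient relative to the affine hull\<close>

lemma has_derivative_within_convex_direction:
  fixes \<phi> :: "'b::real_normed_vector \<Rightarrow> real"
  assumes "(\<phi> has_derivative L) (at q within X)" "convex X" "q \<in> X" "x \<in> X"
  shows "((\<lambda>t. (\<phi> (q + t *\<^sub>R (x - q)) - \<phi> q) / t) \<longlongrightarrow> L (x - q)) (at 0 within {0..1})"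
proof -
  \<comment> \<open>Convexity keeps the segment from \<open>q\<close> to \<open>x\<close> inside
    \<open>X\<close>, so the derivative within \<open>X\<close> determines \<open>L (x - q)\<close>
    as a one-sided limit even if \<open>X\<close> has empty interior.\<close>
  have sub: "(\<lambda>t. q + t *\<^sub>R (x - q)) ` {0..1} \<subseteq> X"
  proof safe
    fix t :: real assume "t \<in> {0..1}"
    then have "(1 - t) *\<^sub>R q + t *\<^sub>R x \<in> X"
      using assms by (intro convexD) auto
    then show "q + t *\<^sub>R (x - q) \<in> X"
      by (simp add: algebra_simps)
  qed
  have "((\<lambda>t. q + t *\<^sub>R (x - q)) has_derivative (\<lambda>t. t *\<^sub>R (x - q))) (at 0 within {0..1})"
    by (auto intro!: derivative_eq_intros)
  moreover have "(\<phi> has_derivative L)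
      (at (q + 0 *\<^sub>R (x - q)) within (\<lambda>t. q + t *\<^sub>R (x - q)) ` {0..1})"
    using has_derivative_subset[OF assms(1) sub] by simp
  ultimately have "((\<lambda>t. \<phi> (q + t *\<^sub>R (x - q))) has_derivative (\<lambda>t. L (t *\<^sub>R (x - q))))
      (at 0 within {0..1})"
    by (rule has_derivative_in_compose)
  moreover have "L (t *\<^sub>R (x - q)) = L (x - q) * t" for t
    using assms(1) by (simp add: has_derivative_bounded_linear linear_simps(5))
  ultimately have "((\<lambda>t. \<phi> (q + t *\<^sub>R (x - q))) has_field_derivative L (x - q)) (at 0 within {0..1})"
    by (simp add: has_field_derivative_def)
  then show ?thesis
    by (simp add: has_field_derivative_iff)
qed

lemma at_within_01_nontriv: "at (0::real) within {0..1} \<noteq> bot"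
  by (simp add: trivial_limit_within islimpt_Icc)

text \<open>This makes the definite description in \<open>rel_grad\<close> meaningful. Differences
  of points of \<open>X\<close> span the directions on which the derivative is determined; the
  representing vector inside this span exists by Riesz and is unique by the one-sided
  limits.\<close>

lemma rel_grad_has_derivative:
  fixes X :: "('a \<Rightarrow>\<^sub>0 real) set"
  assumes "convex X" "q \<in> X" and Act: "finite Act" "X \<subseteq> {x. Poly_Mapping.keys x \<subseteq> Act}"
    and \<phi>: "\<phi> differentiable (at q within X)"
  shows "(\<phi> has_derivative pm_inner (rel_grad X \<phi> q)) (at q within X)"
proof -
  let ?V = "{x - y | x y. x \<in> X \<and> y \<in> X}"
  let ?E = "(\<lambda>a. Poly_Mapping.single a (1::real)) ` Act"
  have expand: "x = (\<Sum>a\<in>Act. Poly_Mapping.lookup x a *\<^sub>R Poly_Mapping.single a (1::real))"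
    if "x \<in> X" for x
  proof (rule poly_mapping_eqI)
    fix b
    have "Poly_Mapping.lookup x b = 0" if "b \<notin> Act"
      using that \<open>x \<in> X\<close> Act(2) in_keys_iff[of b x] by blast
    have "(\<Sum>a\<in>Act. Poly_Mapping.lookup x a * Poly_Mapping.lookup (Poly_Mapping.single a (1::real)) b)
        = (\<Sum>a\<in>Act. if a = b then Poly_Mapping.lookup x a else 0)"
      by (intro sum.cong) (auto simp: lookup_single)
    also have "\<dots> = Poly_Mapping.lookup x b"
      using Act \<open>b \<notin> Act \<Longrightarrow> Poly_Mapping.lookup x b = 0\<close> by (auto simp: sum.delta)
    finally show "Poly_Mapping.lookup x b =
        Poly_Mapping.lookup (\<Sum>a\<in>Act. Poly_Mapping.lookup x a *\<^sub>R Poly_Mapping.single a (1::real)) b"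
      by (simp add: lookup_sum)
  qed
  have XE: "x \<in> span ?E" if "x \<in> X" for x
    by (subst expand[OF that]) (intro span_sum span_scale span_base, auto)
  have "?V \<subseteq> span ?E"
    using XE by (auto intro: span_diff)
  \<comment> \<open>Vectors of \<open>X\<close> are supported in the finite set \<open>Act\<close>,
    so a basis of the direction space is finite and the Riesz induction applies.\<close>
  obtain B where B: "B \<subseteq> ?V" "independent B" "?V \<subseteq> span B"
    using maximal_independent_subset by blast
  have "finite B"
    using independent_span_bound[of ?E B] B \<open>?V \<subseteq> span ?E\<close> Act by auto
  have spanB: "span B = span ?V"
    using B by (meson span_eq span_base subset_trans subsetI)
  obtain L where L: "(\<phi> has_derivative L) (at q within X)"
    using \<phi> by (auto simp: differentiable_def)
  obtain g where g: "g \<in> span ?V" "\<forall>v\<in>span ?V. pm_inner g v = L v"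
    using linear_functional_span_eq_pm_inner[OF \<open>finite B\<close>
        has_derivative_linear[OF L]] spanB by auto
  \<comment> \<open>\<open>L\<close> and \<open>pm_inner g\<close> may differ off the direction
    space, but the limit within \<open>X\<close> evaluates them only at differences
    \<open>y - q\<close>.\<close>
  have dg: "(\<phi> has_derivative pm_inner g) (at q within X)"
  proof -
    have "((\<lambda>y. (1 / norm (y - q)) *\<^sub>R (\<phi> y - (\<phi> q + L (y - q)))) \<longlongrightarrow> 0) (at q within X)"
      using L by (simp add: has_derivative_within)
    moreover have "L (y - q) = pm_inner g (y - q)" if "y \<in> X" for y
    proof -
      have "y - q \<in> ?V"
        using that \<open>q \<in> X\<close> by blast
      then show ?thesis
        using g(2)[rule_format, OF span_base] by simp
    qed
    then have "\<forall>\<^sub>F y in at q within X. L (y - q) = pm_inner g (y - q)"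
      unfolding eventually_at_filter by (intro always_eventually) blast
    then have "\<forall>\<^sub>F y in at q within X. (1 / norm (y - q)) *\<^sub>R (\<phi> y - (\<phi> q + L (y - q))) =
        (1 / norm (y - q)) *\<^sub>R (\<phi> y - (\<phi> q + pm_inner g (y - q)))"
      by eventually_elim simp
    ultimately have "((\<lambda>y. (1 / norm (y - q)) *\<^sub>R (\<phi> y - (\<phi> q + pm_inner g (y - q)))) \<longlongrightarrow> 0) (at q within X)"
      by (rule Lim_transform_eventually)
    then show ?thesis
      by (simp add: has_derivative_within bounded_linear_pm_inner)
  qed
  have uniq: "g' = g" if g': "g' \<in> span ?V" "(\<phi> has_derivative pm_inner g') (at q within X)" for g'
  proof -
    have "pm_inner g' (x - q) = pm_inner g (x - q)" if "x \<in> X" for x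
      using has_derivative_within_convex_direction[OF g'(2) assms(1,2) that]
        has_derivative_within_convex_direction[OF dg assms(1,2) that]
      by (rule tendsto_unique[OF at_within_01_nontriv])
    then have "pm_inner (g' - g) (x - y) = 0" if "x \<in> X" "y \<in> X" for x y
      using that pm_inner_diff_right[of "g' - g" "x - q" "y - q"]
      by (simp add: pm_inner_diff_left)
    then have "?V \<subseteq> {v. pm_inner (g' - g) v = 0}"
      by auto
    moreover have "subspace {v. pm_inner (g' - g) v = 0}"
      by (auto intro!: subspaceI simp: pm_inner_add_right pm_inner_scaleR_right)
    ultimately have "span ?V \<subseteq> {v. pm_inner (g' - g) v = 0}"
      by (rule span_minimal)
    \<comment> \<open>A vector of the direction space that is orthogonal to the whole space is
      orthogonal to itself, hence 0.\<close>
    moreover have "g' - g \<in> span ?V"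
      using g' g by (intro span_diff)
    ultimately show ?thesis
      using pm_inner_self_eq_0[of "g' - g"] by auto
  qed
  have "rel_grad X \<phi> q \<in> span ?V \<and> (\<phi> has_derivative pm_inner (rel_grad X \<phi> q)) (at q within X)"
    unfolding rel_grad_def
  proof (rule theI)
    show "g \<in> span ?V \<and> (\<phi> has_derivative pm_inner g) (at q within X)"
      using g(1) dg ..
  qed (erule conjE, rule uniq)
  then show ?thesis by simp
qed

section \<open>Bregman divergences on vectors\<close>

definition bregman_vec ::
    "('a \<Rightarrow>\<^sub>0 real) set \<Rightarrow> (('a \<Rightarrow>\<^sub>0 real) \<Rightarrow> real) \<Rightarrow> ('a \<Rightarrow>\<^sub>0 real) \<Rightarrow> ('a \<Rightarrow>\<^sub>0 real) \<Rightarrow> real" where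
  "bregman_vec X \<phi> y q = \<phi> y - \<phi> q - pm_inner (rel_grad X \<phi> q) (y - q)"

text \<open>Midpoints, contracted points and limits are not given as distributions, so the
  divergence is studied on vectors and specialised through this identity.\<close>

lemma bregman_eq_vec: "bregman X \<phi> p q = bregman_vec X \<phi> (pmf_vec p) (pmf_vec q)"
  by (simp add: bregman_def bregman_vec_def)

lemma bregman_vec_self [simp]: "bregman_vec X \<phi> q q = 0"
  by (simp add: bregman_vec_def)

text \<open>The divergence is convex in its first argument and vanishes at \<open>q\<close>.\<close>

lemma bregman_vec_segment_le:
  assumes "convex_on X \<phi>" "q \<in> X" "y \<in> X" "0 \<le> t" "t \<le> 1"
  shows "bregman_vec X \<phi> (q + t *\<^sub>R (y - q)) q \<le> t * bregman_vec X \<phi> y q"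
proof -
  have "\<phi> (q + t *\<^sub>R (y - q)) = \<phi> ((1 - t) *\<^sub>R q + t *\<^sub>R y)"
    by (simp add: algebra_simps)
  also have "\<dots> \<le> (1 - t) * \<phi> q + t * \<phi> y"
    using assms by (intro convex_onD) auto
  finally show ?thesis
    unfolding bregman_vec_def add_diff_cancel_left' pm_inner_scaleR_right by (simp add: algebra_simps)
qed

text \<open>Convexity bounds the difference quotients from \<open>q\<close> towards \<open>y\<close>
  by \<open>\<phi> y - \<phi> q\<close>, hence also their limit, the derivative in that
  direction.\<close>

lemma bregman_vec_nonneg:
  assumes "finite Act" "X \<subseteq> {x. Poly_Mapping.keys x \<subseteq> Act}" "convex_on X \<phi>"
    and "\<phi> differentiable (at q within X)" "q \<in> X" "y \<in> X"
  shows "0 \<le> bregman_vec X \<phi> y q"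
proof -
  have conv: "convex X"
    using assms by (simp add: convex_on_imp_convex)
  have "((\<lambda>t. (\<phi> (q + t *\<^sub>R (y - q)) - \<phi> q) / t) \<longlongrightarrow> pm_inner (rel_grad X \<phi> q) (y - q))
      (at 0 within {0..1})"
    using rel_grad_has_derivative[OF conv assms(5,1,2,4)] conv assms(5,6)
    by (rule has_derivative_within_convex_direction)
  moreover have "\<forall>\<^sub>F t in at 0 within {0..1}. (\<phi> (q + t *\<^sub>R (y - q)) - \<phi> q) / t \<le> \<phi> y - \<phi> q"
    unfolding eventually_at_filter
  proof (intro always_eventually allI impI)
    fix t :: real assume t: "t \<noteq> 0" "t \<in> {0..1}"
    have "\<phi> (q + t *\<^sub>R (y - q)) = \<phi> ((1 - t) *\<^sub>R q + t *\<^sub>R y)"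
      by (simp add: algebra_simps)
    also have "\<dots> \<le> (1 - t) * \<phi> q + t * \<phi> y"
      using assms t by (intro convex_onD) auto
    finally show "(\<phi> (q + t *\<^sub>R (y - q)) - \<phi> q) / t \<le> \<phi> y - \<phi> q"
      using t by (simp add: field_simps)
  qed
  ultimately have "pm_inner (rel_grad X \<phi> q) (y - q) \<le> \<phi> y - \<phi> q"
    using at_within_01_nontriv by (rule tendsto_upperbound)
  then show ?thesis
    by (simp add: bregman_vec_def)
qed

lemma legendre_type_convex_on: "legendre_type X \<phi> \<Longrightarrow> convex_on X \<phi>"
  and legendre_type_differentiable:
    "legendre_type X \<phi> \<Longrightarrow> q \<in> rel_interior X \<Longrightarrow> \<phi> differentiable (at q within X)"
  and legendre_type_strict:
    "legendre_type X \<phi> \<Longrightarrow> x \<in> rel_interior X \<Longrightarrow> y \<in> rel_interior X \<Longrightarrow> x \<noteq> y \<Longrightarrow>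
      0 < u \<Longrightarrow> u < 1 \<Longrightarrow> \<phi> ((1 - u) *\<^sub>R x + u *\<^sub>R y) < (1 - u) * \<phi> x + u * \<phi> y"
  by (simp_all add: legendre_type_def)

lemma legendre_type_convex: "legendre_type X \<phi> \<Longrightarrow> convex X"
  by (rule convex_on_imp_convex[OF legendre_type_convex_on])

lemma rel_interior_subset_self: "x \<in> rel_interior X \<Longrightarrow> x \<in> X"
  unfolding rel_interior by simp

text \<open>By strict convexity the divergence of the midpoint is strictly below half that of
  \<open>x\<close>, and it is nonnegative.\<close>

lemma bregman_vec_pos_rel_interior:
  assumes "finite Act" "X \<subseteq> {x. Poly_Mapping.keys x \<subseteq> Act}" "legendre_type X \<phi>"
    and "q \<in> rel_interior X" "x \<in> rel_interior X" "x \<noteq> q"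
  shows "0 < bregman_vec X \<phi> x q"
proof -
  have X: "q \<in> X" "x \<in> X"
    using assms(4,5) by (auto dest: rel_interior_subset_self)
  note cvx = legendre_type_convex_on[OF assms(3)]
    and diff = legendre_type_differentiable[OF assms(3,4)]
  \<comment> \<open>The weight is left as \<open>1 - 1/2\<close> to match the shape of
    \<open>legendre_type_strict\<close> at \<open>u = 1/2\<close>.\<close>
  define m where "m = q + (1 - 1/2) *\<^sub>R (x - q)"
  have m: "m = (1 - 1/2) *\<^sub>R x + (1/2) *\<^sub>R q"
  proof -
    have "q + (1 - u) *\<^sub>R (x - q) = (1 - u) *\<^sub>R x + u *\<^sub>R q" for u
      by (simp add: algebra_simps)
    then show ?thesis unfolding m_def .
  qed
  have "m \<in> X"
    unfolding m using X legendre_type_convex[OF assms(3)] by (intro convexD) auto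
  have "0 \<le> bregman_vec X \<phi> m q"
    using assms(1,2) cvx diff X(1) \<open>m \<in> X\<close> by (rule bregman_vec_nonneg)
  also have "\<dots> < (1/2) * bregman_vec X \<phi> x q"
  proof -
    have "\<phi> m < (1 - 1/2) * \<phi> x + (1/2) * \<phi> q"
      unfolding m by (rule legendre_type_strict[OF assms(3,5,4,6)]) simp_all
    moreover have "m - q = (1 - 1/2) *\<^sub>R (x - q)"
      unfolding m_def by (rule add_diff_cancel_left')
    then have "pm_inner g (m - q) = (1 - 1/2) * pm_inner g (x - q)" for g
      by (simp only: pm_inner_scaleR_right)
    moreover have "a - c - (1 - 1/2) * p < (1/2) * (b - c - p)" if "a < (1 - 1/2) * b + (1/2) * c"
      for a b c p :: real
      using that by (simp add: field_simps)
    ultimately show ?thesis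
      unfolding bregman_vec_def by (simp only:)
  qed
  finally show ?thesis by simp
qed

lemma lookup_pmf_vec:
  assumes "finite (set_pmf p)"
  shows "Poly_Mapping.lookup (pmf_vec p) = pmf p"
proof -
  have "finite {a. pmf p a \<noteq> 0}"
    using assms by (simp add: set_pmf_eq)
  then show ?thesis
    by (simp add: pmf_vec_def)
qed

text \<open>Places the distributions in a compact set, from which the case of stepsize 0 extracts a
  limit point.\<close>

lemma pmf_vec_in_convex_hull:
  assumes "finite Act" "set_pmf p \<subseteq> Act"
  shows "pmf_vec p \<in> convex hull ((\<lambda>a. Poly_Mapping.single a 1) ` Act)"
proof -
  have fin: "finite (set_pmf p)"
    using assms finite_subset by blast
  have "pmf_vec p = (\<Sum>a\<in>Act. pmf p a *\<^sub>R Poly_Mapping.single a (1::real))"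
  proof (rule poly_mapping_eqI)
    fix b
    have "(\<Sum>a\<in>Act. pmf p a * Poly_Mapping.lookup (Poly_Mapping.single a (1::real)) b) =
        (\<Sum>a\<in>Act. if a = b then pmf p a else 0)"
      by (intro sum.cong) (auto simp: lookup_single)
    also have "\<dots> = pmf p b"
      using assms by (auto simp: sum.delta set_pmf_eq)
    finally show "Poly_Mapping.lookup (pmf_vec p) b =
        Poly_Mapping.lookup (\<Sum>a\<in>Act. pmf p a *\<^sub>R Poly_Mapping.single a (1::real)) b"
      by (simp add: lookup_sum lookup_pmf_vec fin)
  qed
  moreover have "(\<Sum>a\<in>Act. pmf p a *\<^sub>R Poly_Mapping.single a (1::real)) \<in>
      convex hull ((\<lambda>a. Poly_Mapping.single a 1) ` Act)"
    using assms by (intro convex_sum) (auto simp: sum_pmf_eq_1 hull_inc)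
  ultimately show ?thesis by simp
qed

lemma single_in_simplex_vecs:
  assumes "a \<in> Act"
  shows "Poly_Mapping.single a 1 \<in> simplex_vecs Act"
proof -
  have "pmf_vec (return_pmf a) = Poly_Mapping.single a 1"
    by (rule poly_mapping_eqI) (auto simp: lookup_pmf_vec lookup_single when_def indicator_def)
  then show ?thesis
    using assms unfolding simplex_vecs_def by (intro image_eqI[of _ _ "return_pmf a"]) auto
qed

text \<open>
  This settles the step with stepsize 0, which the stepsize condition permits.
  The mirror map need not be lower semicontinuous on the relative boundary of its domain, so the
  points are first contracted towards \<open>q\<close>, into the relative interior, where differentiability
  provides continuity.
\<close>

lemma bregman_vec_limit_0:
  fixes X :: "('a \<Rightarrow>\<^sub>0 real) set"
  assumes "finite Act" "X \<subseteq> {x. Poly_Mapping.keys x \<subseteq> Act}" "legendre_type X \<phi>"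
    and q: "q \<in> rel_interior X" and y: "\<And>n. y n \<in> X" "y \<longlonglongrightarrow> l" "l \<in> X"
    and lim: "(\<lambda>n. bregman_vec X \<phi> (y n) q) \<longlonglongrightarrow> 0"
  shows "l = q"
proof (rule ccontr)
  assume "l \<noteq> q"
  note cvx = legendre_type_convex_on[OF assms(3)] and conv = legendre_type_convex[OF assms(3)]
  obtain e where e: "e > 0" "ball q e \<inter> affine hull X \<subseteq> X" and qX: "q \<in> X"
    using q by (auto simp: mem_rel_interior_ball)
  \<comment> \<open>Small enough for \<open>q + t *\<^sub>R (l - q)\<close> to fall into the ball
    around \<open>q\<close>, and at most 1 so that the contraction maps \<open>X\<close> into
    itself.\<close>
  define t where "t = min 1 (e / (2 * norm (l - q)))"
  have t: "0 < t" "t \<le> 1"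
    using e \<open>l \<noteq> q\<close> by (auto simp: t_def)
  have "t * norm (l - q) \<le> e / (2 * norm (l - q)) * norm (l - q)"
    by (intro mult_right_mono) (auto simp: t_def)
  also have "\<dots> < e"
    using e \<open>l \<noteq> q\<close> by simp
  finally have tl: "t * norm (l - q) < e" .
  define x where "x = q + t *\<^sub>R (l - q)"
  define xs where "xs n = q + t *\<^sub>R (y n - q)" for n
  have inX: "q + t *\<^sub>R (z - q) \<in> X" if "z \<in> X" for z
  proof -
    have "(1 - t) *\<^sub>R q + t *\<^sub>R z \<in> X"
      using that qX t conv by (intro convexD) auto
    then show ?thesis by (simp add: algebra_simps)
  qed
  have "x \<in> rel_interior X"
    unfolding mem_rel_interior_ball
  proof (intro conjI exI)
    show "x \<in> X" unfolding x_def by (rule inX[OF y(3)])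
    have "dist q x < e"
      using tl t by (simp add: x_def dist_norm)
    then show "e - dist q x > 0" by simp
    have "ball x (e - dist q x) \<subseteq> ball q e"
    proof
      fix z assume "z \<in> ball x (e - dist q x)"
      then show "z \<in> ball q e"
        using dist_triangle[of q z x] by simp
    qed
    then show "ball x (e - dist q x) \<inter> affine hull X \<subseteq> X"
      using e by blast
  qed
  then have cont: "continuous (at x within X) \<phi>"
    by (intro differentiable_imp_continuous_within legendre_type_differentiable[OF assms(3)])
  have xs: "xs \<longlonglongrightarrow> x"
    unfolding xs_def x_def by (intro tendsto_intros y)
  have "xs n \<in> X" for n
    unfolding xs_def by (rule inX[OF y(1)])
  with xs have "(\<lambda>n. \<phi> (xs n)) \<longlonglongrightarrow> \<phi> x"
    using cont[unfolded continuous_within_sequentially, rule_format, of xs] by (simp add: o_def)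
  then have "(\<lambda>n. bregman_vec X \<phi> (xs n) q) \<longlonglongrightarrow> bregman_vec X \<phi> x q"
    unfolding bregman_vec_def by (intro tendsto_intros xs bounded_linear.tendsto[OF bounded_linear_pm_inner])
  moreover have "(\<lambda>n. t * bregman_vec X \<phi> (y n) q) \<longlonglongrightarrow> t * 0"
    by (intro tendsto_intros lim)
  moreover have "\<exists>N. \<forall>n\<ge>N. bregman_vec X \<phi> (xs n) q \<le> t * bregman_vec X \<phi> (y n) q"
    unfolding xs_def using t by (intro exI allI impI bregman_vec_segment_le cvx qX y) auto
  \<comment> \<open>The divergences of the contracted points are at most \<open>t\<close> times
    those of \<open>y n\<close>, which tend to 0; strict positivity at the interior point
    \<open>x\<close> contradicts this.\<close>
  ultimately have "bregman_vec X \<phi> x q \<le> t * 0"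
    by (rule LIMSEQ_le)
  moreover have "0 < bregman_vec X \<phi> x q"
    using bregman_vec_pos_rel_interior[OF assms(1,2,3) q \<open>x \<in> rel_interior X\<close>] \<open>l \<noteq> q\<close> t
    by (simp add: x_def)
  ultimately show False
    by simp
qed

section \<open>The greedy gap after one mirror step\<close>

lemma pmf_linear_eq_lookup:
  assumes "finite Act" "set_pmf p \<subseteq> Act"
  shows "(\<Sum>a\<in>Act. Q a * pmf p a) = (\<Sum>a\<in>Act. Q a * Poly_Mapping.lookup (pmf_vec p) a)"
  by (simp add: lookup_pmf_vec finite_subset[OF assms(2,1)])

text \<open>Optimality of \<open>p'\<close> against a maximiser \<open>p\<close> of the linear term,
  with the divergence of \<open>p'\<close> dropped as nonnegative, bounds \<open>\<eta>\<close>
  times the gap by the divergence of \<open>p\<close>. The infimum over \<open>p\<close> is at most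
  \<open>c * \<eta>\<close>, so division by a positive \<open>\<eta>\<close> finishes.\<close>

lemma mirror_step_gap:
  fixes Q :: "'a \<Rightarrow> real"
  assumes Act: "finite Act" and mm: "mirror_map Act X \<phi>"
    and q: "pmf_vec q \<in> rel_interior X" "set_pmf q \<subseteq> Act"
    and max: "is_arg_max (\<lambda>p. \<eta> * (\<Sum>a\<in>Act. Q a * pmf p a) - bregman X \<phi> p q)
        (\<lambda>p. set_pmf p \<subseteq> Act) p'"
    and G: "G \<noteq> {}" "\<And>p. p \<in> G \<Longrightarrow> set_pmf p \<subseteq> Act" "\<And>p. p \<in> G \<Longrightarrow> (\<Sum>a\<in>Act. Q a * pmf p a) = m"
    and \<eta>: "0 \<le> \<eta>" "(INF p\<in>G. bregman X \<phi> p q) \<le> c * \<eta>" and c: "0 \<le> c"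
  shows "m - c \<le> (\<Sum>a\<in>Act. Q a * pmf p' a)"
proof -
  have X: "X \<subseteq> {x. Poly_Mapping.keys x \<subseteq> Act}" "simplex_vecs Act \<subseteq> X" "legendre_type X \<phi>"
    using mm by (auto simp: mirror_map_def)
  note cvx = legendre_type_convex_on[OF X(3)]
    and diff = legendre_type_differentiable[OF X(3) q(1)]
    and qX = rel_interior_subset_self[OF q(1)]
  have inX: "pmf_vec p \<in> X" if "set_pmf p \<subseteq> Act" for p
    using that X by (auto simp: simplex_vecs_def)
  have nonneg: "0 \<le> bregman X \<phi> p q" if "set_pmf p \<subseteq> Act" for p
    unfolding bregman_eq_vec using Act X(1) cvx diff qX inX[OF that] by (rule bregman_vec_nonneg)
  have p': "set_pmf p' \<subseteq> Act"
    using max by (simp add: is_arg_max_def)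
  have opt: "\<eta> * (\<Sum>a\<in>Act. Q a * pmf p a) - bregman X \<phi> p q \<le>
      \<eta> * (\<Sum>a\<in>Act. Q a * pmf p' a) - bregman X \<phi> p' q" if "set_pmf p \<subseteq> Act" for p
    using max that by (auto simp: is_arg_max_def not_less)
  show ?thesis
  proof (cases "\<eta> = 0")
    case False
    then have "\<eta> > 0" using \<eta> by simp
    have "\<eta> * (m - (\<Sum>a\<in>Act. Q a * pmf p' a)) \<le> (INF p\<in>G. bregman X \<phi> p q)"
    proof (rule cINF_greatest[OF G(1)])
      fix p assume "p \<in> G"
      then show "\<eta> * (m - (\<Sum>a\<in>Act. Q a * pmf p' a)) \<le> bregman X \<phi> p q"
        using opt[of p] nonneg[OF p'] G by (simp add: algebra_simps)
    qed
    also have "\<dots> \<le> \<eta> * c" using \<eta> by (simp add: mult.commute)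
    finally show ?thesis
      using \<open>\<eta> > 0\<close> by simp
  next
    case True
    \<comment> \<open>At stepsize 0 the infimum is at most 0 but possibly unattained. A minimising
      sequence of greedy distributions has a limit point in the compact hull \<open>K\<close>, which
      must be \<open>q\<close>; by continuity of the linear term \<open>q\<close> attains
      \<open>m\<close>.\<close>
    define K where "K = convex hull ((\<lambda>a. Poly_Mapping.single a (1::real)) ` Act)"
    have "K \<subseteq> X"
      unfolding K_def using X(2) single_in_simplex_vecs[of _ Act] legendre_type_convex[OF X(3)]
      by (intro hull_minimal) auto
    have "\<exists>p\<in>G. bregman X \<phi> p q < inverse (real (Suc n))" for n
    proof -
      have "(INF p\<in>G. bregman X \<phi> p q) < inverse (real (Suc n))"
        using \<eta> True by (simp add: le_less_trans[of _ 0])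
      then show ?thesis
        using G nonneg by (subst (asm) cINF_less_iff) (auto intro!: bdd_belowI2[of _ 0])
    qed
    then obtain p where p: "\<And>n. p n \<in> G" "\<And>n. bregman X \<phi> (p n) q < inverse (real (Suc n))"
      by metis
    have "compact K"
      unfolding K_def using Act by (intro finite_imp_compact_convex_hull) auto
    moreover have "\<forall>n. pmf_vec (p n) \<in> K"
      unfolding K_def using p G Act by (auto intro!: pmf_vec_in_convex_hull)
    ultimately obtain l r where l: "l \<in> K" "strict_mono r" "((\<lambda>n. pmf_vec (p n)) \<circ> r) \<longlonglongrightarrow> l"
      unfolding compact_def by metis
    have "(\<lambda>n. bregman X \<phi> (p n) q) \<longlonglongrightarrow> 0"
    proof (rule tendsto_sandwich[OF _ _ tendsto_const LIMSEQ_inverse_real_of_nat])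
      show "\<forall>\<^sub>F n in sequentially. 0 \<le> bregman X \<phi> (p n) q"
        by (intro always_eventually allI nonneg G(2) p(1))
      show "\<forall>\<^sub>F n in sequentially. bregman X \<phi> (p n) q \<le> inverse (real (Suc n))"
        by (intro always_eventually allI less_imp_le p(2))
    qed
    then have lim: "(\<lambda>n. bregman_vec X \<phi> (pmf_vec (p (r n))) (pmf_vec q)) \<longlonglongrightarrow> 0"
      using LIMSEQ_subseq_LIMSEQ[OF _ l(2)] by (fastforce simp: o_def bregman_eq_vec)
    have pl: "(\<lambda>n. pmf_vec (p (r n))) \<longlonglongrightarrow> l"
      using l(3) by (simp add: o_def)
    have "l = pmf_vec q"
      using Act X(1,3) q(1) _ pl _ lim
    proof (rule bregman_vec_limit_0)
      show "l \<in> X"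
        using l(1) \<open>K \<subseteq> X\<close> by blast
      show "pmf_vec (p (r n)) \<in> X" for n
        by (intro inX G(2) p(1))
    qed
    have "(\<lambda>n. \<Sum>a\<in>Act. Q a * Poly_Mapping.lookup (pmf_vec (p (r n))) a) \<longlonglongrightarrow>
        (\<Sum>a\<in>Act. Q a * Poly_Mapping.lookup l a)"
      by (intro tendsto_intros bounded_linear.tendsto[OF bounded_linear_lookup] pl)
    moreover have "(\<Sum>a\<in>Act. Q a * Poly_Mapping.lookup (pmf_vec (p (r n))) a) = m" for n
      using pmf_linear_eq_lookup[OF Act G(2)[OF p(1)], of Q "r n"] G(3)[OF p(1), of "r n"] by simp
    ultimately have "(\<Sum>a\<in>Act. Q a * Poly_Mapping.lookup l a) = m"
      by (simp add: LIMSEQ_const_iff)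
    then have qm: "(\<Sum>a\<in>Act. Q a * pmf q a) = m"
      by (simp add: pmf_linear_eq_lookup[OF Act q(2)] \<open>l = pmf_vec q\<close>)
    \<comment> \<open>At stepsize 0 the update minimises the divergence, and \<open>q\<close> itself
      has divergence 0.\<close>
    have "bregman X \<phi> p' q = 0"
      using opt[OF q(2)] nonneg[OF p'] True by (simp add: bregman_eq_vec)
    then have "(\<lambda>n::nat. bregman_vec X \<phi> (pmf_vec p') (pmf_vec q)) \<longlonglongrightarrow> 0"
      by (simp add: bregman_eq_vec)
    \<comment> \<open>\<open>p'\<close> may lie on the relative boundary, where strict convexity is
      not assumed; hence the limit lemma with a constant sequence.\<close>
    then have "pmf_vec p' = pmf_vec q"
      using inX[OF p'] by (intro bregman_vec_limit_0[OF Act X(1,3) q(1)]) simp_all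
    then have "(\<Sum>a\<in>Act. Q a * pmf p' a) = m"
      using qm by (simp add: pmf_linear_eq_lookup[OF Act q(2)] pmf_linear_eq_lookup[OF Act p'])
    then show ?thesis using c by simp
  qed
qed

context fin_mdp
begin

text \<open>Greediness is a comparison with all policies. The deterministic policy that picks a
  maximiser in each state is among them and is greedy itself, so every greedy policy attains the
  maximal estimate in every state.\<close>

lemma greedy_policies_state:
  assumes s: "s \<in> states D"
  shows "(\<lambda>\<pi>'. \<pi>' s) ` greedy_policies D Q \<noteq> {}"
    and "p \<in> (\<lambda>\<pi>'. \<pi>' s) ` greedy_policies D Q \<Longrightarrow> set_pmf p \<subseteq> actions D"
    and "p \<in> (\<lambda>\<pi>'. \<pi>' s) ` greedy_policies D Q \<Longrightarrow>
      (\<Sum>a\<in>actions D. Q s a * pmf p a) = Max (Q s ` actions D)"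
proof -
  define f where "f s = (SOME a. a \<in> actions D \<and> Q s a = Max (Q s ` actions D))" for s
  have f: "f s \<in> actions D" "Q s (f s) = Max (Q s ` actions D)" for s
  proof -
    have "Max (Q s ` actions D) \<in> Q s ` actions D"
      by (intro Max_in) auto
    then obtain a where "a \<in> actions D" "Max (Q s ` actions D) = Q s a"
      by (rule imageE)
    then have "\<exists>a. a \<in> actions D \<and> Q s a = Max (Q s ` actions D)"
      by metis
    then have "f s \<in> actions D \<and> Q s (f s) = Max (Q s ` actions D)"
      unfolding f_def by (rule someI_ex)
    then show "f s \<in> actions D" "Q s (f s) = Max (Q s ` actions D)"
      by auto
  qed
  define \<pi>\<^sub>0 where "\<pi>\<^sub>0 = (\<lambda>s. return_pmf (f s))"
  have pol: "\<pi>\<^sub>0 \<in> policies D"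
    using f by (auto simp: \<pi>\<^sub>0_def policies_def)
  have avg: "policy_avg D Q \<pi>\<^sub>0 s = Max (Q s ` actions D)" for s
  proof -
    have "policy_avg D Q \<pi>\<^sub>0 s = (\<Sum>a\<in>actions D. if a = f s then Q s a else 0)"
      unfolding policy_avg_def \<pi>\<^sub>0_def by (intro sum.cong) auto
    then show ?thesis
      using f by simp
  qed
  have greedy: "\<pi>\<^sub>0 \<in> greedy_policies D Q"
    using pol policy_avg_le_Max by (auto simp: greedy_policies_def avg)
  then show "(\<lambda>\<pi>'. \<pi>' s) ` greedy_policies D Q \<noteq> {}"
    by blast
  assume "p \<in> (\<lambda>\<pi>'. \<pi>' s) ` greedy_policies D Q"
  then obtain \<pi> where \<pi>: "\<pi> \<in> greedy_policies D Q" "p = \<pi> s"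
    by auto
  then have \<pi>_pol: "\<pi> \<in> policies D"
    by (simp add: greedy_policies_def)
  then show "set_pmf p \<subseteq> actions D"
    using s \<pi>(2) by (auto simp: policies_def)
  have "policy_avg D Q \<pi>\<^sub>0 s \<le> policy_avg D Q \<pi> s"
    using \<pi>(1) pol s by (simp add: greedy_policies_def)
  then have "policy_avg D Q \<pi> s = Max (Q s ` actions D)"
    using policy_avg_le_Max[OF \<pi>_pol s, of Q] avg[of s] by linarith
  then show "(\<Sum>a\<in>actions D. Q s a * pmf p a) = Max (Q s ` actions D)"
    by (simp add: policy_avg_def \<pi>(2) mult.commute)
qed

lemma pmd_update_gap:
  assumes mm: "mirror_map (actions D) X \<phi>" and \<pi>: "\<pi> \<in> policies D" and c: "0 < c"
    and upd: "pmd_update D X \<phi> \<eta> Q \<pi> \<pi>'" and step: "stepsize_cond D X \<phi> c \<eta> Q \<pi>"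
  shows "\<pi>' \<in> policies D"
    and "s \<in> states D \<Longrightarrow> Max (Q s ` actions D) - c \<le> policy_avg D Q \<pi>' s"
proof -
  have arg_max: "is_arg_max (\<lambda>p. \<eta> * (\<Sum>a\<in>actions D. Q s a * pmf p a) - bregman X \<phi> p (\<pi> s))
      (\<lambda>p. set_pmf p \<subseteq> actions D) (\<pi>' s)"
    and ri: "pmf_vec (\<pi> s) \<in> rel_interior X" if "s \<in> states D" for s
    using upd that by (auto simp: pmd_update_def)
  show "\<pi>' \<in> policies D"
    using arg_max by (auto simp: policies_def is_arg_max_def)
  assume s: "s \<in> states D"
  define I where "I s = (INF \<pi>'\<in>greedy_policies D Q. bregman X \<phi> (\<pi>' s) (\<pi> s))" for s
  have "\<bar>I s\<bar> \<le> sup_norm D I"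
    using s by (rule abs_le_sup_norm)
  moreover have "sup_norm D I \<le> c * \<eta>"
    using step c by (simp add: stepsize_cond_def I_def[abs_def] field_simps)
  \<comment> \<open>The stepsize condition itself makes \<open>\<eta>\<close> nonnegative, its lower
    bound being a norm divided by \<open>c\<close>.\<close>
  ultimately have "0 \<le> c * \<eta>" "I s \<le> c * \<eta>"
    by linarith+
  then have "0 \<le> \<eta>" "I s \<le> c * \<eta>"
    using c by (auto simp: zero_le_mult_iff)
  then have "Max (Q s ` actions D) - c \<le> (\<Sum>a\<in>actions D. Q s a * pmf (\<pi>' s) a)"
    using \<pi> s c greedy_policies_state[OF s, where Q = Q]
    by (intro mirror_step_gap[OF finite_actions mm ri[OF s] _ arg_max[OF s],
          of "(\<lambda>\<pi>'. \<pi>' s) ` greedy_policies D Q"])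
      (auto simp: I_def image_image policies_def)
  then show "Max (Q s ` actions D) - c \<le> policy_avg D Q \<pi>' s"
    by (simp add: policy_avg_def mult.commute)
qed

end


section \<open>Accuracy of the Monte Carlo planning procedure\<close>

text \<open>Union bound for a two-stage experiment: either the first stage misses \<open>G\<close>,
  or the second fails given a good outcome. With \<open>c = 0\<close> it covers conclusions that
  follow from a good outcome with certainty.\<close>

lemma measure_bind_pmf_le:
  assumes "\<And>x. x \<in> set_pmf p \<Longrightarrow> G x \<Longrightarrow> measure_pmf.prob (f x) B \<le> c" "0 \<le> c"
  shows "measure_pmf.prob (bind_pmf p f) B \<le> measure_pmf.prob p {x. \<not> G x} + c"
proof -
  have "emeasure (bind_pmf p f) B = (\<integral>\<^sup>+x. emeasure (f x) B \<partial>p)"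
    by simp
  also have "\<dots> \<le> (\<integral>\<^sup>+x. indicator {x. \<not> G x} x + ennreal c \<partial>p)"
  proof (rule nn_integral_mono_AE, unfold AE_measure_pmf_iff, intro ballI)
    fix x assume x: "x \<in> set_pmf p"
    show "emeasure (f x) B \<le> indicator {x. \<not> G x} x + ennreal c"
    proof (cases "G x")
      case True
      then show ?thesis
        using assms(1)[OF x] by (simp add: measure_pmf.emeasure_eq_measure ennreal_leI)
    next
      case False
      have "emeasure (f x) B \<le> 1 + 0"
        by (simp add: measure_pmf.measure_le_1)
      also have "\<dots> \<le> 1 + ennreal c"
        by (intro add_left_mono) simp
      finally show ?thesis
        using False by simp
    qed
  qed
  also have "\<dots> = emeasure p {x. \<not> G x} + ennreal c"
    by (subst nn_integral_add) auto
  also have "\<dots> = ennreal (measure_pmf.prob p {x. \<not> G x} + c)"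
    using assms(2) by (simp add: measure_pmf.emeasure_eq_measure ennreal_plus)
  finally show ?thesis
    using assms(2) unfolding measure_pmf.emeasure_eq_measure by (subst (asm) ennreal_le_iff) auto
qed

lemma prob_Pi_pmf_component_le:
  assumes "finite A" "\<And>x. x \<in> A \<Longrightarrow> measure_pmf.prob (p x) {y. \<not> G x y} \<le> c"
  shows "measure_pmf.prob (Pi_pmf A d p) {f. \<not> (\<forall>x\<in>A. G x (f x))} \<le> real (card A) * c"
proof -
  have "measure_pmf.prob (Pi_pmf A d p) {f. \<not> (\<forall>x\<in>A. G x (f x))} =
      measure_pmf.prob (Pi_pmf A d p) (\<Union>x\<in>A. {f. \<not> G x (f x)})"
    by (rule arg_cong[where f = "measure_pmf.prob _"]) auto
  also have "\<dots> \<le> (\<Sum>x\<in>A. measure_pmf.prob (Pi_pmf A d p) {f. \<not> G x (f x)})"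
    using assms by (intro measure_pmf.finite_measure_subadditive_finite) auto
  also have "\<dots> \<le> (\<Sum>x\<in>A. c)"
  proof (rule sum_mono)
    fix x assume x: "x \<in> A"
    have "measure_pmf.prob (Pi_pmf A d p) {f. \<not> G x (f x)} =
        measure_pmf.prob (map_pmf (\<lambda>f. f x) (Pi_pmf A d p)) {y. \<not> G x y}"
      by (simp add: vimage_def)
    also have "\<dots> \<le> c"
      using assms x by (subst Pi_pmf_component) auto
    finally show "measure_pmf.prob (Pi_pmf A d p) {f. \<not> G x (f x)} \<le> c" .
  qed
  finally show ?thesis by simp
qed

text \<open>Exchanges a list of repeated draws for independent coordinates indexed by
  \<open>js\<close>, the setting of Hoeffding's inequality.\<close>

lemma replicate_pmf_eq_map_Pi_pmf:
  "distinct js \<Longrightarrow> replicate_pmf (length js) p = map_pmf (\<lambda>f. map f js) (Pi_pmf (set js) d (\<lambda>_. p))"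
proof (induction js)
  case (Cons j js)
  have "replicate_pmf (length (j # js)) p =
      do { y \<leftarrow> p; f \<leftarrow> Pi_pmf (set js) d (\<lambda>_. p); return_pmf (y # map f js) }"
    using Cons by (simp add: map_pmf_def bind_assoc_pmf bind_return_pmf)
  also have "\<dots> = do { y \<leftarrow> p; f \<leftarrow> Pi_pmf (set js) d (\<lambda>_. p); return_pmf (map (f(j := y)) (j # js)) }"
    using Cons by (intro bind_pmf_cong refl arg_cong[where f = return_pmf]) auto
  also have "\<dots> = map_pmf (\<lambda>f. map f (j # js)) (Pi_pmf (set (j # js)) d (\<lambda>_. p))"
    using Cons unfolding list.set
    by (subst Pi_pmf_insert') (auto simp: map_pmf_def bind_assoc_pmf bind_return_pmf)
  finally show ?case .
qed simp

lemma Hoeffding_replicate_pmf: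
  fixes f :: "'a \<Rightarrow> real"
  assumes m: "1 \<le> m" and B: "0 < B" "\<And>x. x \<in> set_pmf p \<Longrightarrow> 0 \<le> f x \<and> f x \<le> B" and "0 \<le> \<tau>"
  shows "measure_pmf.prob (replicate_pmf m p)
      {xs. \<not> \<bar>1 / real m * (\<Sum>x\<leftarrow>xs. f x) - measure_pmf.expectation p f\<bar> < \<tau>}
    \<le> 2 * exp (- 2 * real m * \<tau>\<^sup>2 / B\<^sup>2)"
proof -
  let ?P = "Pi_pmf {..<m} undefined (\<lambda>_. p)"
  have comp: "map_pmf (\<lambda>g. g i) ?P = p" if "i < m" for i
    using that by (simp add: Pi_pmf_component)
  have exp: "measure_pmf.expectation ?P (\<lambda>g. f (g i)) = measure_pmf.expectation p f" if "i < m" for i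
    using integral_map_pmf[of "\<lambda>g. g i" ?P f] comp[OF that] by simp
  interpret H: Hoeffding_ineq "measure_pmf ?P" "{..<m}" "\<lambda>i g. f (g i)" "\<lambda>_. 0" "\<lambda>_. B"
    "\<Sum>i<m. measure_pmf.expectation ?P (\<lambda>g. f (g i))"
  proof unfold_locales
    show "prob_space.indep_vars ?P (\<lambda>_. borel) (\<lambda>i g. f (g i)) {..<m}"
      by (rule prob_space.indep_vars_compose2[OF measure_pmf.prob_space_axioms indep_vars_Pi_pmf]) auto
    fix i assume "i \<in> {..<m}"
    then show "AE g in ?P. f (g i) \<in> {0..B}"
      using B(2) by (auto simp: AE_measure_pmf_iff set_Pi_pmf PiE_dflt_def)
  qed auto
  have "measure_pmf.prob (replicate_pmf m p)
      {xs. \<not> \<bar>1 / real m * (\<Sum>x\<leftarrow>xs. f x) - measure_pmf.expectation p f\<bar> < \<tau>} =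
    measure_pmf.prob ?P {g. \<not> \<bar>1 / real m * (\<Sum>i<m. f (g i)) - measure_pmf.expectation p f\<bar> < \<tau>}"
    using replicate_pmf_eq_map_Pi_pmf[of "[0..<m]" p undefined]
    by (simp add: vimage_def o_def lessThan_atLeast0 interv_sum_list_conv_sum_set_nat)
  also have "{g. \<not> \<bar>1 / real m * (\<Sum>i<m. f (g i)) - measure_pmf.expectation p f\<bar> < \<tau>} =
      {g \<in> space ?P. real m * \<tau> \<le> \<bar>(\<Sum>i<m. f (g i)) - (\<Sum>i<m. measure_pmf.expectation ?P (\<lambda>g. f (g i)))\<bar>}"
  proof -
    \<comment> \<open>Hoeffding's inequality concerns sums, so the deviation of the mean is scaled
      by \<open>m\<close>.\<close>
    have "\<bar>1 / real m * x - \<mu>\<bar> < \<tau> \<longleftrightarrow> \<bar>x - real m * \<mu>\<bar> < real m * \<tau>" for x \<mu> :: real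
    proof -
      have "\<bar>x - real m * \<mu>\<bar> = real m * \<bar>1 / real m * x - \<mu>\<bar>"
        using m by (simp add: abs_mult[symmetric, of "real m", simplified] right_diff_distrib)
      then show ?thesis using m by simp
    qed
    then show ?thesis
      using exp by (auto simp: not_less)
  qed
  also have "measure_pmf.prob ?P \<dots> \<le> 2 * exp (- 2 * (real m * \<tau>)\<^sup>2 / (\<Sum>i<m. (B - 0)\<^sup>2))"
    using assms by (intro H.Hoeffding_ineq_abs_ge) auto
  also have "- 2 * (real m * \<tau>)\<^sup>2 / (\<Sum>i<m. (B - 0)\<^sup>2) = - 2 * real m * \<tau>\<^sup>2 / B\<^sup>2"
    using m B by (simp add: power2_eq_square)
  finally show ?thesis .
qed

lemma abs_sum_list_diff_le:
  fixes f g :: "'a \<Rightarrow> real"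
  assumes "\<And>x. x \<in> set xs \<Longrightarrow> \<bar>f x - g x\<bar> \<le> e"
  shows "\<bar>(\<Sum>x\<leftarrow>xs. f x) - (\<Sum>x\<leftarrow>xs. g x)\<bar> \<le> real (length xs) * e"
  using assms
proof (induction xs)
  case (Cons x xs)
  then have "\<bar>f x - g x\<bar> \<le> e" "\<bar>(\<Sum>x\<leftarrow>xs. f x) - (\<Sum>x\<leftarrow>xs. g x)\<bar> \<le> real (length xs) * e"
    by auto
  then show ?case
    by (simp add: algebra_simps)
qed simp

lemma abs_Max_diff_le:
  fixes f g :: "'a \<Rightarrow> real"
  assumes "finite A" "A \<noteq> {}" "\<And>a. a \<in> A \<Longrightarrow> \<bar>f a - g a\<bar> \<le> e"
  shows "\<bar>Max (f ` A) - Max (g ` A)\<bar> \<le> e"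
proof -
  have le: "Max (f ` A) \<le> Max (g ` A) + e" if "\<And>a. a \<in> A \<Longrightarrow> f a \<le> g a + e" for f g :: "'a \<Rightarrow> real"
  proof (rule Max.boundedI)
    fix y assume "y \<in> f ` A"
    then obtain a where "a \<in> A" "y = f a" by auto
    moreover from this have "g a \<le> Max (g ` A)"
      using assms by (intro Max_ge) auto
    ultimately show "y \<le> Max (g ` A) + e"
      using that[of a] by simp
  qed (use assms in auto)
  have "f a \<le> g a + e" "g a \<le> f a + e" if "a \<in> A" for a
    using assms(3)[OF that] by auto
  then show ?thesis
    using le[of f g] le[of g f] by fastforce
qed

section \<open>One sampled backup: error and cost\<close>

context fin_mdp
begin

lemma mc_backup_sample_sets:
  assumes "T \<subseteq> states D"
    and X: "X \<in> set_pmf (Pi_pmf (T \<times> actions D) [] (\<lambda>(s, a). replicate_pmf m (transition D s a)))"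
  shows "T \<union> (\<Union>sa\<in>T \<times> actions D. set (X sa)) \<subseteq> states D"
    and "s \<in> T \<Longrightarrow> a \<in> actions D \<Longrightarrow> length (X (s, a)) = m"
proof -
  have "finite T"
    by (rule finite_subset[OF assms(1)]) simp
  then have *: "X (s, a) \<in> set_pmf (replicate_pmf m (transition D s a))" if "s \<in> T" "a \<in> actions D" for s a
    using X that by (auto simp: set_Pi_pmf PiE_dflt_def)
  then show "s \<in> T \<Longrightarrow> a \<in> actions D \<Longrightarrow> length (X (s, a)) = m"
    by (auto simp: set_replicate_pmf)
  have "set (X (s, a)) \<subseteq> states D" if "s \<in> T" "a \<in> actions D" for s a
    using *[OF that] set_transition[of s a] that assms(1) by (fastforce simp: set_replicate_pmf lists_eq_set)
  then show "T \<union> (\<Union>sa\<in>T \<times> actions D. set (X sa)) \<subseteq> states D"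
    using assms(1) by auto
qed

text \<open>The guarantee on \<open>est\<close> is demanded for every set of states because the set
  passed to it is random. That set contains all sampled states, so \<open>e\<close> enters each
  sample mean unamplified and the deviation of the mean adds \<open>\<tau>\<close>. One average per
  state-action pair has to be controlled, whence the product of the two cardinalities.\<close>

lemma mc_backup_error:
  assumes T: "T \<subseteq> states D" and m: "1 \<le> m" and "0 \<le> \<tau>" "0 \<le> P"
    and W: "\<And>s. s \<in> states D \<Longrightarrow> 0 \<le> W s \<and> W s \<le> 1 / (1 - \<gamma>)"
    and est: "\<And>T'. T' \<subseteq> states D \<Longrightarrow>
      measure_pmf.prob (est T') {(V, n). \<not> (\<forall>s\<in>T'. \<bar>V s - W s\<bar> \<le> e)} \<le> P"
  shows "measure_pmf.prob (mc_backup D m est T)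
      {(Q, n). \<not> (\<forall>s\<in>T. \<forall>a\<in>actions D. \<bar>Q s a - qval D W s a\<bar> \<le> \<gamma> * (e + \<tau>))}
    \<le> real (card (states D)) * real (card (actions D)) * (2 * exp (- 2 * real m * (\<tau> * (1 - \<gamma>))\<^sup>2)) + P"
proof -
  define p where "p = 2 * exp (- 2 * real m * (\<tau> * (1 - \<gamma>))\<^sup>2)"
  have finT: "finite T"
    by (rule finite_subset[OF T]) simp
  let ?Pi = "Pi_pmf (T \<times> actions D) [] (\<lambda>(s, a). replicate_pmf m (transition D s a))"
  define G where "G sa xs \<longleftrightarrow> \<bar>1 / real m * (\<Sum>s'\<leftarrow>xs. W s') -
      measure_pmf.expectation (transition D (fst sa) (snd sa)) W\<bar> < \<tau>" for sa and xs :: "'s list"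
  have "measure_pmf.prob (mc_backup D m est T)
      {(Q, n). \<not> (\<forall>s\<in>T. \<forall>a\<in>actions D. \<bar>Q s a - qval D W s a\<bar> \<le> \<gamma> * (e + \<tau>))}
    \<le> measure_pmf.prob ?Pi {X. \<not> (\<forall>sa\<in>T \<times> actions D. G sa (X sa))} + P"
    unfolding mc_backup_def
  proof (rule measure_bind_pmf_le)
    fix X assume X: "X \<in> set_pmf ?Pi" and G: "\<forall>sa\<in>T \<times> actions D. G sa (X sa)"
    define T' where "T' = T \<union> (\<Union>sa\<in>T \<times> actions D. set (X sa))"
    have T': "T' \<subseteq> states D"
      unfolding T'_def using T X by (rule mc_backup_sample_sets)
    have Q: "\<bar>reward D s a + \<gamma> / real m * (\<Sum>s'\<leftarrow>X (s, a). V s') - qval D W s a\<bar> \<le> \<gamma> * (e + \<tau>)"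
      if V: "\<forall>s\<in>T'. \<bar>V s - W s\<bar> \<le> e" and s: "s \<in> T" and a: "a \<in> actions D" for V s a
    proof -
      let ?\<mu> = "measure_pmf.expectation (transition D s a) W"
      have "length (X (s, a)) = m"
        using T X s a by (rule mc_backup_sample_sets)
      moreover have "\<bar>(\<Sum>s'\<leftarrow>X (s, a). V s') - (\<Sum>s'\<leftarrow>X (s, a). W s')\<bar> \<le> real (length (X (s, a))) * e"
        using V s a by (intro abs_sum_list_diff_le) (auto simp: T'_def)
      ultimately have "1 / real m * \<bar>(\<Sum>s'\<leftarrow>X (s, a). V s') - (\<Sum>s'\<leftarrow>X (s, a). W s')\<bar> \<le> e"
        using m by (simp add: field_simps)
      then have "\<bar>1 / real m * (\<Sum>s'\<leftarrow>X (s, a). V s') - 1 / real m * (\<Sum>s'\<leftarrow>X (s, a). W s')\<bar> \<le> e"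
        using m by (simp add: abs_mult flip: right_diff_distrib diff_divide_distrib)
      moreover have "\<bar>1 / real m * (\<Sum>s'\<leftarrow>X (s, a). W s') - ?\<mu>\<bar> < \<tau>"
        using G s a by (force simp: G_def)
      ultimately have "\<bar>1 / real m * (\<Sum>s'\<leftarrow>X (s, a). V s') - ?\<mu>\<bar> \<le> e + \<tau>"
        by linarith
      then have "\<gamma> * \<bar>1 / real m * (\<Sum>s'\<leftarrow>X (s, a). V s') - ?\<mu>\<bar> \<le> \<gamma> * (e + \<tau>)"
        using \<gamma> by (intro mult_left_mono) auto
      moreover have "reward D s a + \<gamma> / real m * (\<Sum>s'\<leftarrow>X (s, a). V s') - qval D W s a =
          \<gamma> * (1 / real m * (\<Sum>s'\<leftarrow>X (s, a). V s') - ?\<mu>)"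
        using T s a by (simp add: qval_def sum_transition_eq_expectation subset_iff right_diff_distrib)
      ultimately show ?thesis
        using \<gamma> by (simp add: abs_mult)
    qed
    have "measure_pmf.prob (est T' \<bind> (\<lambda>(V, n). return_pmf
          ((\<lambda>s a. reward D s a + \<gamma> / real m * (\<Sum>s'\<leftarrow>X (s, a). V s')), n + m * card T * card (actions D))))
        {(Q, n). \<not> (\<forall>s\<in>T. \<forall>a\<in>actions D. \<bar>Q s a - qval D W s a\<bar> \<le> \<gamma> * (e + \<tau>))}
      \<le> measure_pmf.prob (est T') {x. \<not> (case x of (V, n) \<Rightarrow> \<forall>s\<in>T'. \<bar>V s - W s\<bar> \<le> e)} + 0"
      using Q by (intro measure_bind_pmf_le) (auto split: prod.splits)
    also have "\<dots> \<le> P"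
      using est[OF T'] by (simp add: case_prod_unfold)
    finally show "measure_pmf.prob (est (T \<union> (\<Union>sa\<in>T \<times> actions D. set (X sa))) \<bind> (\<lambda>(V, n). return_pmf
          ((\<lambda>s a. reward D s a + \<gamma> / real m * (\<Sum>s'\<leftarrow>X (s, a). V s')), n + m * card T * card (actions D))))
        {(Q, n). \<not> (\<forall>s\<in>T. \<forall>a\<in>actions D. \<bar>Q s a - qval D W s a\<bar> \<le> \<gamma> * (e + \<tau>))} \<le> P"
      by (simp add: T'_def)
  qed fact
  also have "measure_pmf.prob ?Pi {X. \<not> (\<forall>sa\<in>T \<times> actions D. G sa (X sa))} \<le>
      real (card (T \<times> actions D)) * p"
  proof (rule prob_Pi_pmf_component_le)
    fix sa assume sa: "sa \<in> T \<times> actions D"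
    then obtain s a where [simp]: "sa = (s, a)" and s: "s \<in> states D" "a \<in> actions D"
      using T by auto
    have "measure_pmf.prob (replicate_pmf m (transition D s a))
        {xs. \<not> \<bar>1 / real m * (\<Sum>x\<leftarrow>xs. W x) - measure_pmf.expectation (transition D s a) W\<bar> < \<tau>}
      \<le> 2 * exp (- 2 * real m * \<tau>\<^sup>2 / (1 / (1 - \<gamma>))\<^sup>2)"
      using set_transition[OF s] W \<gamma> m \<open>0 \<le> \<tau>\<close> by (intro Hoeffding_replicate_pmf) auto
    also have "\<dots> = p"
      by (simp add: p_def power_mult_distrib power_divide)
    finally show "measure_pmf.prob (case sa of (s, a) \<Rightarrow> replicate_pmf m (transition D s a)) {y. \<not> G sa y} \<le> p"
      by (simp add: G_def)
  qed (use finT in auto)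
  \<comment> \<open>Passing from \<open>T\<close> to all states makes the bound independent of the
    random set reached at this level.\<close>
  also have "real (card (T \<times> actions D)) * p \<le> real (card (states D)) * real (card (actions D)) * p"
    using T by (intro mult_right_mono) (auto simp: p_def card_cartesian_product card_mono intro!: mult_right_mono)
  finally show ?thesis
    by (simp add: p_def)
qed

lemma mc_backup_count:
  assumes T: "T \<subseteq> states D" and est: "\<And>T' V n. T' \<subseteq> states D \<Longrightarrow> (V, n) \<in> set_pmf (est T') \<Longrightarrow> n \<le> N"
    and Q: "(Q, n) \<in> set_pmf (mc_backup D m est T)"
  shows "n \<le> N + m * card (states D) * card (actions D)"
proof -
  obtain X V n' where X: "X \<in> set_pmf (Pi_pmf (T \<times> actions D) [] (\<lambda>(s, a). replicate_pmf m (transition D s a)))"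
    "(V, n') \<in> set_pmf (est (T \<union> (\<Union>sa\<in>T \<times> actions D. set (X sa))))"
    "n = n' + m * card T * card (actions D)"
    using Q unfolding mc_backup_def set_bind_pmf by (auto simp del: set_Pi_pmf)
  have "n' \<le> N"
    using mc_backup_sample_sets(1)[OF T X(1)] X(2) by (rule est)
  moreover have "m * card T * card (actions D) \<le> m * card (states D) * card (actions D)"
    using T by (intro mult_le_mono card_mono) auto
  ultimately show ?thesis
    unfolding X(3) by (rule add_mono)
qed

end

section \<open>Error and cost through all planning levels\<close>

context mdp_policy
begin

primrec mc_error :: "nat \<Rightarrow> real \<Rightarrow> real \<Rightarrow> nat \<Rightarrow> real" where
  "mc_error H \<tau>0 \<tau> 0 = \<tau>0 + \<gamma> ^ H / (1 - \<gamma>)"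
| "mc_error H \<tau>0 \<tau> (Suc k) = \<gamma> * (mc_error H \<tau>0 \<tau> k + \<tau>)"

lemma mc_error_eq: "mc_error H \<tau>0 \<tau> k = \<gamma> ^ k * (\<tau>0 + \<gamma> ^ H / (1 - \<gamma>)) + \<gamma> * \<tau> * (1 - \<gamma> ^ k) / (1 - \<gamma>)"
proof (induction k)
  case (Suc k)
  have "\<gamma> * (\<gamma> * \<tau> * (1 - \<gamma> ^ k) / (1 - \<gamma>) + \<tau>) = \<gamma> * \<tau> * (1 - \<gamma> ^ Suc k) / (1 - \<gamma>)"
    using \<gamma> by (simp add: field_simps)
  then show ?case
    by (simp add: Suc algebra_simps)
qed simp

text \<open>\<open>T\<close> is arbitrary in the induction because each level is run on a random
  set. Every level above the rollouts adds one sampled backup to the failure probability; the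
  maximum over actions does not enlarge the error.\<close>

lemma mc_V_error:
  assumes M: "1 \<le> M 0" "\<And>j. 1 \<le> j \<Longrightarrow> M j = m" "1 \<le> m" and \<tau>: "0 \<le> \<tau>0" "0 \<le> \<tau>"
  shows "T \<subseteq> states D \<Longrightarrow> measure_pmf.prob (mc_V D \<pi> M H k T)
      {(V, n). \<not> (\<forall>s\<in>T. \<bar>V s - (opt_backup D ^^ k) (value_fun D \<pi>) s\<bar> \<le> mc_error H \<tau>0 \<tau> k)}
    \<le> real (card (states D)) * (2 * exp (- 2 * real (M 0) * (\<tau>0 * (1 - \<gamma>))\<^sup>2)) +
      real k * (real (card (states D)) * real (card (actions D)) * (2 * exp (- 2 * real m * (\<tau> * (1 - \<gamma>))\<^sup>2)))"
proof (induction k arbitrary: T)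
  case 0
  define p where "p = 2 * exp (- 2 * real (M 0) * (\<tau>0 * (1 - \<gamma>))\<^sup>2)"
  have finT: "finite T"
    by (rule finite_subset[OF 0]) simp
  define G where "G s xs \<longleftrightarrow> \<bar>1 / real (M 0) * (\<Sum>x\<leftarrow>xs. disc_return D x) - rollout H s\<bar> < \<tau>0" for s xs
  have "measure_pmf.prob (mc_V D \<pi> M H 0 T)
      {(V, n). \<not> (\<forall>s\<in>T. \<bar>V s - (opt_backup D ^^ 0) (value_fun D \<pi>) s\<bar> \<le> mc_error H \<tau>0 \<tau> 0)}
    \<le> measure_pmf.prob (Pi_pmf T [] (\<lambda>s. replicate_pmf (M 0) (traj D \<pi> H s))) {W. \<not> (\<forall>s\<in>T. G s (W s))} + 0"
    unfolding mc_V.simps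
  proof (rule measure_bind_pmf_le)
    fix W assume G: "\<forall>s\<in>T. G s (W s)"
    have "\<bar>1 / real (M 0) * (\<Sum>x\<leftarrow>W s. disc_return D x) - value_fun D \<pi> s\<bar> \<le> \<tau>0 + \<gamma> ^ H / (1 - \<gamma>)"
      if "s \<in> T" for s
    proof -
      have "\<bar>rollout H s - value_fun D \<pi> s\<bar> \<le> \<gamma> ^ H / (1 - \<gamma>)"
        using that 0 by (intro abs_rollout_minus_value_fun_le) auto
      moreover have "\<bar>1 / real (M 0) * (\<Sum>x\<leftarrow>W s. disc_return D x) - rollout H s\<bar> < \<tau>0"
        using G that by (simp add: G_def)
      ultimately show ?thesis by linarith
    qed
    then show "measure_pmf.prob (return_pmf (\<lambda>s. 1 / real (M 0) * (\<Sum>xs\<leftarrow>W s. disc_return D xs), M 0 * H * card T))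
        {(V, n). \<not> (\<forall>s\<in>T. \<bar>V s - (opt_backup D ^^ 0) (value_fun D \<pi>) s\<bar> \<le> mc_error H \<tau>0 \<tau> 0)} \<le> 0"
      by (auto simp: indicator_def)
  qed simp
  also have "\<dots> \<le> real (card T) * p"
    unfolding add_0_right
  proof (rule prob_Pi_pmf_component_le[OF finT])
    fix s assume s: "s \<in> T"
    have "measure_pmf.prob (replicate_pmf (M 0) (traj D \<pi> H s)) {y. \<not> G s y}
      \<le> 2 * exp (- 2 * real (M 0) * \<tau>0\<^sup>2 / (1 / (1 - \<gamma>))\<^sup>2)"
      unfolding G_def rollout_def using s 0 \<gamma> M \<tau> disc_return_bounds
      by (intro Hoeffding_replicate_pmf) auto
    also have "\<dots> = p"
      by (simp add: p_def power_mult_distrib power_divide)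
    finally show "measure_pmf.prob (replicate_pmf (M 0) (traj D \<pi> H s)) {y. \<not> G s y} \<le> p" .
  qed
  also have "\<dots> \<le> real (card (states D)) * p"
    using 0 by (intro mult_right_mono) (auto simp: p_def card_mono)
  finally show ?case
    by (simp add: p_def)
next
  case (Suc k)
  let ?W = "(opt_backup D ^^ k) (value_fun D \<pi>)"
  let ?P = "real (card (states D)) * (2 * exp (- 2 * real (M 0) * (\<tau>0 * (1 - \<gamma>))\<^sup>2)) +
      real k * (real (card (states D)) * real (card (actions D)) * (2 * exp (- 2 * real m * (\<tau> * (1 - \<gamma>))\<^sup>2)))"
  have "measure_pmf.prob (mc_V D \<pi> M H (Suc k) T)
      {(V, n). \<not> (\<forall>s\<in>T. \<bar>V s - (opt_backup D ^^ Suc k) (value_fun D \<pi>) s\<bar> \<le> mc_error H \<tau>0 \<tau> (Suc k))}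
    \<le> measure_pmf.prob (mc_backup D (M (Suc k)) (mc_V D \<pi> M H k) T)
      {x. \<not> (case x of (Q, n) \<Rightarrow> \<forall>s\<in>T. \<forall>a\<in>actions D. \<bar>Q s a - qval D ?W s a\<bar> \<le> \<gamma> * (mc_error H \<tau>0 \<tau> k + \<tau>))} + 0"
    unfolding mc_V.simps
  proof (rule measure_bind_pmf_le)
    fix x :: "('s \<Rightarrow> 'a \<Rightarrow> real) \<times> nat"
    obtain Q n where x: "x = (Q, n)" by (cases x)
    assume "case x of (Q, n) \<Rightarrow> \<forall>s\<in>T. \<forall>a\<in>actions D. \<bar>Q s a - qval D ?W s a\<bar> \<le> \<gamma> * (mc_error H \<tau>0 \<tau> k + \<tau>)"
    then have Q: "\<bar>Q s a - qval D ?W s a\<bar> \<le> \<gamma> * (mc_error H \<tau>0 \<tau> k + \<tau>)" if "s \<in> T" "a \<in> actions D" for s a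
      using that x by auto
    have "\<bar>Max (Q s ` actions D) - opt_backup D ?W s\<bar> \<le> \<gamma> * (mc_error H \<tau>0 \<tau> k + \<tau>)" if "s \<in> T" for s
      unfolding opt_backup_def[of D ?W s] using Q[OF that] by (intro abs_Max_diff_le) auto
    then show "measure_pmf.prob (case x of (Q, n) \<Rightarrow> return_pmf (\<lambda>s. Max (Q s ` actions D), n))
        {(V, n). \<not> (\<forall>s\<in>T. \<bar>V s - (opt_backup D ^^ Suc k) (value_fun D \<pi>) s\<bar> \<le> mc_error H \<tau>0 \<tau> (Suc k))} \<le> 0"
      by (auto simp: x indicator_def)
  qed simp
  also have "\<dots> = measure_pmf.prob (mc_backup D m (mc_V D \<pi> M H k) T)
      {(Q, n). \<not> (\<forall>s\<in>T. \<forall>a\<in>actions D. \<bar>Q s a - qval D ?W s a\<bar> \<le> \<gamma> * (mc_error H \<tau>0 \<tau> k + \<tau>))}"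
    using M(2)[of "Suc k"] by (simp add: case_prod_unfold)
  also have "\<dots> \<le> real (card (states D)) * real (card (actions D)) * (2 * exp (- 2 * real m * (\<tau> * (1 - \<gamma>))\<^sup>2)) + ?P"
    using Suc M \<tau> value_fun_bounds
    by (intro mc_backup_error opt_backup_funpow_bounds Suc.IH add_nonneg_nonneg mult_nonneg_nonneg) auto
  finally show ?case
    by (simp add: algebra_simps)
qed

text \<open>The top backup is returned without the maximum over actions; counting it,
  \<open>h\<close> levels of sampled next states lie above the rollouts.\<close>

lemma mc_Q_error:
  assumes h: "1 \<le> h" and M: "1 \<le> M 0" "\<And>j. 1 \<le> j \<Longrightarrow> M j = m" "1 \<le> m" and \<tau>: "0 \<le> \<tau>0" "0 \<le> \<tau>"
  shows "measure_pmf.prob (mc_Q D \<pi> M H h (states D))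
      {(Q, n). \<not> (\<forall>s\<in>states D. \<forall>a\<in>actions D.
         \<bar>Q s a - qval D ((opt_backup D ^^ (h - 1)) (value_fun D \<pi>)) s a\<bar> \<le> mc_error H \<tau>0 \<tau> h)}
    \<le> real (card (states D)) * (2 * exp (- 2 * real (M 0) * (\<tau>0 * (1 - \<gamma>))\<^sup>2)) +
      real h * (real (card (states D)) * real (card (actions D)) * (2 * exp (- 2 * real m * (\<tau> * (1 - \<gamma>))\<^sup>2)))"
proof -
  obtain k where k: "h = Suc k"
    using h by (cases h) auto
  let ?W = "(opt_backup D ^^ k) (value_fun D \<pi>)"
  let ?P = "real (card (states D)) * (2 * exp (- 2 * real (M 0) * (\<tau>0 * (1 - \<gamma>))\<^sup>2)) +
      real k * (real (card (states D)) * real (card (actions D)) * (2 * exp (- 2 * real m * (\<tau> * (1 - \<gamma>))\<^sup>2)))"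
  have "measure_pmf.prob (mc_backup D m (mc_V D \<pi> M H k) (states D))
      {(Q, n). \<not> (\<forall>s\<in>states D. \<forall>a\<in>actions D. \<bar>Q s a - qval D ?W s a\<bar> \<le> \<gamma> * (mc_error H \<tau>0 \<tau> k + \<tau>))}
    \<le> real (card (states D)) * real (card (actions D)) * (2 * exp (- 2 * real m * (\<tau> * (1 - \<gamma>))\<^sup>2)) + ?P"
    using M \<tau> value_fun_bounds
    by (intro mc_backup_error opt_backup_funpow_bounds mc_V_error add_nonneg_nonneg mult_nonneg_nonneg) auto
  then show ?thesis
    using M(2)[of h] h by (simp add: mc_Q_def k algebra_simps)
qed

lemma mc_V_count:
  assumes M: "\<And>j. 1 \<le> j \<Longrightarrow> M j = m"
  shows "T \<subseteq> states D \<Longrightarrow> (V, n) \<in> set_pmf (mc_V D \<pi> M H k T) \<Longrightarrow>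
    n \<le> M 0 * H * card (states D) + k * (m * card (states D) * card (actions D))"
proof (induction k arbitrary: T V n)
  case 0
  then have "n = M 0 * H * card T"
    by auto
  then show ?case
    using 0 by (auto intro!: card_mono)
next
  case (Suc k)
  obtain Q where "(Q, n) \<in> set_pmf (mc_backup D m (mc_V D \<pi> M H k) T)"
    using Suc.prems M[of "Suc k"] by auto
  with Suc.prems(1) have "n \<le> (M 0 * H * card (states D) + k * (m * card (states D) * card (actions D))) +
      m * card (states D) * card (actions D)"
    by (intro mc_backup_count[of T "mc_V D \<pi> M H k"] Suc.IH)
  then show ?case
    by simp
qed

lemma mc_Q_count:
  assumes h: "1 \<le> h" and M: "\<And>j. 1 \<le> j \<Longrightarrow> M j = m"
    and "(Q, n) \<in> set_pmf (mc_Q D \<pi> M H h (states D))"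
  shows "n \<le> M 0 * H * card (states D) + h * (m * card (states D) * card (actions D))"
proof -
  obtain k where k: "h = Suc k"
    using h by (cases h) auto
  have "(Q, n) \<in> set_pmf (mc_backup D m (mc_V D \<pi> M H k) (states D))"
    using assms M[of h] by (simp add: mc_Q_def k)
  then have "n \<le> (M 0 * H * card (states D) + k * (m * card (states D) * card (actions D))) +
      m * card (states D) * card (actions D)"
    using mc_V_count[of M m] M by (intro mc_backup_count[of "states D" "mc_V D \<pi> M H k"]) blast+
  then show ?thesis
    by (simp add: k)
qed

end


section \<open>Runs of inexact policy mirror descent\<close>

text \<open>Recovers the history at each iteration from a complete run, so that the update rule,
  assumed on the supports of partial runs, applies to the prefixes \<open>take i qs\<close>.\<close>

lemma set_hpmd_run:
  assumes "(qs, n) \<in> set_pmf (hpmd_run D M H h pol k)"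
  shows "length qs = k" and "i < k \<Longrightarrow> \<exists>n'. (take i qs, n') \<in> set_pmf (hpmd_run D M H h pol i)"
    and "i < k \<Longrightarrow> \<exists>c. (qs ! i, c) \<in> set_pmf (mc_Q D (pol (take i qs)) M H h (states D))"
proof -
  have "length qs = k \<and> (\<forall>i<k. (\<exists>n'. (take i qs, n') \<in> set_pmf (hpmd_run D M H h pol i)) \<and>
      (\<exists>c. (qs ! i, c) \<in> set_pmf (mc_Q D (pol (take i qs)) M H h (states D))))"
    using assms
  proof (induction k arbitrary: qs n)
    case (Suc k)
    then obtain ps n' q c where 1: "(ps, n') \<in> set_pmf (hpmd_run D M H h pol k)"
      and 2: "(q, c) \<in> set_pmf (mc_Q D (pol ps) M H h (states D))" and qs: "qs = ps @ [q]"
      by auto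
    have IH: "length ps = k" "\<And>i. i < k \<Longrightarrow> (\<exists>n'. (take i ps, n') \<in> set_pmf (hpmd_run D M H h pol i)) \<and>
      (\<exists>c. (ps ! i, c) \<in> set_pmf (mc_Q D (pol (take i ps)) M H h (states D)))"
      using Suc.IH[OF 1] by auto
    show ?case
    proof (intro conjI allI impI)
      show "length qs = Suc k"
        using IH by (simp add: qs)
      fix i assume "i < Suc k"
      then consider "i < k" | "i = k" by linarith
      then have "(\<exists>n'. (take i qs, n') \<in> set_pmf (hpmd_run D M H h pol i)) \<and>
          (\<exists>c. (qs ! i, c) \<in> set_pmf (mc_Q D (pol (take i qs)) M H h (states D)))"
      proof cases
        case 1
        then show ?thesis
          using IH by (simp add: qs nth_append)
      next
        case 2
        then show ?thesis
          using IH(1) \<open>(ps, n') \<in> _\<close> \<open>(q, c) \<in> _\<close> by (auto simp: qs)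
      qed
      then show "\<exists>n'. (take i qs, n') \<in> set_pmf (hpmd_run D M H h pol i)"
        "\<exists>c. (qs ! i, c) \<in> set_pmf (mc_Q D (pol (take i qs)) M H h (states D))"
        by auto
    qed
  qed simp
  then show "length qs = k" and "i < k \<Longrightarrow> \<exists>n'. (take i qs, n') \<in> set_pmf (hpmd_run D M H h pol i)"
    and "i < k \<Longrightarrow> \<exists>c. (qs ! i, c) \<in> set_pmf (mc_Q D (pol (take i qs)) M H h (states D))"
    by blast+
qed

lemma hpmd_run_count:
  assumes "\<And>k qs n q c. k < K \<Longrightarrow> (qs, n) \<in> set_pmf (hpmd_run D M H h pol k) \<Longrightarrow>
      (q, c) \<in> set_pmf (mc_Q D (pol qs) M H h (states D)) \<Longrightarrow> c \<le> N"
  shows "k \<le> K \<Longrightarrow> (qs, n) \<in> set_pmf (hpmd_run D M H h pol k) \<Longrightarrow> n \<le> k * N"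
proof (induction k arbitrary: qs n)
  case (Suc k)
  then obtain ps n' q c where 1: "(ps, n') \<in> set_pmf (hpmd_run D M H h pol k)"
    and 2: "(q, c) \<in> set_pmf (mc_Q D (pol ps) M H h (states D))" and n: "n = n' + c"
    by auto
  have "n' \<le> k * N"
    using Suc.IH[OF _ 1] Suc.prems by simp
  moreover have "c \<le> N"
    using assms[OF _ 1 2] Suc.prems by simp
  ultimately show ?case
    by (simp add: n)
qed simp

text \<open>Union bound over iterations. The policy is a function of the estimates so far, so
  \<open>good\<close> takes this history as a parameter and the bound for one iteration is used
  conditionally on it.\<close>

lemma hpmd_run_failure:
  assumes mc: "\<And>k qs n. k < K \<Longrightarrow> (qs, n) \<in> set_pmf (hpmd_run D M H h pol k) \<Longrightarrow>
      measure_pmf.prob (mc_Q D (pol qs) M H h (states D)) {(q, c). \<not> good q qs} \<le> p"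
    and p: "0 \<le> p"
  shows "k \<le> K \<Longrightarrow> measure_pmf.prob (hpmd_run D M H h pol k)
    {(qs, n). \<not> (\<forall>i<k. good (qs ! i) (take i qs))} \<le> real k * p"
proof (induction k)
  case (Suc k)
  have "measure_pmf.prob (hpmd_run D M H h pol (Suc k)) {(qs, n). \<not> (\<forall>i<Suc k. good (qs ! i) (take i qs))}
    \<le> measure_pmf.prob (hpmd_run D M H h pol k)
        {x. \<not> (case x of (qs, n) \<Rightarrow> \<forall>i<k. good (qs ! i) (take i qs))} + p"
    unfolding hpmd_run.simps
  proof (rule measure_bind_pmf_le[OF _ p])
    fix x assume x: "x \<in> set_pmf (hpmd_run D M H h pol k)"
      and g: "case x of (qs, n) \<Rightarrow> \<forall>i<k. good (qs ! i) (take i qs)"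
    obtain qs n where [simp]: "x = (qs, n)" by (cases x)
    have len: "length qs = k"
      using x set_hpmd_run(1) by auto
    have "measure_pmf.prob (mc_Q D (pol qs) M H h (states D) \<bind> (\<lambda>(q, c). return_pmf (qs @ [q], n + c)))
        {(qs, n). \<not> (\<forall>i<Suc k. good (qs ! i) (take i qs))}
      \<le> measure_pmf.prob (mc_Q D (pol qs) M H h (states D)) {y. \<not> (case y of (q, c) \<Rightarrow> good q qs)} + 0"
    proof (rule measure_bind_pmf_le)
      fix y :: "('a \<Rightarrow> 'b \<Rightarrow> real) \<times> nat" assume "case y of (q, c) \<Rightarrow> good q qs"
      moreover obtain q c where [simp]: "y = (q, c)" by (cases y)
      ultimately have "\<forall>i<Suc k. good ((qs @ [q]) ! i) (take i (qs @ [q]))"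
        using g len by (auto simp: less_Suc_eq nth_append)
      then show "measure_pmf.prob (case y of (q, c) \<Rightarrow> return_pmf (qs @ [q], n + c))
          {(qs, n). \<not> (\<forall>i<Suc k. good (qs ! i) (take i qs))} \<le> 0"
        by (simp add: indicator_def)
    qed simp
    also have "\<dots> \<le> p"
      using mc[of k qs n] x Suc.prems by (simp add: case_prod_unfold)
    finally show "measure_pmf.prob (case x of (qs, n) \<Rightarrow> mc_Q D (pol qs) M H h (states D) \<bind>
          (\<lambda>(q, c). return_pmf (qs @ [q], n + c)))
        {(qs, n). \<not> (\<forall>i<Suc k. good (qs ! i) (take i qs))} \<le> p"
      by simp
  qed
  also have "\<dots> \<le> real k * p + p"
    using Suc by (simp add: case_prod_unfold)
  finally show ?case
    by (simp add: algebra_simps)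
qed simp

text \<open>Unrolling sums \<open>g ^ (k - 1 - i) * g ^ (2 * (i + 1))\<close> over
  \<open>i < k\<close>, which is \<open>g ^ k\<close> times a geometric sum starting at
  \<open>g\<close>. The constant term \<open>e\<close> accumulates with the factor
  \<open>(1 - g ^ k) / (1 - g)\<close>.\<close>

lemma discounted_recursion:
  fixes x :: "nat \<Rightarrow> real" and g :: real
  assumes g: "0 \<le> g" "g < 1" and rec: "\<And>k. k < K \<Longrightarrow> x (Suc k) \<le> g * x k + (e + g ^ (2 * (k + 1))) * d"
  shows "k \<le> K \<Longrightarrow> x k \<le> g ^ k * (x 0 + d * (g * (1 - g ^ k) / (1 - g))) + d * e * ((1 - g ^ k) / (1 - g))"
proof (induction k)
  case (Suc k)
  have "x (Suc k) \<le> g * x k + (e + g ^ (2 * (k + 1))) * d"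
    using rec Suc.prems by simp
  also have "\<dots> \<le> g * (g ^ k * (x 0 + d * (g * (1 - g ^ k) / (1 - g))) + d * e * ((1 - g ^ k) / (1 - g)))
      + (e + g ^ (2 * (k + 1))) * d"
    using Suc g by (intro add_right_mono mult_left_mono) auto
  also have "\<dots> = g ^ Suc k * (x 0 + d * (g * (1 - g ^ k) / (1 - g) + g * g ^ k))
      + d * e * (g * ((1 - g ^ k) / (1 - g)) + 1)"
    by (simp add: algebra_simps mult_2_right flip: power_add)
  also have "g * (1 - g ^ k) / (1 - g) + g * g ^ k = g * (1 - g ^ Suc k) / (1 - g)"
    using g by (simp add: field_simps)
  also have "g * ((1 - g ^ k) / (1 - g)) + 1 = (1 - g ^ Suc k) / (1 - g)"
    using g by (simp add: field_simps)
  finally show ?case .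
qed simp

lemma inexact_hpmdD:
  assumes ih: "inexact_hpmd D X \<phi> M H h c K pol eta" and k: "k < K"
    and qs: "(qs, n) \<in> set_pmf (hpmd_run D M H h pol k)"
    and q: "(q, m) \<in> set_pmf (mc_Q D (pol qs) M H h (states D))"
  shows "mirror_map (actions D) X \<phi>"
    and "pmd_update D X \<phi> (eta (qs @ [q])) q (pol qs) (pol (qs @ [q]))"
    and "stepsize_cond D X \<phi> (c k) (eta (qs @ [q])) q (pol qs)"
proof -
  show "mirror_map (actions D) X \<phi>"
    using ih by (simp add: inexact_hpmd_def)
  have "\<forall>(qs, n)\<in>set_pmf (hpmd_run D M H h pol k).
      \<forall>(q, m)\<in>set_pmf (mc_Q D (pol qs) M H h (states D)).
        pmd_update D X \<phi> (eta (qs @ [q])) q (pol qs) (pol (qs @ [q])) \<and>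
        stepsize_cond D X \<phi> (c k) (eta (qs @ [q])) q (pol qs)"
    using ih k by (simp add: inexact_hpmd_def)
  from bspec[OF this qs] have "\<forall>(q, m)\<in>set_pmf (mc_Q D (pol qs) M H h (states D)).
        pmd_update D X \<phi> (eta (qs @ [q])) q (pol qs) (pol (qs @ [q])) \<and>
        stepsize_cond D X \<phi> (c k) (eta (qs @ [q])) q (pol qs)"
    by simp
  from bspec[OF this q] show "pmd_update D X \<phi> (eta (qs @ [q])) q (pol qs) (pol (qs @ [q]))"
    and "stepsize_cond D X \<phi> (c k) (eta (qs @ [q])) q (pol qs)"
    by simp_all
qed

lemma inexact_hpmd_policies:
  assumes ih: "inexact_hpmd D X \<phi> M H h c K pol eta" and c: "\<And>k. 0 < c k"
    and run: "(qs, n) \<in> set_pmf (hpmd_run D M H h pol k)"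
  shows "k \<le> K \<Longrightarrow> pol qs \<in> policies D"
  using run
proof (induction k arbitrary: qs n)
  case 0
  then show ?case
    using ih by (simp add: inexact_hpmd_def)
next
  case (Suc k)
  interpret fin_mdp D
    using ih by unfold_locales (simp add: inexact_hpmd_def)
  from Suc.prems obtain ps n' q c' where 1: "(ps, n') \<in> set_pmf (hpmd_run D M H h pol k)"
    and 2: "(q, c') \<in> set_pmf (mc_Q D (pol ps) M H h (states D))" and qs: "qs = ps @ [q]"
    by auto
  have "pol ps \<in> policies D"
    using Suc.IH[OF _ 1] Suc.prems by simp
  moreover have "k < K"
    using Suc.prems by simp
  note D = inexact_hpmdD[OF ih this 1 2]
  ultimately show ?case
    unfolding qs using pmd_update_gap(1)[OF D(1) _ c D(2,3)] by simp
qed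

lemma inexact_hpmd_step:
  assumes ih: "inexact_hpmd D X \<phi> M H h c K pol eta" and c: "\<And>k. 0 < c k" and h: "1 \<le> h"
    and run: "(qs, n) \<in> set_pmf (hpmd_run D M H h pol K)" and i: "i < K"
    and Q: "\<And>s a. s \<in> states D \<Longrightarrow> a \<in> actions D \<Longrightarrow>
      \<bar>(qs ! i) s a - qval D ((opt_backup D ^^ (h - 1)) (value_fun D (pol (take i qs)))) s a\<bar> \<le> b"
  shows "sup_norm D (\<lambda>s. opt_value D s - value_fun D (pol (take (Suc i) qs)) s) \<le>
    discount D ^ h * sup_norm D (\<lambda>s. opt_value D s - value_fun D (pol (take i qs)) s)
      + (2 * b + c i) / (1 - discount D)"
proof -
  interpret fin_mdp D
    using ih by unfold_locales (simp add: inexact_hpmd_def)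
  obtain n' c' where 1: "(take i qs, n') \<in> set_pmf (hpmd_run D M H h pol i)"
    and 2: "(qs ! i, c') \<in> set_pmf (mc_Q D (pol (take i qs)) M H h (states D))"
    using set_hpmd_run(2,3)[OF run i] by blast
  have take_Suc: "take (Suc i) qs = take i qs @ [qs ! i]"
    using set_hpmd_run(1)[OF run] i by (simp add: take_Suc_conv_app_nth)
  have pol: "pol (take i qs) \<in> policies D"
    using inexact_hpmd_policies[OF ih c 1] i by simp
  note D = inexact_hpmdD[OF ih i 1 2, folded take_Suc]
  note gap = pmd_update_gap[OF D(1) pol c[of i] D(2,3)]
  show ?thesis
    using h pol gap(1) Q gap(2) by (rule lookahead_improvement_inexact)
qed


section \<open>Choice of the parameters\<close>

definition admissible :: "nat \<Rightarrow> nat \<Rightarrow> real \<Rightarrow> nat \<Rightarrow> real \<Rightarrow> real \<Rightarrow> bool" where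
  "admissible S A \<gamma> h \<epsilon> \<delta> \<longleftrightarrow> 1 \<le> S \<and> 1 \<le> A \<and> 0 < \<gamma> \<and> \<gamma> < 1 \<and> 1 \<le> h \<and> 0 < \<epsilon> \<and> 0 < \<delta>"

definition log_size :: "nat \<Rightarrow> nat \<Rightarrow> real \<Rightarrow> nat \<Rightarrow> real \<Rightarrow> real \<Rightarrow> nat \<Rightarrow> real" where
  "log_size S A \<gamma> h \<epsilon> \<delta> K = ln (problem_size S A \<gamma> h \<epsilon> \<delta> + real K)"

text \<open>
  The constants 192 and 48 make the Hoeffding exponents at least \<open>6 * log_size\<close>, so that each single
  failure has probability at most \<open>2 / (problem_size + K)\<^sup>6\<close>. Outside the admissible range the values
  are junk, positive as required of the parameters.
\<close>

definition rollouts :: mc_parameter where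
  "rollouts S A \<gamma> h \<epsilon> \<delta> K =
     (if admissible S A \<gamma> h \<epsilon> \<delta>
      then nat \<lceil>192 * log_size S A \<gamma> h \<epsilon> \<delta> K *
        (\<gamma> ^ (2 * h) / ((1 - \<gamma>) ^ 4 * (1 - \<gamma> ^ h) ^ 2 * \<epsilon> ^ 2))\<rceil> else 1)"

definition next_states :: mc_parameter where
  "next_states S A \<gamma> h \<epsilon> \<delta> K =
     (if admissible S A \<gamma> h \<epsilon> \<delta>
      then nat \<lceil>48 * log_size S A \<gamma> h \<epsilon> \<delta> K * (1 / ((1 - \<gamma>) ^ 6 * \<epsilon> ^ 2))\<rceil> else 1)"

text \<open>Since \<open>\<gamma> \<le> exp (- (1 - \<gamma>))\<close>, the constant 6 makes
  \<open>\<gamma>\<close> to this length at most the sixth power of the reciprocal of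
  \<open>problem_size\<close> plus \<open>K\<close>, like the failure probabilities.\<close>

definition rollout_length :: mc_parameter where
  "rollout_length S A \<gamma> h \<epsilon> \<delta> K =
     (if admissible S A \<gamma> h \<epsilon> \<delta> then nat \<lceil>6 * log_size S A \<gamma> h \<epsilon> \<delta> K / (1 - \<gamma>)\<rceil> else 1)"

section \<open>Sizes of the parameters\<close>

lemma le_nat_ceiling: "0 < x \<Longrightarrow> 1 \<le> nat \<lceil>x\<rceil> \<and> x \<le> real (nat \<lceil>x\<rceil>) \<and> real (nat \<lceil>x\<rceil>) \<le> x + 1"
  by linarith

lemma one_minus_power_bounds:
  fixes \<gamma> :: real
  assumes "0 < \<gamma>" "\<gamma> < 1" "1 \<le> h"
  shows "1 - \<gamma> \<le> 1 - \<gamma> ^ h" "1 - \<gamma> ^ h < 1" "0 < 1 - \<gamma> ^ h" "0 < \<gamma> ^ h" "\<gamma> ^ h < 1"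
proof -
  have "\<gamma> ^ h \<le> \<gamma> ^ 1"
    using assms by (intro power_decreasing) auto
  then show "1 - \<gamma> \<le> 1 - \<gamma> ^ h" "1 - \<gamma> ^ h < 1" "0 < 1 - \<gamma> ^ h" "0 < \<gamma> ^ h" "\<gamma> ^ h < 1"
    using assms by auto
qed

lemma problem_size_bounds:
  assumes "admissible S A \<gamma> h \<epsilon> \<delta>"
  shows "4 < problem_size S A \<gamma> h \<epsilon> \<delta>" "real S \<le> problem_size S A \<gamma> h \<epsilon> \<delta>"
    "real A \<le> problem_size S A \<gamma> h \<epsilon> \<delta>" "real h \<le> problem_size S A \<gamma> h \<epsilon> \<delta>"
    "1 / (1 - \<gamma>) \<le> problem_size S A \<gamma> h \<epsilon> \<delta>" "1 / \<epsilon> \<le> problem_size S A \<gamma> h \<epsilon> \<delta>"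
    "1 / \<delta> \<le> problem_size S A \<gamma> h \<epsilon> \<delta>"
proof -
  have "1 \<le> real S" "1 \<le> real A" "1 \<le> real h" "1 < 1 / (1 - \<gamma>)" "0 < 1 / \<epsilon>" "0 < 1 / \<delta>"
    using assms by (auto simp: admissible_def)
  then show "4 < problem_size S A \<gamma> h \<epsilon> \<delta>" "real S \<le> problem_size S A \<gamma> h \<epsilon> \<delta>"
    "real A \<le> problem_size S A \<gamma> h \<epsilon> \<delta>" "real h \<le> problem_size S A \<gamma> h \<epsilon> \<delta>"
    "1 / (1 - \<gamma>) \<le> problem_size S A \<gamma> h \<epsilon> \<delta>" "1 / \<epsilon> \<le> problem_size S A \<gamma> h \<epsilon> \<delta>"
    "1 / \<delta> \<le> problem_size S A \<gamma> h \<epsilon> \<delta>"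
    unfolding problem_size_def by linarith+
qed

lemma log_size_pos: "admissible S A \<gamma> h \<epsilon> \<delta> \<Longrightarrow> 0 < log_size S A \<gamma> h \<epsilon> \<delta> K"
  using problem_size_bounds(1)[of S A \<gamma> h \<epsilon> \<delta>] by (simp add: log_size_def)

lemma mc_parameter_bounds:
  fixes K :: nat
  assumes "admissible S A \<gamma> h \<epsilon> \<delta>"
  defines "L \<equiv> log_size S A \<gamma> h \<epsilon> \<delta> K"
    and "g\<^sub>0 \<equiv> \<gamma> ^ (2 * h) / ((1 - \<gamma>) ^ 4 * (1 - \<gamma> ^ h) ^ 2 * \<epsilon> ^ 2)"
    and "g \<equiv> 1 / ((1 - \<gamma>) ^ 6 * \<epsilon> ^ 2)"
  shows "1 \<le> rollouts S A \<gamma> h \<epsilon> \<delta> K" "192 * L * g\<^sub>0 \<le> real (rollouts S A \<gamma> h \<epsilon> \<delta> K)"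
    "real (rollouts S A \<gamma> h \<epsilon> \<delta> K) \<le> 192 * L * g\<^sub>0 + 1"
    "1 \<le> next_states S A \<gamma> h \<epsilon> \<delta> K" "48 * L * g \<le> real (next_states S A \<gamma> h \<epsilon> \<delta> K)"
    "real (next_states S A \<gamma> h \<epsilon> \<delta> K) \<le> 48 * L * g + 1"
    "1 \<le> rollout_length S A \<gamma> h \<epsilon> \<delta> K" "6 * L / (1 - \<gamma>) \<le> real (rollout_length S A \<gamma> h \<epsilon> \<delta> K)"
    "real (rollout_length S A \<gamma> h \<epsilon> \<delta> K) \<le> 6 * L / (1 - \<gamma>) + 1"
proof -
  have \<gamma>: "0 < \<gamma>" "\<gamma> < 1" "1 \<le> h" "0 < \<epsilon>"
    using assms(1) by (auto simp: admissible_def)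
  have "0 < L" "0 < g" "0 < g\<^sub>0"
    using \<gamma> log_size_pos[OF assms(1)] one_minus_power_bounds(3)[OF \<gamma>(1-3)] by (auto simp: L_def g_def g\<^sub>0_def)
  then have "0 < 192 * L * g\<^sub>0" "0 < 48 * L * g" "0 < 6 * L / (1 - \<gamma>)"
    using \<gamma> by auto
  note this[THEN le_nat_ceiling]
  then show "1 \<le> rollouts S A \<gamma> h \<epsilon> \<delta> K" "192 * L * g\<^sub>0 \<le> real (rollouts S A \<gamma> h \<epsilon> \<delta> K)"
    "real (rollouts S A \<gamma> h \<epsilon> \<delta> K) \<le> 192 * L * g\<^sub>0 + 1"
    "1 \<le> next_states S A \<gamma> h \<epsilon> \<delta> K" "48 * L * g \<le> real (next_states S A \<gamma> h \<epsilon> \<delta> K)"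
    "real (next_states S A \<gamma> h \<epsilon> \<delta> K) \<le> 48 * L * g + 1"
    "1 \<le> rollout_length S A \<gamma> h \<epsilon> \<delta> K" "6 * L / (1 - \<gamma>) \<le> real (rollout_length S A \<gamma> h \<epsilon> \<delta> K)"
    "real (rollout_length S A \<gamma> h \<epsilon> \<delta> K) \<le> 6 * L / (1 - \<gamma>) + 1"
    unfolding rollouts_def next_states_def rollout_length_def L_def[symmetric] g\<^sub>0_def[symmetric] g_def[symmetric]
      if_P[OF assms(1)] by blast+
qed

lemma mc_parameter_ge_1:
  "1 \<le> rollouts S A \<gamma> h \<epsilon> \<delta> K" "1 \<le> next_states S A \<gamma> h \<epsilon> \<delta> K" "1 \<le> rollout_length S A \<gamma> h \<epsilon> \<delta> K"
  using mc_parameter_bounds(1,4,7)[of S A \<gamma> h \<epsilon> \<delta> K]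
  by (cases "admissible S A \<gamma> h \<epsilon> \<delta>"; simp add: rollouts_def next_states_def rollout_length_def)+

lemma soft_O_rollouts: "soft_O rollouts (\<lambda>\<gamma> h \<epsilon>. \<gamma> ^ (2 * h) / ((1 - \<gamma>) ^ 4 * (1 - \<gamma> ^ h) ^ 2 * \<epsilon> ^ 2))"
  unfolding soft_O_def
proof (rule exI[of _ 192], rule exI[of _ 1], intro allI impI)
  fix S A h K :: nat and \<gamma> \<epsilon> \<delta> :: real
  assume "1 \<le> S \<and> 1 \<le> A \<and> 0 < \<gamma> \<and> \<gamma> < 1 \<and> 1 \<le> h \<and> 0 < \<epsilon> \<and> 0 < \<delta>"
  then have adm: "admissible S A \<gamma> h \<epsilon> \<delta>"
    by (simp add: admissible_def)
  then have "0 \<le> 192 * log_size S A \<gamma> h \<epsilon> \<delta> K * (\<gamma> ^ (2 * h) / ((1 - \<gamma>) ^ 4 * (1 - \<gamma> ^ h) ^ 2 * \<epsilon> ^ 2))"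
    using log_size_pos[OF adm, of K] by (intro mult_nonneg_nonneg divide_nonneg_nonneg) (auto simp: admissible_def)
  then show "int (rollouts S A \<gamma> h \<epsilon> \<delta> K) \<le> \<lceil>192 * ln (problem_size S A \<gamma> h \<epsilon> \<delta> + real K) ^ 1 *
      (\<gamma> ^ (2 * h) / ((1 - \<gamma>) ^ 4 * (1 - \<gamma> ^ h) ^ 2 * \<epsilon> ^ 2))\<rceil>"
    unfolding rollouts_def if_P[OF adm] log_size_def power_one_right by linarith
qed

lemma soft_O_next_states: "soft_O next_states (\<lambda>\<gamma> h \<epsilon>. 1 / ((1 - \<gamma>) ^ 6 * \<epsilon> ^ 2))"
  unfolding soft_O_def
proof (rule exI[of _ 48], rule exI[of _ 1], intro allI impI)
  fix S A h K :: nat and \<gamma> \<epsilon> \<delta> :: real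
  assume "1 \<le> S \<and> 1 \<le> A \<and> 0 < \<gamma> \<and> \<gamma> < 1 \<and> 1 \<le> h \<and> 0 < \<epsilon> \<and> 0 < \<delta>"
  then have adm: "admissible S A \<gamma> h \<epsilon> \<delta>"
    by (simp add: admissible_def)
  then have "0 \<le> 48 * log_size S A \<gamma> h \<epsilon> \<delta> K * (1 / ((1 - \<gamma>) ^ 6 * \<epsilon> ^ 2))"
    using log_size_pos[OF adm, of K] by (intro mult_nonneg_nonneg divide_nonneg_nonneg) (auto simp: admissible_def)
  then show "int (next_states S A \<gamma> h \<epsilon> \<delta> K) \<le> \<lceil>48 * ln (problem_size S A \<gamma> h \<epsilon> \<delta> + real K) ^ 1 *
      (1 / ((1 - \<gamma>) ^ 6 * \<epsilon> ^ 2))\<rceil>"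
    unfolding next_states_def if_P[OF adm] log_size_def power_one_right by linarith
qed

section \<open>Failure probabilities and the error budget\<close>

lemma exp_neg_log_size_le:
  assumes adm: "admissible S A \<gamma> h \<epsilon> \<delta>" and x: "6 * log_size S A \<gamma> h \<epsilon> \<delta> K \<le> x"
  shows "exp (- x) \<le> 1 / (problem_size S A \<gamma> h \<epsilon> \<delta> + real K) ^ 6"
proof -
  let ?N = "problem_size S A \<gamma> h \<epsilon> \<delta> + real K"
  have N: "0 < ?N"
    using problem_size_bounds(1)[OF adm] by simp
  have "exp (- x) \<le> exp (- (6 * ln ?N))"
    using x by (simp add: log_size_def)
  also have "\<dots> = 1 / exp (real 6 * ln ?N)"
    by (simp add: exp_minus inverse_eq_divide)
  also have "\<dots> = 1 / ?N ^ 6"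
    using N by (simp only: exp_of_nat_mult exp_ln)
  finally show ?thesis .
qed

lemma truncation_error_le:
  assumes adm: "admissible S A \<gamma> h \<epsilon> \<delta>"
  shows "\<gamma> ^ rollout_length S A \<gamma> h \<epsilon> \<delta> K / (1 - \<gamma>) \<le> \<epsilon> * (1 - \<gamma>) * (1 - \<gamma> ^ h) / 8"
proof -
  let ?N = "problem_size S A \<gamma> h \<epsilon> \<delta> + real K" and ?H = "rollout_length S A \<gamma> h \<epsilon> \<delta> K"
  have \<gamma>: "0 < \<gamma>" "\<gamma> < 1" "1 \<le> h" "0 < \<epsilon>"
    using adm by (auto simp: admissible_def)
  define u where "u = 1 - \<gamma>"
  have u: "0 < u" "u < 1" using \<gamma> by (auto simp: u_def)
  have N: "4 < ?N" "1 / u \<le> ?N" "1 / \<epsilon> \<le> ?N"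
    using problem_size_bounds(1,5,6)[OF adm] by (auto simp: u_def)
  have "\<gamma> \<le> exp (- u)"
    using exp_ge_add_one_self[of "- u"] by (simp add: u_def)
  then have "\<gamma> ^ ?H \<le> exp (- u) ^ ?H"
    using \<gamma> by (intro power_mono) auto
  also have "\<dots> = exp (- (real ?H * u))"
    by (simp flip: exp_of_nat_mult)
  also have "\<dots> \<le> 1 / ?N ^ 6"
    using mc_parameter_bounds(8)[OF adm, of K] u
    by (intro exp_neg_log_size_le[OF adm]) (simp add: u_def[symmetric] field_simps)
  also have "\<dots> \<le> \<epsilon> * u ^ 3 / 8"
  proof -
    \<comment> \<open>Of the six powers, two absorb the 8, one absorbs \<open>1 / \<epsilon>\<close>
      and three absorb \<open>(1 / u) ^ 3\<close>. One factor \<open>u\<close> gained here is spent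
      on the later division by \<open>1 - \<gamma>\<close>.\<close>
    have "8 * (1 / \<epsilon> * (1 / u) ^ 3) \<le> ?N ^ 2 * (?N * ?N ^ 3)"
    proof (intro mult_mono power_mono)
      have "8 \<le> (4::real) ^ 2" by simp
      also have "\<dots> \<le> ?N ^ 2"
        using N by (intro power_mono) auto
      finally show "8 \<le> ?N ^ 2" .
    qed (use N u \<gamma> in auto)
    also have "\<dots> = ?N ^ 6"
      by (simp flip: power_add power_Suc)
    finally have "1 / ?N ^ 6 \<le> 1 / (8 * (1 / \<epsilon> * (1 / u) ^ 3))"
      using u \<gamma> by (intro divide_left_mono mult_pos_pos) (use N in auto)
    also have "\<dots> = \<epsilon> * u ^ 3 / 8"
      by (simp add: power_divide)
    finally show ?thesis .
  qed
  finally have "\<gamma> ^ ?H / u \<le> \<epsilon> * u ^ 3 / 8 / u"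
    using u by (intro divide_right_mono) auto
  also have "\<dots> = \<epsilon> * u * u / 8"
    using u by (simp add: power3_eq_cube)
  also have "\<dots> \<le> \<epsilon> * u * (1 - \<gamma> ^ h) / 8"
    using one_minus_power_bounds(1)[OF \<gamma>(1-3)] \<gamma> u
    by (intro divide_right_mono mult_left_mono) (auto simp: u_def)
  finally show ?thesis
    by (simp add: u_def)
qed

text \<open>Rollout errors are discounted by \<open>\<gamma> ^ h\<close> on their way up, so
  \<open>\<tau>\<^sub>0\<close> may carry this factor in its denominator; its square is the
  \<open>\<gamma> ^ (2 * h)\<close> in the number of rollouts. Before rounding the exponent is
  \<open>2 * 192 / 64 = 6\<close> times the logarithm.\<close>

lemma rollout_exponent:
  assumes adm: "admissible S A \<gamma> h \<epsilon> \<delta>"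
  defines "\<tau>\<^sub>0 \<equiv> \<epsilon> * (1 - \<gamma>) * (1 - \<gamma> ^ h) / (8 * \<gamma> ^ h)"
  shows "2 * exp (- 2 * real (rollouts S A \<gamma> h \<epsilon> \<delta> K) * (\<tau>\<^sub>0 * (1 - \<gamma>))\<^sup>2) \<le>
    2 / (problem_size S A \<gamma> h \<epsilon> \<delta> + real K) ^ 6"
proof -
  have \<gamma>: "0 < \<gamma>" "\<gamma> < 1" "1 \<le> h" "0 < \<epsilon>"
    using adm by (auto simp: admissible_def)
  define u w q where "u = 1 - \<gamma>" and "w = 1 - \<gamma> ^ h" and "q = \<gamma> ^ h"
  have pos: "0 < u" "0 < w" "0 < q"
    using \<gamma> one_minus_power_bounds[OF \<gamma>(1-3)] by (auto simp: u_def w_def q_def)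
  define L where "L = log_size S A \<gamma> h \<epsilon> \<delta> K"
  have q2: "\<gamma> ^ (2 * h) = q\<^sup>2"
    by (simp add: q_def power_mult mult.commute flip: power_mult)
  have "192 * L * (q\<^sup>2 / (u ^ 4 * w\<^sup>2 * \<epsilon>\<^sup>2)) \<le> real (rollouts S A \<gamma> h \<epsilon> \<delta> K)"
    using mc_parameter_bounds(2)[OF adm, of K] by (simp only: L_def u_def w_def q2)
  then have "2 * (192 * L * (q\<^sup>2 / (u ^ 4 * w\<^sup>2 * \<epsilon>\<^sup>2))) * (\<tau>\<^sub>0 * u)\<^sup>2 \<le>
      2 * real (rollouts S A \<gamma> h \<epsilon> \<delta> K) * (\<tau>\<^sub>0 * u)\<^sup>2"
    by (intro mult_right_mono mult_left_mono) auto
  moreover have "\<tau>\<^sub>0 = \<epsilon> * u * w / (8 * q)"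
    by (simp only: \<tau>\<^sub>0_def u_def w_def q_def)
  then have "(\<tau>\<^sub>0 * u)\<^sup>2 = (u ^ 4 * w\<^sup>2 * \<epsilon>\<^sup>2) / (64 * q\<^sup>2)"
    by (simp add: power2_eq_square power4_eq_xxxx)
  then have "2 * (192 * L * (q\<^sup>2 / (u ^ 4 * w\<^sup>2 * \<epsilon>\<^sup>2))) * (\<tau>\<^sub>0 * u)\<^sup>2 = 6 * L"
    using pos \<gamma> by (simp only:) simp
  ultimately have "6 * L \<le> 2 * real (rollouts S A \<gamma> h \<epsilon> \<delta> K) * (\<tau>\<^sub>0 * u)\<^sup>2"
    by linarith
  from exp_neg_log_size_le[OF adm this[unfolded L_def]] show ?thesis
    by (simp add: u_def)
qed

text \<open>\<open>\<tau>\<close> is proportional to the square of \<open>1 - \<gamma>\<close>, and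
  the value range costs one more factor; squaring produces the sixth power in the order of the
  parameter. Before rounding the exponent is \<open>2 * 48 / 16 = 6\<close> times the
  logarithm.\<close>

lemma next_states_exponent:
  assumes adm: "admissible S A \<gamma> h \<epsilon> \<delta>"
  defines "\<tau> \<equiv> \<epsilon> * (1 - \<gamma>)\<^sup>2 / 4"
  shows "2 * exp (- 2 * real (next_states S A \<gamma> h \<epsilon> \<delta> K) * (\<tau> * (1 - \<gamma>))\<^sup>2) \<le>
    2 / (problem_size S A \<gamma> h \<epsilon> \<delta> + real K) ^ 6"
proof -
  have \<gamma>: "0 < \<gamma>" "\<gamma> < 1" "1 \<le> h" "0 < \<epsilon>"
    using adm by (auto simp: admissible_def)
  define u where "u = 1 - \<gamma>"
  have pos: "0 < u"
    using \<gamma> by (auto simp: u_def)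
  define L where "L = log_size S A \<gamma> h \<epsilon> \<delta> K"
  have "48 * L * (1 / (u ^ 6 * \<epsilon>\<^sup>2)) \<le> real (next_states S A \<gamma> h \<epsilon> \<delta> K)"
    using mc_parameter_bounds(5)[OF adm, of K] by (simp only: L_def u_def)
  then have "2 * (48 * L * (1 / (u ^ 6 * \<epsilon>\<^sup>2))) * (\<tau> * u)\<^sup>2 \<le>
      2 * real (next_states S A \<gamma> h \<epsilon> \<delta> K) * (\<tau> * u)\<^sup>2"
    by (intro mult_right_mono mult_left_mono) auto
  moreover have "\<tau> = \<epsilon> * u\<^sup>2 / 4"
    by (simp only: \<tau>_def u_def)
  then have "(\<tau> * u)\<^sup>2 = (u ^ 6 * \<epsilon>\<^sup>2) / 16"
    by (simp only:) (simp add: eval_nat_numeral)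
  then have "2 * (48 * L * (1 / (u ^ 6 * \<epsilon>\<^sup>2))) * (\<tau> * u)\<^sup>2 = 6 * L"
    using pos \<gamma> by (simp only:) simp
  ultimately have "6 * L \<le> 2 * real (next_states S A \<gamma> h \<epsilon> \<delta> K) * (\<tau> * u)\<^sup>2"
    by linarith
  from exp_neg_log_size_le[OF adm this[unfolded L_def]] show ?thesis
    by (simp add: u_def)
qed

text \<open>At most four counts, each at most N = problem size plus K, multiply
  \<open>2 / N ^ 6\<close>. Of the remaining two powers of N, one swallows the constant 4 and the
  other is at least \<open>1 / \<delta>\<close>.\<close>

lemma total_failure_le:
  assumes adm: "admissible S A \<gamma> h \<epsilon> \<delta>"
    and p: "p\<^sub>0 \<le> 2 / (problem_size S A \<gamma> h \<epsilon> \<delta> + real K) ^ 6" "p \<le> 2 / (problem_size S A \<gamma> h \<epsilon> \<delta> + real K) ^ 6"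
  shows "real K * (real S * p\<^sub>0 + real h * (real S * real A * p)) \<le> \<delta>"
proof -
  define N where "N = problem_size S A \<gamma> h \<epsilon> \<delta> + real K"
  have N: "4 < N" "real K \<le> N" "real S \<le> N" "real A \<le> N" "real h \<le> N" "1 / \<delta> \<le> N"
    using problem_size_bounds[OF adm] by (auto simp: N_def)
  have "real K * (real S * p\<^sub>0 + real h * (real S * real A * p)) \<le>
      real K * (real S * (2 / N ^ 6) + real h * (real S * real A * (2 / N ^ 6)))"
    using p by (intro mult_left_mono add_mono) (auto simp: N_def)
  also have "\<dots> \<le> N * (N * (2 / N ^ 6) + N * (N * N * (2 / N ^ 6)))"
    using N by (intro mult_mono add_mono) auto
  \<comment> \<open>The rollout term is raised to the same power of N as the next-state term, so
    that the two add up.\<close>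
  also have "\<dots> \<le> N * (N * N * N * (2 / N ^ 6) + N * (N * N * (2 / N ^ 6)))"
  proof (intro mult_left_mono add_right_mono mult_right_mono)
    have "N * 1 \<le> N * (N * N)"
      using N mult_mono[of 1 N 1 N] by (intro mult_left_mono) auto
    then show "N \<le> N * N * N"
      by (simp add: mult.assoc)
  qed (use N in auto)
  also have "\<dots> = 4 / N / N"
    using N by (simp add: field_simps eval_nat_numeral)
  also have "\<dots> \<le> 1 / N"
    using N by (intro divide_right_mono) auto
  also have "\<dots> \<le> \<delta>"
    using N adm by (auto simp: admissible_def field_simps)
  finally show ?thesis .
qed

text \<open>Of the product \<open>\<epsilon> * (1 - \<gamma>) * (1 - \<gamma> ^ h)\<close>, rollout
  deviation and truncation are charged an eighth each and next-state sampling a quarter.\<close>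

lemma (in mdp_policy) mc_error_le:
  assumes adm: "admissible S A \<gamma> h \<epsilon> \<delta>"
  shows "mc_error (rollout_length S A \<gamma> h \<epsilon> \<delta> K) (\<epsilon> * (1 - \<gamma>) * (1 - \<gamma> ^ h) / (8 * \<gamma> ^ h)) (\<epsilon> * (1 - \<gamma>)\<^sup>2 / 4) h
    \<le> \<epsilon> * (1 - \<gamma>) * (1 - \<gamma> ^ h) / 2"
proof -
  have h: "1 \<le> h" and \<epsilon>: "0 < \<epsilon>"
    using adm by (auto simp: admissible_def)
  define u w q where "u = 1 - \<gamma>" and "w = 1 - \<gamma> ^ h" and "q = \<gamma> ^ h"
  have pos: "0 < u" "0 < w" "0 < q" "q < 1"
    using \<gamma> one_minus_power_bounds[OF \<gamma> h] by (auto simp: u_def w_def q_def)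
  let ?H = "rollout_length S A \<gamma> h \<epsilon> \<delta> K"
  have "\<gamma> ^ ?H / u \<le> \<epsilon> * u * w / 8"
    using truncation_error_le[OF adm, of K] by (simp add: u_def w_def)
  then have "q * (\<gamma> ^ ?H / u) \<le> 1 * (\<epsilon> * u * w / 8)"
    using pos \<gamma> by (intro mult_mono) auto
  moreover have "q * (\<epsilon> * u * w / (8 * q)) = \<epsilon> * u * w / 8"
    using pos by simp
  moreover have "\<gamma> * (\<epsilon> * u\<^sup>2 / 4) * w / u = \<gamma> * (\<epsilon> * u * w / 4)"
    using pos by (simp add: power2_eq_square)
  moreover have "\<gamma> * (\<epsilon> * u * w / 4) \<le> 1 * (\<epsilon> * u * w / 4)"
    using pos \<gamma> \<epsilon> by (intro mult_right_mono) auto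
  ultimately have "q * (\<epsilon> * u * w / (8 * q) + \<gamma> ^ ?H / u) + \<gamma> * (\<epsilon> * u\<^sup>2 / 4) * w / u \<le> \<epsilon> * u * w / 2"
    unfolding distrib_left by linarith
  then show ?thesis
    unfolding mc_error_eq by (simp only: u_def w_def q_def)
qed

text \<open>The upper bound on K gives problem size plus K at most \<open>5 * \<kappa>\<close> times
  the squared problem size, so the logarithms containing K are at most \<open>c\<close> times the
  one without; \<open>c\<close> collects the constant and the square. The powers of
  \<open>1 - \<gamma>\<close> add up as 1 + 4 + 1 from iterations, rollouts and their length, and as
  1 + 6 from iterations and next states.\<close>

lemma sample_complexity_bound:
  assumes adm: "admissible S A \<gamma> h \<epsilon> \<delta>" and \<kappa>: "1 \<le> \<kappa>"
    and K: "iter_threshold \<gamma> h \<epsilon> < real K" "real K \<le> \<kappa> * iter_threshold \<gamma> h \<epsilon>"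
  defines "c \<equiv> ln (5 * \<kappa>) + 2"
  shows "real K * real (rollouts S A \<gamma> h \<epsilon> \<delta> K) * real (rollout_length S A \<gamma> h \<epsilon> \<delta> K) * real S
      + real h * real K * real (next_states S A \<gamma> h \<epsilon> \<delta> K) * real S * real A
    \<le> (4 * \<kappa> * (192 * c + 16) * (6 * c + 1) + 4 * \<kappa> * (48 * c + 16)) * ln (problem_size S A \<gamma> h \<epsilon> \<delta>) ^ 3 *
      (real S / (real h * \<epsilon> ^ 2 * (1 - \<gamma>) ^ 6 * (1 - \<gamma> ^ h) ^ 2) +
       real S * real A / (\<epsilon> ^ 2 * (1 - \<gamma>) ^ 7))"
proof -
  have \<gamma>: "0 < \<gamma>" "\<gamma> < 1" "1 \<le> h" "0 < \<epsilon>"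
    using adm by (auto simp: admissible_def)
  define u w q where "u = 1 - \<gamma>" and "w = 1 - \<gamma> ^ h" and "q = \<gamma> ^ h"
  have u: "0 < u" "u < 1" and w: "u \<le> w" "0 < w" "w < 1" and q: "0 < q" "q < 1"
    using \<gamma> one_minus_power_bounds[OF \<gamma>(1-3)] by (auto simp: u_def w_def q_def)
  have h: "1 \<le> real h" using \<gamma> by simp
  define P where "P = problem_size S A \<gamma> h \<epsilon> \<delta>"
  define l where "l = ln P"
  define L where "L = log_size S A \<gamma> h \<epsilon> \<delta> K"
  define r where "r = ln (4 / (\<epsilon> * u * w))"
  have P: "4 < P" "1 / u \<le> P" "1 / \<epsilon> \<le> P"
    using problem_size_bounds[OF adm] by (auto simp: P_def u_def)
  have l: "1 \<le> l"
  proof -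
    have "exp 1 \<le> P"
      using exp_le P by linarith
    then show ?thesis
      using P by (simp add: l_def ln_ge_iff)
  qed
  have thr: "iter_threshold \<gamma> h \<epsilon> = r / (real h * u)"
    by (simp add: iter_threshold_def r_def u_def w_def)
  \<comment> \<open>For a nonpositive threshold the two bounds on K conflict, as
    \<open>\<kappa> \<ge> 1\<close>. Positivity means \<open>\<epsilon> * u * w < 4\<close>, which
    keeps the unrounded parameters bounded away from 0.\<close>
  have "0 < iter_threshold \<gamma> h \<epsilon>"
  proof (rule ccontr)
    assume "\<not> 0 < iter_threshold \<gamma> h \<epsilon>"
    then have "\<kappa> * iter_threshold \<gamma> h \<epsilon> \<le> 1 * iter_threshold \<gamma> h \<epsilon>"
      using \<kappa> by (intro mult_right_mono_neg) auto
    then show False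
      using K by linarith
  qed
  moreover have "0 < real h * u"
    using u h by simp
  ultimately have "0 < r"
    by (simp only: thr zero_less_divide_iff) linarith
  moreover have prod_pos: "0 < \<epsilon> * u * w"
    using \<gamma> u w by simp
  ultimately have "1 < 4 / (\<epsilon> * u * w)"
    unfolding r_def by (subst (asm) ln_gt_zero_iff) auto
  then have "\<epsilon> * u * w < 4"
    using prod_pos by (simp add: field_simps)
  then have "(\<epsilon> * u * w)\<^sup>2 \<le> 4\<^sup>2"
    using prod_pos by (intro power_mono) auto
  then have one: "1 \<le> 16 / (\<epsilon>\<^sup>2 * u\<^sup>2 * w\<^sup>2)"
    using u w \<gamma> by (simp add: power_mult_distrib)
  \<comment> \<open>Each of 4, \<open>1 / \<epsilon>\<close>, \<open>1 / u\<close> and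
    \<open>1 / w\<close> is at most \<open>P\<close>, hence the factor 4.\<close>
  have r: "r \<le> 4 * l"
  proof -
    have "1 / w \<le> 1 / u"
      using u w by (intro divide_left_mono) auto
    then have "4 * (1 / \<epsilon>) * (1 / u) * (1 / w) \<le> P * P * P * P"
      using P u w \<gamma> by (intro mult_mono) auto
    then have "4 / (\<epsilon> * u * w) \<le> P ^ 4"
      by (simp add: eval_nat_numeral mult.assoc)
    then have "r \<le> ln (P ^ 4)"
      unfolding r_def using prod_pos P by (intro ln_mono) auto
    also have "\<dots> = 4 * l"
      using P by (simp add: l_def ln_realpow)
    finally show ?thesis .
  qed
  have K_le: "real K \<le> 4 * \<kappa> * l / (real h * u)"
  proof -
    have "r / (real h * u) \<le> 4 * l / (real h * u)"
      using r u h by (intro divide_right_mono) auto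
    then have "\<kappa> * (r / (real h * u)) \<le> \<kappa> * (4 * l / (real h * u))"
      using \<kappa> by (intro mult_left_mono) auto
    then show ?thesis
      using K(2) by (simp add: thr mult_ac)
  qed
  have c: "2 \<le> c"
    using \<kappa> by (simp add: c_def ln_ge_zero)
  have L: "L \<le> c * l"
  proof -
    have "l \<le> P"
      unfolding l_def using P ln_le_minus_one[of P] by linarith
    moreover have "1 / (real h * u) \<le> 1 / (1 * u)"
      using u h by (intro divide_left_mono mult_right_mono mult_pos_pos) auto
    then have "1 / (real h * u) \<le> P"
      using P by simp
    ultimately have "l * (1 / (real h * u)) \<le> P * P"
      using l u h P by (intro mult_mono) auto
    then have "4 * \<kappa> * (l * (1 / (real h * u))) \<le> 4 * \<kappa> * (P * P)"
      using \<kappa> by (intro mult_left_mono) auto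
    moreover have "1 * P \<le> \<kappa> * P * P"
    proof -
      have "1 * 1 \<le> \<kappa> * P"
        using \<kappa> P by (intro mult_mono) auto
      then show ?thesis
        using P by (intro mult_right_mono) auto
    qed
    ultimately have "P + real K \<le> 5 * \<kappa> * P\<^sup>2"
      using K_le by (simp add: power2_eq_square)
    then have "L \<le> ln (5 * \<kappa> * P\<^sup>2)"
      unfolding L_def log_size_def P_def[symmetric] using P by (intro ln_mono) auto
    also have "\<dots> = ln (5 * \<kappa>) + 2 * l"
      using \<kappa> P by (simp add: ln_mult ln_realpow l_def)
    also have "ln (5 * \<kappa>) \<le> ln (5 * \<kappa>) * l"
      using \<kappa> l by (simp add: mult_le_cancel_left1 ln_ge_zero)
    finally show ?thesis
      by (simp add: c_def algebra_simps)
  qed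
  have L0: "0 < L"
    unfolding L_def using adm by (rule log_size_pos)
  have cl: "0 \<le> c * l" using c l by simp
  define G\<^sub>0 where "G\<^sub>0 = 1 / (u ^ 4 * w\<^sup>2 * \<epsilon>\<^sup>2)"
  define G where "G = 1 / (u ^ 6 * \<epsilon>\<^sup>2)"
  have G0: "0 < G\<^sub>0" "0 < G"
    using u w \<gamma> by (auto simp: G\<^sub>0_def G_def)
  \<comment> \<open>Rounding up adds 1 to the number of rollouts. This 1 is absorbed into the main
    term, whence the summand 16 in the constants.\<close>
  have one0: "1 \<le> 16 * G\<^sub>0"
  proof -
    have "u ^ 4 \<le> u\<^sup>2"
      using u by (intro power_decreasing) auto
    then have "16 / (\<epsilon>\<^sup>2 * u\<^sup>2 * w\<^sup>2) \<le> 16 / (\<epsilon>\<^sup>2 * u ^ 4 * w\<^sup>2)"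
      using u w \<gamma> by (intro divide_left_mono mult_right_mono mult_left_mono mult_pos_pos) auto
    then show ?thesis
      using one by (simp add: G\<^sub>0_def mult_ac)
  qed
  have one1: "1 \<le> 16 * G"
  proof -
    have "u ^ 6 \<le> u ^ 4"
      using u by (intro power_decreasing) auto
    also have "\<dots> = u\<^sup>2 * u\<^sup>2"
      by (simp flip: power_add)
    also have "\<dots> \<le> u\<^sup>2 * w\<^sup>2"
      using u w by (intro mult_left_mono power_mono) auto
    finally have "\<epsilon>\<^sup>2 * u ^ 6 \<le> \<epsilon>\<^sup>2 * (u\<^sup>2 * w\<^sup>2)"
      by (intro mult_left_mono) auto
    then have "16 / (\<epsilon>\<^sup>2 * (u\<^sup>2 * w\<^sup>2)) \<le> 16 / (\<epsilon>\<^sup>2 * u ^ 6)"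
      using u w \<gamma> by (intro divide_left_mono mult_pos_pos) auto
    then show ?thesis
      using one by (simp add: G_def mult_ac)
  qed
  have m0: "real (rollouts S A \<gamma> h \<epsilon> \<delta> K) \<le> (192 * c + 16) * l * G\<^sub>0"
  proof -
    have "\<gamma> ^ (2 * h) / (u ^ 4 * w\<^sup>2 * \<epsilon>\<^sup>2) \<le> G\<^sub>0"
      unfolding G\<^sub>0_def using \<gamma> u w by (intro divide_right_mono power_le_one) auto
    then have "192 * L * (\<gamma> ^ (2 * h) / (u ^ 4 * w\<^sup>2 * \<epsilon>\<^sup>2)) \<le> 192 * (c * l) * G\<^sub>0"
      using L L0 \<gamma> u w cl by (intro mult_mono) auto
    moreover have "16 * G\<^sub>0 \<le> 16 * G\<^sub>0 * l"
      using G0 l by simp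
    ultimately have "192 * L * (\<gamma> ^ (2 * h) / (u ^ 4 * w\<^sup>2 * \<epsilon>\<^sup>2)) + 1 \<le> 192 * (c * l) * G\<^sub>0 + 16 * G\<^sub>0 * l"
      using one0 by linarith
    moreover have "real (rollouts S A \<gamma> h \<epsilon> \<delta> K) \<le> 192 * L * (\<gamma> ^ (2 * h) / (u ^ 4 * w\<^sup>2 * \<epsilon>\<^sup>2)) + 1"
      using mc_parameter_bounds(3)[OF adm, of K] by (simp only: L_def u_def w_def)
    ultimately show ?thesis
      by (simp add: algebra_simps)
  qed
  have m: "real (next_states S A \<gamma> h \<epsilon> \<delta> K) \<le> (48 * c + 16) * l * G"
  proof -
    have "48 * L * G \<le> 48 * (c * l) * G"
      using L G0 by (intro mult_mono) (use L0 cl in auto)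
    moreover have "16 * G \<le> 16 * G * l"
      using G0 l by simp
    ultimately have "48 * L * G + 1 \<le> 48 * (c * l) * G + 16 * G * l"
      using one1 by linarith
    moreover have "real (next_states S A \<gamma> h \<epsilon> \<delta> K) \<le> 48 * L * G + 1"
      using mc_parameter_bounds(6)[OF adm, of K] by (simp only: L_def u_def G_def)
    ultimately show ?thesis
      by (simp add: algebra_simps)
  qed
  have H: "real (rollout_length S A \<gamma> h \<epsilon> \<delta> K) \<le> (6 * c + 1) * l / u"
  proof -
    have "6 * L / u \<le> 6 * (c * l) / u"
      using L u by (intro divide_right_mono) auto
    moreover have "1 \<le> l / u"
      using l u by simp
    ultimately have "6 * L / u + 1 \<le> 6 * (c * l) / u + l / u"
      by linarith
    moreover have "real (rollout_length S A \<gamma> h \<epsilon> \<delta> K) \<le> 6 * L / u + 1"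
      using mc_parameter_bounds(9)[OF adm, of K] by (simp only: L_def u_def)
    ultimately show ?thesis
      by (simp add: algebra_simps add_divide_distrib)
  qed
  define C\<^sub>1 where "C\<^sub>1 = 4 * \<kappa> * (192 * c + 16) * (6 * c + 1)"
  define C\<^sub>2 where "C\<^sub>2 = 4 * \<kappa> * (48 * c + 16)"
  have C: "0 \<le> C\<^sub>1" "0 \<le> C\<^sub>2"
    using \<kappa> c by (auto simp: C\<^sub>1_def C\<^sub>2_def)
  define X where "X = real S / (real h * \<epsilon>\<^sup>2 * u ^ 6 * w\<^sup>2)"
  define Y where "Y = real S * real A / (\<epsilon>\<^sup>2 * u ^ 7)"
  have XY: "0 \<le> X" "0 \<le> Y"
    using u w \<gamma> by (auto simp: X_def Y_def)
  \<comment> \<open>Three logarithms meet here: from the iterations, the number of rollouts and the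
    rollout length.\<close>
  have "real K * real (rollouts S A \<gamma> h \<epsilon> \<delta> K) * real (rollout_length S A \<gamma> h \<epsilon> \<delta> K) * real S
      \<le> (4 * \<kappa> * l / (real h * u)) * ((192 * c + 16) * l * G\<^sub>0) * ((6 * c + 1) * l / u) * real S"
    using K_le m0 H \<kappa> c l u h G0 by (intro mult_mono mult_nonneg_nonneg divide_nonneg_nonneg) auto
  also have "\<dots> = C\<^sub>1 * l ^ 3 * X"
    using u w \<gamma> h by (simp add: C\<^sub>1_def X_def G\<^sub>0_def field_simps eval_nat_numeral)
  also have "\<dots> \<le> (C\<^sub>1 + C\<^sub>2) * l ^ 3 * X"
    using C XY l by (intro mult_right_mono) auto
  finally have 1: "real K * real (rollouts S A \<gamma> h \<epsilon> \<delta> K) * real (rollout_length S A \<gamma> h \<epsilon> \<delta> K) * real S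
      \<le> (C\<^sub>1 + C\<^sub>2) * l ^ 3 * X" .
  have "real h * real K \<le> 4 * \<kappa> * l / u"
    using K_le h u by (simp add: field_simps)
  then have "real h * real K * real (next_states S A \<gamma> h \<epsilon> \<delta> K) * real S * real A
      \<le> (4 * \<kappa> * l / u) * ((48 * c + 16) * l * G) * real S * real A"
    using m \<kappa> c l u G0 by (intro mult_mono mult_nonneg_nonneg divide_nonneg_nonneg) auto
  also have "\<dots> = C\<^sub>2 * l ^ 2 * Y"
    using u \<gamma> by (simp add: C\<^sub>2_def Y_def G_def field_simps eval_nat_numeral)
  \<comment> \<open>Next-state sampling contributes only two logarithms; \<open>l \<ge> 1\<close>
    raises them to the common power 3.\<close>
  also have "\<dots> \<le> (C\<^sub>1 + C\<^sub>2) * l ^ 3 * Y"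
    using C XY l by (intro mult_right_mono mult_mono power_increasing) auto
  finally have 2: "real h * real K * real (next_states S A \<gamma> h \<epsilon> \<delta> K) * real S * real A
      \<le> (C\<^sub>1 + C\<^sub>2) * l ^ 3 * Y" .
  from add_mono[OF 1 2] have "real K * real (rollouts S A \<gamma> h \<epsilon> \<delta> K) * real (rollout_length S A \<gamma> h \<epsilon> \<delta> K) * real S
      + real h * real K * real (next_states S A \<gamma> h \<epsilon> \<delta> K) * real S * real A
      \<le> (C\<^sub>1 + C\<^sub>2) * l ^ 3 * (X + Y)"
    by (simp only: distrib_left)
  then show ?thesis
    unfolding C\<^sub>1_def C\<^sub>2_def l_def P_def X_def Y_def u_def w_def .
qed

text \<open>The accuracy \<open>b\<close> of the estimates is chosen so that
  \<open>2 * b / ((1 - \<gamma>) * (1 - g))\<close> equals \<open>\<epsilon>\<close>. The factor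
  \<open>1 - g ^ k\<close> on this term and the factor \<open>g\<close> on the stepsize contribution
  are bounded by 1.\<close>

lemma inexact_hpmd_iterates:
  assumes ih: "inexact_hpmd D X \<phi> M H h (\<lambda>k. discount D ^ (2 * h * (k + 1))) K pol eta" and h: "1 \<le> h"
    and run: "(qs, n) \<in> set_pmf (hpmd_run D M H h pol K)" and "0 < \<epsilon>"
    and Q: "\<And>i s a. i < K \<Longrightarrow> s \<in> states D \<Longrightarrow> a \<in> actions D \<Longrightarrow>
      \<bar>(qs ! i) s a - qval D ((opt_backup D ^^ (h - 1)) (value_fun D (pol (take i qs)))) s a\<bar>
      \<le> \<epsilon> * (1 - discount D) * (1 - discount D ^ h) / 2"
    and k: "k \<le> K"
  shows "sup_norm D (\<lambda>s. opt_value D s - value_fun D (pol (take k qs)) s)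
    \<le> discount D ^ (h * k) * (sup_norm D (\<lambda>s. opt_value D s - value_fun D (pol []) s) +
        (1 - discount D ^ (h * k)) / ((1 - discount D) * (1 - discount D ^ h))) + \<epsilon>"
proof -
  interpret fin_mdp D
    using ih by unfold_locales (simp add: inexact_hpmd_def)
  define g where "g = \<gamma> ^ h"
  have g: "0 < g" "g < 1"
    using one_minus_power_bounds[OF \<gamma> h] by (auto simp: g_def)
  define x where "x k = sup_norm D (\<lambda>s. opt_value D s - value_fun D (pol (take k qs)) s)" for k
  define b where "b = \<epsilon> * (1 - \<gamma>) * (1 - g) / 2"
  have gk: "g ^ k = \<gamma> ^ (h * k)" for k
    by (simp add: g_def power_mult)
  have rec: "x (Suc i) \<le> g * x i + (2 * b + g ^ (2 * (i + 1))) * (1 / (1 - \<gamma>))" if "i < K" for i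
  proof -
    have "x (Suc i) \<le> \<gamma> ^ h * x i + (2 * b + \<gamma> ^ (2 * h * (i + 1))) / (1 - \<gamma>)"
      unfolding x_def b_def g_def using \<gamma>
      by (intro inexact_hpmd_step[OF ih _ h run that] Q[OF that]) auto
    moreover have "\<gamma> ^ (2 * h * (i + 1)) = g ^ (2 * (i + 1))"
      unfolding g_def power_mult[symmetric] by (simp add: algebra_simps)
    ultimately show ?thesis
      by (simp add: g_def)
  qed
  have "x k \<le> g ^ k * (x 0 + 1 / (1 - \<gamma>) * (g * (1 - g ^ k) / (1 - g)))
      + 1 / (1 - \<gamma>) * (2 * b) * ((1 - g ^ k) / (1 - g))"
    using g rec k by (intro discounted_recursion) auto
  also have "1 / (1 - \<gamma>) * (2 * b) * ((1 - g ^ k) / (1 - g)) = \<epsilon> * (1 - g ^ k)"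
    using \<gamma> g by (simp add: b_def)
  also have "\<dots> \<le> \<epsilon> * 1"
    using g \<open>0 < \<epsilon>\<close> by (intro mult_left_mono) auto
  also have "1 / (1 - \<gamma>) * (g * (1 - g ^ k) / (1 - g)) \<le> (1 - g ^ k) / ((1 - \<gamma>) * (1 - g))"
  proof -
    have "g * (1 - g ^ k) \<le> 1 * (1 - g ^ k)"
      using g by (intro mult_right_mono) (auto simp: power_le_one)
    then have "g * (1 - g ^ k) / ((1 - \<gamma>) * (1 - g)) \<le> 1 * (1 - g ^ k) / ((1 - \<gamma>) * (1 - g))"
      using \<gamma> g by (intro divide_right_mono) auto
    then show ?thesis by simp
  qed
  finally have "x k \<le> g ^ k * (x 0 + (1 - g ^ k) / ((1 - \<gamma>) * (1 - g))) + \<epsilon>"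
    using g by simp
  then show ?thesis
    unfolding x_def gk by (simp add: g_def)
qed

section \<open>Runs with the chosen parameters\<close>

locale tuned_hpmd =
  fixes D :: "('s, 'a) mdp" and X \<phi> pol eta and \<epsilon> \<delta> :: real and h K :: nat and mc :: "nat \<Rightarrow> nat" and H :: nat
  assumes pos: "1 \<le> h" "0 < \<epsilon>" "0 < \<delta>"
    and mc: "mc = (\<lambda>j. if j = 0 then rollouts (card (states D)) (card (actions D)) (discount D) h \<epsilon> \<delta> K
      else next_states (card (states D)) (card (actions D)) (discount D) h \<epsilon> \<delta> K)"
    and H: "H = rollout_length (card (states D)) (card (actions D)) (discount D) h \<epsilon> \<delta> K"
    and hpmd: "inexact_hpmd D X \<phi> mc H h (\<lambda>k. discount D ^ (2 * h * (k + 1))) K pol eta"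
begin

sublocale fin_mdp D
  using hpmd by unfold_locales (simp add: inexact_hpmd_def)

lemma adm: "admissible (card (states D)) (card (actions D)) \<gamma> h \<epsilon> \<delta>"
  using pos \<gamma> by (simp add: admissible_def Suc_le_eq card_gt_0_iff)

lemma iterate_policy:
  assumes "k \<le> K" "(qs, n) \<in> set_pmf (hpmd_run D mc H h pol k)"
  shows "pol qs \<in> policies D"
  using inexact_hpmd_policies[OF hpmd _ assms(2,1)] \<gamma> by simp

lemma run_count:
  assumes "(qs, n) \<in> set_pmf (hpmd_run D mc H h pol K)"
  shows "n \<le> K * mc 0 * H * card (states D) + h * K * mc 1 * card (states D) * card (actions D)"
proof -
  have "n \<le> K * (mc 0 * H * card (states D) + h * (mc 1 * card (states D) * card (actions D)))"
    using _ order_refl assms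
  proof (rule hpmd_run_count)
    fix k qs n q c
    assume k: "k < K" and qs: "(qs, n) \<in> set_pmf (hpmd_run D mc H h pol k)"
      and q: "(q, c) \<in> set_pmf (mc_Q D (pol qs) mc H h (states D))"
    interpret mdp_policy D "pol qs"
      using iterate_policy[of k] k qs by unfold_locales auto
    show "c \<le> mc 0 * H * card (states D) + h * (mc 1 * card (states D) * card (actions D))"
      using pos(1) _ q by (rule mc_Q_count) (simp add: mc)
  qed
  then show ?thesis
    by (simp add: algebra_simps)
qed

text \<open>On the support of the run the error bound follows with certainty from good estimates at
  all iterations, so it fails at most with the probability that some estimate is bad.\<close>

lemma run_error_prob:
  "1 - \<delta> \<le> measure_pmf.prob (hpmd_run D mc H h pol K)
     {(qs, n). \<forall>k\<le>K. sup_norm D (\<lambda>s. opt_value D s - value_fun D (pol (take k qs)) s)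
        \<le> \<gamma> ^ (h * k) * (sup_norm D (\<lambda>s. opt_value D s - value_fun D (pol []) s) +
            (1 - \<gamma> ^ (h * k)) / ((1 - \<gamma>) * (1 - \<gamma> ^ h))) + \<epsilon>}"
    (is "_ \<le> measure_pmf.prob ?run ?E")
proof -
  define good where "good q qs \<longleftrightarrow> (\<forall>s\<in>states D. \<forall>a\<in>actions D.
      \<bar>q s a - qval D ((opt_backup D ^^ (h - 1)) (value_fun D (pol qs))) s a\<bar> \<le> \<epsilon> * (1 - \<gamma>) * (1 - \<gamma> ^ h) / 2)"
    for q qs
  define \<tau>\<^sub>0 where "\<tau>\<^sub>0 = \<epsilon> * (1 - \<gamma>) * (1 - \<gamma> ^ h) / (8 * \<gamma> ^ h)"
  define \<tau> where "\<tau> = \<epsilon> * (1 - \<gamma>)\<^sup>2 / 4"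
  define p\<^sub>0 where "p\<^sub>0 = 2 * exp (- 2 * real (mc 0) * (\<tau>\<^sub>0 * (1 - \<gamma>))\<^sup>2)"
  define p where "p = 2 * exp (- 2 * real (mc 1) * (\<tau> * (1 - \<gamma>))\<^sup>2)"
  define P where "P = real (card (states D)) * p\<^sub>0 + real h * (real (card (states D)) * real (card (actions D)) * p)"
  have \<tau>: "0 \<le> \<tau>\<^sub>0" "0 \<le> \<tau>"
    using pos \<gamma> one_minus_power_bounds[OF \<gamma> pos(1)] by (auto simp: \<tau>\<^sub>0_def \<tau>_def)
  have "0 \<le> P"
    by (simp add: P_def p\<^sub>0_def p_def)
  have "measure_pmf.prob ?run {(qs, n). \<not> (\<forall>i<K. good (qs ! i) (take i qs))} \<le> real K * P"
    using _ \<open>0 \<le> P\<close> order_refl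
  proof (rule hpmd_run_failure)
    fix k qs n assume k: "k < K" and qs: "(qs, n) \<in> set_pmf (hpmd_run D mc H h pol k)"
    interpret mdp_policy D "pol qs"
      using iterate_policy[of k] k qs by unfold_locales auto
    have err: "mc_error H \<tau>\<^sub>0 \<tau> h \<le> \<epsilon> * (1 - \<gamma>) * (1 - \<gamma> ^ h) / 2"
      unfolding H \<tau>\<^sub>0_def \<tau>_def using adm by (rule mc_error_le)
    \<comment> \<open>The planning error fits into the budget, so an estimate that is not good
      violates the planning guarantee.\<close>
    have bad: "\<not> (\<forall>s\<in>states D. \<forall>a\<in>actions D.
        \<bar>q s a - qval D ((opt_backup D ^^ (h - 1)) (value_fun D (pol qs))) s a\<bar> \<le> mc_error H \<tau>\<^sub>0 \<tau> h)"
      if "\<not> good q qs" for q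
      using that err unfolding good_def by (meson order_trans)
    have "measure_pmf.prob (mc_Q D (pol qs) mc H h (states D)) {(q, c). \<not> good q qs} \<le>
        measure_pmf.prob (mc_Q D (pol qs) mc H h (states D)) {(Q, n). \<not> (\<forall>s\<in>states D. \<forall>a\<in>actions D.
         \<bar>Q s a - qval D ((opt_backup D ^^ (h - 1)) (value_fun D (pol qs))) s a\<bar> \<le> mc_error H \<tau>\<^sub>0 \<tau> h)}"
      using bad by (intro measure_pmf.finite_measure_mono subsetI) (simp_all only: case_prod_unfold mem_Collect_eq not_False_eq_True sets_measure_pmf UNIV_I)
    also have "\<dots> \<le> P"
      unfolding P_def p\<^sub>0_def p_def using pos(1) mc_parameter_ge_1 \<tau>
      by (intro mc_Q_error) (auto simp: mc)
    finally show "measure_pmf.prob (mc_Q D (pol qs) mc H h (states D)) {(q, c). \<not> good q qs} \<le> P" .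
  qed
  also have "real K * P \<le> \<delta>"
    unfolding P_def
  proof (rule total_failure_le[OF adm])
    show "p\<^sub>0 \<le> 2 / (problem_size (card (states D)) (card (actions D)) \<gamma> h \<epsilon> \<delta> + real K) ^ 6"
      using rollout_exponent[OF adm, of K] by (simp add: p\<^sub>0_def \<tau>\<^sub>0_def mc)
    show "p \<le> 2 / (problem_size (card (states D)) (card (actions D)) \<gamma> h \<epsilon> \<delta> + real K) ^ 6"
      using next_states_exponent[OF adm, of K] by (simp add: p_def \<tau>_def mc)
  qed
  finally have fail: "measure_pmf.prob ?run {(qs, n). \<not> (\<forall>i<K. good (qs ! i) (take i qs))} \<le> \<delta>" .
  have "1 - measure_pmf.prob ?run ?E = measure_pmf.prob ?run (- ?E)"
    using measure_pmf.prob_compl[of ?E ?run] by (simp add: Compl_eq_Diff_UNIV)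
  also have "\<dots> \<le> measure_pmf.prob ?run {(qs, n). \<not> (\<forall>i<K. good (qs ! i) (take i qs))}"
  proof (rule measure_pmf.finite_measure_mono_AE)
    \<comment> \<open>The update rule constrains only runs of positive probability, so the inclusion
      of events holds almost everywhere.\<close>
    show "AE x in ?run. x \<in> - ?E \<longrightarrow> x \<in> {(qs, n). \<not> (\<forall>i<K. good (qs ! i) (take i qs))}"
      unfolding AE_measure_pmf_iff
    proof (intro ballI impI)
      fix x assume x: "x \<in> set_pmf ?run" "x \<in> - ?E"
      obtain qs n where qs: "x = (qs, n)" by (cases x)
      have "\<not> (\<forall>i<K. good (qs ! i) (take i qs))"
      proof
        assume "\<forall>i<K. good (qs ! i) (take i qs)"
        then have Q: "\<bar>(qs ! i) s a - qval D ((opt_backup D ^^ (h - 1)) (value_fun D (pol (take i qs)))) s a\<bar>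
            \<le> \<epsilon> * (1 - \<gamma>) * (1 - \<gamma> ^ h) / 2" if "i < K" "s \<in> states D" "a \<in> actions D" for i s a
          using that by (simp add: good_def)
        have "x \<in> ?E"
          using inexact_hpmd_iterates[OF hpmd pos(1) x(1)[unfolded qs] pos(2) Q] by (simp add: qs)
        with x(2) show False by blast
      qed
      then show "x \<in> {(qs, n). \<not> (\<forall>i<K. good (qs ! i) (take i qs))}"
        by (simp add: qs)
    qed
  qed simp
  finally show ?thesis
    using fail by linarith
qed

lemma run_count_complexity:
  assumes \<kappa>: "1 \<le> \<kappa>" and K: "iter_threshold \<gamma> h \<epsilon> < real K" "real K \<le> \<kappa> * iter_threshold \<gamma> h \<epsilon>"
    and n: "(qs, n) \<in> set_pmf (hpmd_run D mc H h pol K)"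
  defines "c \<equiv> ln (5 * \<kappa>) + 2"
  shows "real n \<le> (4 * \<kappa> * (192 * c + 16) * (6 * c + 1) + 4 * \<kappa> * (48 * c + 16)) *
      ln (problem_size (card (states D)) (card (actions D)) \<gamma> h \<epsilon> \<delta>) ^ 3 *
      (real (card (states D)) / (real h * \<epsilon> ^ 2 * (1 - \<gamma>) ^ 6 * (1 - \<gamma> ^ h) ^ 2) +
       real (card (states D)) * real (card (actions D)) / (\<epsilon> ^ 2 * (1 - \<gamma>) ^ 7))"
proof -
  have "real n \<le> real (K * mc 0 * H * card (states D) + h * K * mc 1 * card (states D) * card (actions D))"
    using run_count[OF n] by (simp only: of_nat_le_iff)
  then show ?thesis
    using sample_complexity_bound[OF adm \<kappa> K, folded c_def] by (simp add: mc H)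
qed

end

theorem theorem5p4:
  "\<exists>M0 M H :: mc_parameter.
     (\<forall>S A \<gamma> h \<epsilon> \<delta> K. 1 \<le> M0 S A \<gamma> h \<epsilon> \<delta> K \<and> 1 \<le> M S A \<gamma> h \<epsilon> \<delta> K \<and> 1 \<le> H S A \<gamma> h \<epsilon> \<delta> K) \<and>
     soft_O M0 (\<lambda>\<gamma> h \<epsilon>. \<gamma> ^ (2 * h) / ((1 - \<gamma>) ^ 4 * (1 - \<gamma> ^ h) ^ 2 * \<epsilon> ^ 2)) \<and>
     soft_O M (\<lambda>\<gamma> h \<epsilon>. 1 / ((1 - \<gamma>) ^ 6 * \<epsilon> ^ 2)) \<and>
     (\<forall>(D :: ('s, 'a) mdp) X \<phi> pol eta S A \<gamma> h \<epsilon> \<delta> K m0 m H' mc.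
        S = card (states D) \<and> A = card (actions D) \<and> \<gamma> = discount D \<and>
        1 \<le> h \<and> 0 < \<epsilon> \<and> 0 < \<delta> \<and> iter_threshold \<gamma> h \<epsilon> < real K \<and>
        m0 = M0 S A \<gamma> h \<epsilon> \<delta> K \<and> m = M S A \<gamma> h \<epsilon> \<delta> K \<and> H' = H S A \<gamma> h \<epsilon> \<delta> K \<and>
        mc = (\<lambda>j. if j = 0 then m0 else m) \<and>
        inexact_hpmd D X \<phi> mc H' h (\<lambda>k. \<gamma> ^ (2 * h * (k + 1))) K pol eta \<longrightarrow>
        measure_pmf.prob (hpmd_run D mc H' h pol K)
          {(qs, n). \<forall>k\<le>K.
             sup_norm D (\<lambda>s. opt_value D s - value_fun D (pol (take k qs)) s)
             \<le> \<gamma> ^ (h * k) *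
                 (sup_norm D (\<lambda>s. opt_value D s - value_fun D (pol []) s) +
                  (1 - \<gamma> ^ (h * k)) / ((1 - \<gamma>) * (1 - \<gamma> ^ h))) + \<epsilon>}
        \<ge> 1 - \<delta> \<and>
        (\<forall>(qs, n)\<in>set_pmf (hpmd_run D mc H' h pol K).
           n \<le> K * m0 * H' * S + h * K * m * S * A)) \<and>
     (\<forall>\<kappa>::real. 1 \<le> \<kappa> \<longrightarrow> (\<exists>(C::real) (p::nat).
      \<forall>(D :: ('s, 'a) mdp) X \<phi> pol eta S A \<gamma> h \<epsilon> \<delta> K m0 m H' mc.
        S = card (states D) \<and> A = card (actions D) \<and> \<gamma> = discount D \<and>
        1 \<le> h \<and> 0 < \<epsilon> \<and> 0 < \<delta> \<and> iter_threshold \<gamma> h \<epsilon> < real K \<and>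
        m0 = M0 S A \<gamma> h \<epsilon> \<delta> K \<and> m = M S A \<gamma> h \<epsilon> \<delta> K \<and> H' = H S A \<gamma> h \<epsilon> \<delta> K \<and>
        mc = (\<lambda>j. if j = 0 then m0 else m) \<and>
        inexact_hpmd D X \<phi> mc H' h (\<lambda>k. \<gamma> ^ (2 * h * (k + 1))) K pol eta \<and>
        real K \<le> \<kappa> * iter_threshold \<gamma> h \<epsilon> \<longrightarrow>
        (\<forall>(qs, n)\<in>set_pmf (hpmd_run D mc H' h pol K).
           real n \<le> C * ln (problem_size S A \<gamma> h \<epsilon> \<delta>) ^ p *
             (real S / (real h * \<epsilon> ^ 2 * (1 - \<gamma>) ^ 6 * (1 - \<gamma> ^ h) ^ 2) +
              real S * real A / (\<epsilon> ^ 2 * (1 - \<gamma>) ^ 7)))))"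
proof (rule exI[of _ rollouts], rule exI[of _ next_states], rule exI[of _ rollout_length], intro conjI)
  show "\<forall>S A \<gamma> h \<epsilon> \<delta> K. 1 \<le> rollouts S A \<gamma> h \<epsilon> \<delta> K \<and> 1 \<le> next_states S A \<gamma> h \<epsilon> \<delta> K \<and>
      1 \<le> rollout_length S A \<gamma> h \<epsilon> \<delta> K"
    by (intro allI conjI mc_parameter_ge_1)
next
  show "soft_O rollouts (\<lambda>\<gamma> h \<epsilon>. \<gamma> ^ (2 * h) / ((1 - \<gamma>) ^ 4 * (1 - \<gamma> ^ h) ^ 2 * \<epsilon> ^ 2))"
    by (rule soft_O_rollouts)
next
  show "soft_O next_states (\<lambda>\<gamma> h \<epsilon>. 1 / ((1 - \<gamma>) ^ 6 * \<epsilon> ^ 2))"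
    by (rule soft_O_next_states)
next
  show "\<forall>(D :: ('s, 'a) mdp) X \<phi> pol eta S A \<gamma> h \<epsilon> \<delta> K m0 m H' mc.
        S = card (states D) \<and> A = card (actions D) \<and> \<gamma> = discount D \<and>
        1 \<le> h \<and> 0 < \<epsilon> \<and> 0 < \<delta> \<and> iter_threshold \<gamma> h \<epsilon> < real K \<and>
        m0 = rollouts S A \<gamma> h \<epsilon> \<delta> K \<and> m = next_states S A \<gamma> h \<epsilon> \<delta> K \<and>
        H' = rollout_length S A \<gamma> h \<epsilon> \<delta> K \<and> mc = (\<lambda>j. if j = 0 then m0 else m) \<and>
        inexact_hpmd D X \<phi> mc H' h (\<lambda>k. \<gamma> ^ (2 * h * (k + 1))) K pol eta \<longrightarrow>
        measure_pmf.prob (hpmd_run D mc H' h pol K)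
          {(qs, n). \<forall>k\<le>K.
             sup_norm D (\<lambda>s. opt_value D s - value_fun D (pol (take k qs)) s)
             \<le> \<gamma> ^ (h * k) *
                 (sup_norm D (\<lambda>s. opt_value D s - value_fun D (pol []) s) +
                  (1 - \<gamma> ^ (h * k)) / ((1 - \<gamma>) * (1 - \<gamma> ^ h))) + \<epsilon>}
        \<ge> 1 - \<delta> \<and>
        (\<forall>(qs, n)\<in>set_pmf (hpmd_run D mc H' h pol K).
           n \<le> K * m0 * H' * S + h * K * m * S * A)"
  proof (intro allI impI; elim conjE; hypsubst_thin)
    fix D :: "('s, 'a) mdp" and X \<phi> pol eta h \<epsilon> \<delta> K
    let ?rol = "rollouts (card (states D)) (card (actions D)) (discount D) h \<epsilon> \<delta> K"
    let ?nxt = "next_states (card (states D)) (card (actions D)) (discount D) h \<epsilon> \<delta> K"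
    let ?H = "rollout_length (card (states D)) (card (actions D)) (discount D) h \<epsilon> \<delta> K"
    let ?par = "\<lambda>j::nat. if j = 0 then ?rol else ?nxt"
    assume "1 \<le> h" "0 < \<epsilon>" "0 < \<delta>"
      "inexact_hpmd D X \<phi> ?par ?H h (\<lambda>k. discount D ^ (2 * h * (k + 1))) K pol eta"
    then interpret tuned_hpmd D X \<phi> pol eta \<epsilon> \<delta> h K ?par ?H
      by unfold_locales auto
    show "1 - \<delta> \<le> measure_pmf.prob (hpmd_run D ?par ?H h pol K)
          {(qs, n). \<forall>k\<le>K.
             sup_norm D (\<lambda>s. opt_value D s - value_fun D (pol (take k qs)) s)
             \<le> discount D ^ (h * k) *
                 (sup_norm D (\<lambda>s. opt_value D s - value_fun D (pol []) s) +
                  (1 - discount D ^ (h * k)) / ((1 - discount D) * (1 - discount D ^ h))) + \<epsilon>} \<and>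
        (\<forall>(qs, n)\<in>set_pmf (hpmd_run D ?par ?H h pol K).
           n \<le> K * ?rol * ?H * card (states D) + h * K * ?nxt * card (states D) * card (actions D))"
      using run_error_prob run_count by auto
  qed
next
  show "\<forall>\<kappa>::real. 1 \<le> \<kappa> \<longrightarrow> (\<exists>(C::real) (p::nat).
      \<forall>(D :: ('s, 'a) mdp) X \<phi> pol eta S A \<gamma> h \<epsilon> \<delta> K m0 m H' mc.
        S = card (states D) \<and> A = card (actions D) \<and> \<gamma> = discount D \<and>
        1 \<le> h \<and> 0 < \<epsilon> \<and> 0 < \<delta> \<and> iter_threshold \<gamma> h \<epsilon> < real K \<and>
        m0 = rollouts S A \<gamma> h \<epsilon> \<delta> K \<and> m = next_states S A \<gamma> h \<epsilon> \<delta> K \<and>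
        H' = rollout_length S A \<gamma> h \<epsilon> \<delta> K \<and> mc = (\<lambda>j. if j = 0 then m0 else m) \<and>
        inexact_hpmd D X \<phi> mc H' h (\<lambda>k. \<gamma> ^ (2 * h * (k + 1))) K pol eta \<and>
        real K \<le> \<kappa> * iter_threshold \<gamma> h \<epsilon> \<longrightarrow>
        (\<forall>(qs, n)\<in>set_pmf (hpmd_run D mc H' h pol K).
           real n \<le> C * ln (problem_size S A \<gamma> h \<epsilon> \<delta>) ^ p *
             (real S / (real h * \<epsilon> ^ 2 * (1 - \<gamma>) ^ 6 * (1 - \<gamma> ^ h) ^ 2) +
              real S * real A / (\<epsilon> ^ 2 * (1 - \<gamma>) ^ 7))))"
  proof (intro allI impI)
    fix \<kappa> :: real assume \<kappa>: "1 \<le> \<kappa>"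
    \<comment> \<open>\<open>c\<close>, and with it the hidden constant, depends on
      \<open>\<kappa>\<close> alone and is fixed before the process, the mirror map and the other
      parameters.\<close>
    define c where "c = ln (5 * \<kappa>) + 2"
    let ?C = "4 * \<kappa> * (192 * c + 16) * (6 * c + 1) + 4 * \<kappa> * (48 * c + 16)"
    show "\<exists>(C::real) (p::nat).
      \<forall>(D :: ('s, 'a) mdp) X \<phi> pol eta S A \<gamma> h \<epsilon> \<delta> K m0 m H' mc.
        S = card (states D) \<and> A = card (actions D) \<and> \<gamma> = discount D \<and>
        1 \<le> h \<and> 0 < \<epsilon> \<and> 0 < \<delta> \<and> iter_threshold \<gamma> h \<epsilon> < real K \<and>
        m0 = rollouts S A \<gamma> h \<epsilon> \<delta> K \<and> m = next_states S A \<gamma> h \<epsilon> \<delta> K \<and>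
        H' = rollout_length S A \<gamma> h \<epsilon> \<delta> K \<and> mc = (\<lambda>j. if j = 0 then m0 else m) \<and>
        inexact_hpmd D X \<phi> mc H' h (\<lambda>k. \<gamma> ^ (2 * h * (k + 1))) K pol eta \<and>
        real K \<le> \<kappa> * iter_threshold \<gamma> h \<epsilon> \<longrightarrow>
        (\<forall>(qs, n)\<in>set_pmf (hpmd_run D mc H' h pol K).
           real n \<le> C * ln (problem_size S A \<gamma> h \<epsilon> \<delta>) ^ p *
             (real S / (real h * \<epsilon> ^ 2 * (1 - \<gamma>) ^ 6 * (1 - \<gamma> ^ h) ^ 2) +
              real S * real A / (\<epsilon> ^ 2 * (1 - \<gamma>) ^ 7)))"
    proof (rule exI[of _ ?C], rule exI[of _ 3], intro allI impI; elim conjE; hypsubst_thin)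
      fix D :: "('s, 'a) mdp" and X \<phi> pol eta h \<epsilon> \<delta> K
      let ?rol = "rollouts (card (states D)) (card (actions D)) (discount D) h \<epsilon> \<delta> K"
      let ?nxt = "next_states (card (states D)) (card (actions D)) (discount D) h \<epsilon> \<delta> K"
      let ?H = "rollout_length (card (states D)) (card (actions D)) (discount D) h \<epsilon> \<delta> K"
      let ?par = "\<lambda>j::nat. if j = 0 then ?rol else ?nxt"
      assume "1 \<le> h" "0 < \<epsilon>" "0 < \<delta>"
        "inexact_hpmd D X \<phi> ?par ?H h (\<lambda>k. discount D ^ (2 * h * (k + 1))) K pol eta"
        and K: "iter_threshold (discount D) h \<epsilon> < real K" "real K \<le> \<kappa> * iter_threshold (discount D) h \<epsilon>"
      then interpret tuned_hpmd D X \<phi> pol eta \<epsilon> \<delta> h K ?par ?H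
        by unfold_locales auto
      show "\<forall>(qs, n)\<in>set_pmf (hpmd_run D ?par ?H h pol K).
           real n \<le> ?C * ln (problem_size (card (states D)) (card (actions D)) (discount D) h \<epsilon> \<delta>) ^ 3 *
             (real (card (states D)) / (real h * \<epsilon> ^ 2 * (1 - discount D) ^ 6 * (1 - discount D ^ h) ^ 2) +
              real (card (states D)) * real (card (actions D)) / (\<epsilon> ^ 2 * (1 - discount D) ^ 7))"
        using run_count_complexity[OF \<kappa> K, folded c_def] by auto
    qed
  qed
qed

end
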